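(* Consider the rescaled $k$-dimensional process $Z^{(n)}(t)$, the Markov chain $(X^{(n)}_i)_{i\in\mathbb{N}}$ and the Poisson process $N^{(n)}$ defined in the context, with parameters $\lambda>0$, $\gamma>0$, $\alpha\in(0,1)$, transition matrix $P$ and stationary distribution $\pi$. Let $\{\mathcal{X}^\alpha(t)=(\mathcal{X}^\alpha_1(t),\ldots,\mathcal{X}^\alpha_k(t)),\ t\in[0,1]\}$ be a continuous-time inhomogeneous Markov chain with values in $\mathcal{S}=\{0,\ldots,K\}^k$, with infinitesimal generator matrix at time $t$ equal to $\frac{1}{1-\alpha}(1-t)^{\frac{\alpha}{1-\alpha}}\lambda(P-I)$ and with $\mathcal{X}^\alpha(0)\sim\pi$. Let $\{\nu^\alpha_j(t),\ t\in[0,1]\}$, $j=1,\ldots,k$, be $k$ independent Poisson processes with the same intensity $\frac{\lambda}{1-\alpha}$, independent of $\{\mathcal{X}^\alpha(t),\ t\in[0,1]\}$. Fix $t\in[0,1]$. (Fast arrivals) If $\gamma>\alpha$ then, as $n\to\infty$, $$\mathcal{D}\left(\left.\left(\frac{Z^{(n)}(t)}{n^{\gamma-\alpha}},\,X^{(n)}_{N^{(n)}_t}\right)\right|X^{(n)}_0\right)\longrightarrow \mathcal{D}\left(\left.\left(\frac{\lambda}{1-\alpha}\int_{1-t^{1-\alpha}}^1\mathcal{X}^\alpha(v)\,dv,\ \mathcal{X}^\alpha(1)\right)\right|\mathcal{X}^\alpha(1-t^{1-\alpha})\right).$$ (Equilibrium) If $\gamma=\alpha$ then, as $n\to\infty$,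 $$\mathcal{D}\left(\left.\left(Z^{(n)}(t),\,X^{(n)}_{N^{(n)}_t}\right)\right|X^{(n)}_0\right)\longrightarrow \mathcal{D}\left(\left.\left(\left(\int_{1-t^{1-\alpha}}^1\mathcal{X}^\alpha_j(v)\,\nu^\alpha_j(dv)\right)_{j=1,\ldots,k},\ \mathcal{X}^\alpha(1)\right)\right|\mathcal{X}^\alpha(1-t^{1-\alpha})\right).$$ Here the convergence of conditional distributions means: for every $x\in\mathcal{S}$ with $\pi(x)>0$, the conditional law of the left-hand pair given $X^{(n)}_0=x$ converges weakly to the conditional law of the right-hand pair given $\mathcal{X}^\alpha(1-t^{1-\alpha})=x$.
   Context: Let $k,K\in\mathbb{N}^*$ and $\mathcal{S}=\{0,\ldots,K\}^k$. Let $P=(p(x,x'))_{(x,x')\in\mathcal{S}^2}$ be a stochastic matrix (the transition matrix of a stationary Markov chain on $\mathcal{S}$) with stationary distribution $\pi=(\pi(x))_{x\in\mathcal{S}}$; $I$ is the identity matrix. Let $\lambda>0$, $\gamma>0$, $\alpha\in(0,1)$. Service times: $(L_{ij})_{i\in\mathbb{N},\,j=1,\ldots,k}$ are independent nonnegative random variables such that the vectors $(L_{i1},\ldots,L_{ik})$, $i\in\mathbb{N}$, are i.i.d. (the entries $L_{i1},\ldots,L_{ik}$ may have different distributions). With $L_j$ denoting a generic copy of $L_{ij}$, one assumes $\mathbb{P}(L_j>t)\sim t^{-\alpha}$ as $t\to\infty$ for every $j=1,\ldots,k$. Rescaled model, for each integer $n\ge1$: - $\{N^{(n)}_t,\ t\ge0\}$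 is a Poisson process with intensity $\lambda_n=\lambda n^\gamma$ and jump times $(T^n_i)_{i\ge1}$ (and $T^n_0=0$); - $(X^{(n)}_i)_{i\in\mathbb{N}}$, with $X^{(n)}_i=(X^{(n)}_{i1},\ldots,X^{(n)}_{ik})\in\mathcal{S}$, is a stationary Markov chain with transition matrix $P_n=P/n^\gamma+(1-1/n^\gamma)I$ and $X^{(n)}_0\sim\pi$; - the service times are $L^{(n)}_{ij}=L_{ij}/n$; - the Poisson process, the Markov chain and the family of service times are mutually independent. The process $Z^{(n)}(t)=(Z^{(n)}_1(t),\ldots,Z^{(n)}_k(t))$ is defined by $$Z^{(n)}_j(t)=\sum_{i=1}^{N^{(n)}_t}X^{(n)}_{ij}\,\mathbf{1}_{[t<L^{(n)}_{ij}+T^n_i]},\qquad j=1,\ldots,k,\ t\ge0.$$ For a Poisson process $\nu$, $\int_a^b f(v)\,\nu(dv)$ denotes the sum of $f(v)$ over the jump times $v$ of $\nu$ in $(a,b]$. *)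

theory Defs
  imports "HOL-Probability.Probability"
begin

section \<open>State space, stochastic matrices and generated sigma-algebras\<close>

text \<open>The set \<open>{0, \<dots>, K}\<^sup>k\<close>, with \<open>k = CARD('k)\<close>, embedded in Euclidean space;
  as a subspace it is discrete.\<close>

definition state_space :: "nat \<Rightarrow> (real ^ 'k) set" where
  "state_space K = {x. \<forall>j. x $ j \<in> real ` {0..K}}"

definition stochastic_matrix_on :: "'s set \<Rightarrow> ('s \<Rightarrow> 's \<Rightarrow> real) \<Rightarrow> bool" where
  "stochastic_matrix_on S p \<longleftrightarrow>
     (\<forall>x\<in>S. \<forall>y\<in>S. 0 \<le> p x y) \<and> (\<forall>x\<in>S. (\<Sum>y\<in>S. p x y) = 1)"

definition stationary_distribution_on ::
  "'s set \<Rightarrow> ('s \<Rightarrow> 's \<Rightarrow> real) \<Rightarrow> ('s \<Rightarrow> real) \<Rightarrow> bool" where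
  "stationary_distribution_on S p \<pi> \<longleftrightarrow>
     (\<forall>x\<in>S. 0 \<le> \<pi> x) \<and> (\<Sum>x\<in>S. \<pi> x) = 1 \<and> (\<forall>y\<in>S. (\<Sum>x\<in>S. \<pi> x * p x y) = \<pi> y)"

definition identity_matrix :: "'s \<Rightarrow> 's \<Rightarrow> real" where
  "identity_matrix x y = of_bool (x = y)"

text \<open>The events generated by a family \<open>Y i\<close>, \<open>i \<in> I\<close>, of random variables with values in \<open>B\<close>;
  processes are independent when these sigma-algebras are.\<close>

definition generated_events ::
  "'a measure \<Rightarrow> 'b measure \<Rightarrow> ('i \<Rightarrow> 'a \<Rightarrow> 'b) \<Rightarrow> 'i set \<Rightarrow> 'a set set" where
  "generated_events M B Y I =
     sigma_sets (space M) {Y i -` A \<inter> space M | i A. i \<in> I \<and> A \<in> sets B}"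


section \<open>Poisson processes\<close>

text \<open>\<open>I\<close> is a time interval with left end point \<open>0\<close>. The increments are natural numbers, and the
  truncated subtraction is harmless because the paths are nondecreasing.\<close>

definition poisson_process ::
  "'a measure \<Rightarrow> real set \<Rightarrow> real \<Rightarrow> (real \<Rightarrow> 'a \<Rightarrow> nat) \<Rightarrow> bool" where
  "poisson_process M I r N \<longleftrightarrow>
     (\<forall>t\<in>I. N t \<in> measurable M (count_space UNIV)) \<and>
     (\<forall>\<omega>\<in>space M. N 0 \<omega> = 0 \<and> mono_on I (\<lambda>t. N t \<omega>) \<and>
        (\<forall>t\<in>I. continuous (at t within (I \<inter> {t..})) (\<lambda>t. N t \<omega>))) \<and>
     (\<forall>s\<in>I. \<forall>t\<in>I. s < t \<longrightarrow>
        distr M (count_space UNIV) (\<lambda>\<omega>. N t \<omega> - N s \<omega>) = measure_pmf (poisson_pmf (r * (t - s)))) \<and>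
     (\<forall>m u. (\<forall>i\<le>m. u i \<in> I) \<and> (\<forall>i<m. u i \<le> u (Suc i)) \<longrightarrow>
        prob_space.indep_vars M (\<lambda>_. count_space UNIV)
          (\<lambda>i \<omega>. N (u (Suc i)) \<omega> - N (u i) \<omega>) {..<m})"

text \<open>The \<open>i\<close>-th jump time of a counting process; it is \<open>0\<close> for \<open>i = 0\<close>.\<close>

definition jump_time :: "(real \<Rightarrow> 'a \<Rightarrow> nat) \<Rightarrow> nat \<Rightarrow> 'a \<Rightarrow> real" where
  "jump_time N i \<omega> = Inf {s. 0 \<le> s \<and> i \<le> N s \<omega>}"

text \<open>The integral of a path \<open>f\<close> against a counting path \<open>\<nu>\<close>: the sum of \<open>f\<close> over the jump times
  of \<open>\<nu>\<close> in \<open>(a, b]\<close>.\<close>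

definition jump_integral :: "real \<Rightarrow> real \<Rightarrow> (real \<Rightarrow> real) \<Rightarrow> (real \<Rightarrow> nat) \<Rightarrow> real" where
  "jump_integral a b f \<nu> = (\<Sum>v \<in> {v \<in> {a<..b}. \<forall>u\<in>{0..<v}. \<nu> u < \<nu> v}. f v)"


section \<open>Markov chains\<close>

definition markov_chain ::
  "'a measure \<Rightarrow> ('s::topological_space) set \<Rightarrow> ('s \<Rightarrow> real) \<Rightarrow> ('s \<Rightarrow> 's \<Rightarrow> real) \<Rightarrow> (nat \<Rightarrow> 'a \<Rightarrow> 's) \<Rightarrow> bool"
where
  "markov_chain M S \<mu> p X \<longleftrightarrow>
     (\<forall>i. X i \<in> borel_measurable M) \<and>
     (\<forall>i. \<forall>\<omega>\<in>space M. X i \<omega> \<in> S) \<and>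
     (\<forall>x\<in>S. \<P>(\<omega> in M. X 0 \<omega> = x) = \<mu> x) \<and>
     (\<forall>m x. (\<forall>i\<le>Suc m. x i \<in> S) \<and> \<P>(\<omega> in M. \<forall>i\<le>m. X i \<omega> = x i) > 0 \<longrightarrow>
        \<P>(\<omega> in M. X (Suc m) \<omega> = x (Suc m) \<bar> \<forall>i\<le>m. X i \<omega> = x i) = p (x m) (x (Suc m)))"

text \<open>Transition functions \<open>p s t x y\<close>, \<open>0 \<le> s \<le> t \<le> 1\<close>, of inhomogeneous chains on the time
  interval \<open>[0, 1]\<close>.\<close>

definition transition_function :: "'s set \<Rightarrow> (real \<Rightarrow> real \<Rightarrow> 's \<Rightarrow> 's \<Rightarrow> real) \<Rightarrow> bool" where
  "transition_function S p \<longleftrightarrow>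
     (\<forall>s t. 0 \<le> s \<and> s \<le> t \<and> t \<le> 1 \<longrightarrow> stochastic_matrix_on S (p s t)) \<and>
     (\<forall>s\<in>{0..1}. \<forall>x\<in>S. \<forall>y\<in>S. p s s x y = identity_matrix x y) \<and>
     (\<forall>s t u. 0 \<le> s \<and> s \<le> t \<and> t \<le> u \<and> u \<le> 1 \<longrightarrow>
        (\<forall>x\<in>S. \<forall>y\<in>S. p s u x y = (\<Sum>z\<in>S. p s t x z * p t u z y)))"

text \<open>\<open>Q t\<close> is the infinitesimal generator at time \<open>t\<close>. The limit is required from both sides:
  the right-hand limit alone does not exclude jumps at deterministic times.\<close>

definition has_generator ::
  "'s set \<Rightarrow> (real \<Rightarrow> real \<Rightarrow> 's \<Rightarrow> 's \<Rightarrow> real) \<Rightarrow> (real \<Rightarrow> 's \<Rightarrow> 's \<Rightarrow> real) \<Rightarrow> bool" where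
  "has_generator S p Q \<longleftrightarrow>
     (\<forall>t\<in>{0..<1}. \<forall>x\<in>S. \<forall>y\<in>S.
        ((\<lambda>h. (p t (t + h) x y - identity_matrix x y) / h) \<longlongrightarrow> Q t x y) (at_right 0)) \<and>
     (\<forall>t\<in>{0<..1}. \<forall>x\<in>S. \<forall>y\<in>S.
        ((\<lambda>h. (p (t - h) t x y - identity_matrix x y) / h) \<longlongrightarrow> Q t x y) (at_right 0))"

text \<open>A continuous-time Markov chain on \<open>[0, 1]\<close> with right-continuous paths having left limits,
  initial distribution \<open>\<mu>\<close> and generator \<open>Q t\<close> at time \<open>t\<close>.\<close>

definition ct_markov_chain ::
  "'a measure \<Rightarrow> ('s::topological_space) set \<Rightarrow> ('s \<Rightarrow> real) \<Rightarrow> (real \<Rightarrow> 's \<Rightarrow> 's \<Rightarrow> real) \<Rightarrow>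
     (real \<Rightarrow> 'a \<Rightarrow> 's) \<Rightarrow> bool" where
  "ct_markov_chain M S \<mu> Q X \<longleftrightarrow>
     (\<forall>t\<in>{0..1}. X t \<in> borel_measurable M) \<and>
     (\<forall>t\<in>{0..1}. \<forall>\<omega>\<in>space M. X t \<omega> \<in> S) \<and>
     (\<forall>\<omega>\<in>space M.
        (\<forall>t\<in>{0..<1}. ((\<lambda>v. X v \<omega>) \<longlongrightarrow> X t \<omega>) (at_right t)) \<and>
        (\<forall>t\<in>{0<..1}. \<exists>l. ((\<lambda>v. X v \<omega>) \<longlongrightarrow> l) (at_left t))) \<and>
     (\<forall>x\<in>S. \<P>(\<omega> in M. X 0 \<omega> = x) = \<mu> x) \<and>
     (\<exists>p. transition_function S p \<and> has_generator S p Q \<and>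
        (\<forall>m s x. (\<forall>i\<le>Suc m. s i \<in> {0..1} \<and> x i \<in> S) \<and> (\<forall>i\<le>m. s i < s (Suc i)) \<and>
            \<P>(\<omega> in M. \<forall>i\<le>m. X (s i) \<omega> = x i) > 0 \<longrightarrow>
          \<P>(\<omega> in M. X (s (Suc m)) \<omega> = x (Suc m) \<bar> \<forall>i\<le>m. X (s i) \<omega> = x i)
            = p (s m) (s (Suc m)) (x m) (x (Suc m))))"


section \<open>The model\<close>

text \<open>The argument \<open>L\<close> stands for the unscaled service times.\<close>

definition service_times :: "'a measure \<Rightarrow> real \<Rightarrow> (nat \<Rightarrow> 'k::finite \<Rightarrow> 'a \<Rightarrow> real) \<Rightarrow> bool" where
  "service_times M \<alpha> L \<longleftrightarrow>
     prob_space.indep_vars M (\<lambda>_. borel) (\<lambda>(i, j). L i j) UNIV \<and>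
     (\<forall>i j. \<forall>\<omega>\<in>space M. 0 \<le> L i j \<omega>) \<and>
     (\<forall>i. distr M borel (\<lambda>\<omega>. (\<chi> j. L i j \<omega>) :: real ^ 'k) = distr M borel (\<lambda>\<omega>. \<chi> j. L 0 j \<omega>)) \<and>
     (\<forall>j. (\<lambda>t. \<P>(\<omega> in M. L 0 j \<omega> > t)) \<sim>[at_top] (\<lambda>t. t powr (- \<alpha>)))"

definition rescaled_matrix :: "real \<Rightarrow> ('s \<Rightarrow> 's \<Rightarrow> real) \<Rightarrow> nat \<Rightarrow> 's \<Rightarrow> 's \<Rightarrow> real" where
  "rescaled_matrix \<gamma> P n x y =
     P x y / real n powr \<gamma> + (1 - 1 / real n powr \<gamma>) * identity_matrix x y"

definition queue_process ::
  "(real \<Rightarrow> 'a \<Rightarrow> nat) \<Rightarrow> (nat \<Rightarrow> 'a \<Rightarrow> real ^ 'k) \<Rightarrow> (nat \<Rightarrow> 'k \<Rightarrow> 'a \<Rightarrow> real) \<Rightarrow>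
     real \<Rightarrow> 'a \<Rightarrow> real ^ 'k" where
  "queue_process N X L t \<omega> =
     (\<chi> j. \<Sum>i = 1..N t \<omega>. X i \<omega> $ j * of_bool (t < L i j \<omega> + jump_time N i \<omega>))"

definition limit_generator ::
  "real \<Rightarrow> real \<Rightarrow> ('s \<Rightarrow> 's \<Rightarrow> real) \<Rightarrow> real \<Rightarrow> 's \<Rightarrow> 's \<Rightarrow> real" where
  "limit_generator \<alpha> lam P t x y =
     1 / (1 - \<alpha>) * (1 - t) powr (\<alpha> / (1 - \<alpha>)) * lam * (P x y - identity_matrix x y)"


section \<open>Conditional laws and weak convergence\<close>

text \<open>The law of \<open>Y\<close> given an event \<open>A\<close> of positive probability.\<close>

definition conditional_law :: "'a measure \<Rightarrow> 'a set \<Rightarrow> ('a \<Rightarrow> 'b::topological_space) \<Rightarrow> 'b measure" where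
  "conditional_law M A Y = distr (uniform_measure M A) borel Y"

definition converges_weakly :: "(nat \<Rightarrow> 'b::topological_space measure) \<Rightarrow> 'b measure \<Rightarrow> bool" where
  "converges_weakly \<mu> \<mu>' \<longleftrightarrow>
     (\<forall>f :: 'b \<Rightarrow> real. continuous_on UNIV f \<and> bounded (range f) \<longrightarrow>
        (\<lambda>n. integral\<^sup>L (\<mu> n) f) \<longlonglongrightarrow> integral\<^sup>L \<mu>' f)"

end

theory Submission
  imports Defs
begin

text \<open>
  Given the arrivals and the modulating chain, the service times thin the arrivals independently, so
  the joint Laplace transform of the queue and the terminal state of the chain is an entry of a
  product of substochastic matrices along a grid of \<open>[0, t]\<close>, up to an error that vanishes with the
  mesh. The Markov property turns the transform of the limit into a product of the same shape along
  the image of the grid under \<open>u \<mapsto> 1 - (t - u) powr (1 - \<alpha>)\<close>. To first order in the mesh \<open>\<delta>\<close>, a factor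
  of the first product is \<open>I + \<delta> (lam (P - I) - lam g)\<close>, where \<open>g\<close> is the rate of successful thinning,
  and a factor of the second is the same with \<open>g\<close> replaced by \<open>h (t - u) powr (- \<alpha>)\<close>. Products of
  substochastic matrices differ by at most the sum of the differences of their factors; this sum
  tends to \<open>\<integral> \<bar>g - h r powr (- \<alpha>)\<bar> dr\<close> and then to zero by dominated convergence. Finally, the
  substitution \<open>u = exp (- z)\<close> reduces weak convergence on the orthant to the Stone--Weierstrass
  theorem on the unit cube.
\<close>

section \<open>Products of substochastic matrices\<close>

text \<open>The order of limits carries the argument. For fixed n the grid is refined first, so an
  error that is quadratic in the mesh disappears even if its constant grows like a power of n; only
  two integrals over the remaining time r = t - u survive, and these vanish as n grows. The obstacle
  is the pole of r powr (- \<alpha>) at r = 0, where the two rates cannot be compared uniformly.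
  Cells are therefore compared through exact integrals, for which monotonicity of the finite-n rate
  is enough. The time map is the one under which a grid cell of length \<delta> receives exactly
  \<delta> units of the homogeneous chain with generator lam (P - I), while the length of its image
  is (1 - \<alpha>) times the integral of r powr (- \<alpha>) over the cell. Both regimes share one
  comparison and differ only in h, the sum over the coordinates of m j * y j if \<gamma> > \<alpha>
  and of 1 - exp (- m j * y j) if \<gamma> = \<alpha>. Tightness comes out of the transforms
  themselves, since a cutoff near the faces of the cube is a continuous test function.\<close>

primrec path_weight :: "'s set \<Rightarrow> (nat \<Rightarrow> 's \<Rightarrow> 's \<Rightarrow> real) \<Rightarrow> 's \<Rightarrow> nat \<Rightarrow> 's \<Rightarrow> real" where
  "path_weight S A x 0 y = of_bool (x = y)"
| "path_weight S A x (Suc l) y = (\<Sum>z\<in>S. path_weight S A x l z * A l z y)"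

definition substochastic_on :: "'s set \<Rightarrow> ('s \<Rightarrow> 's \<Rightarrow> real) \<Rightarrow> bool" where
  "substochastic_on S A \<longleftrightarrow> (\<forall>x\<in>S. \<forall>y\<in>S. 0 \<le> A x y) \<and> (\<forall>x\<in>S. (\<Sum>y\<in>S. A x y) \<le> 1)"

lemma path_weight_cong:
  assumes "\<And>l z y. l < m \<Longrightarrow> z \<in> S \<Longrightarrow> y \<in> S \<Longrightarrow> A l z y = B l z y" "y \<in> S"
  shows "path_weight S A x m y = path_weight S B x m y"
  using assms
proof (induction m arbitrary: y)
  case (Suc m)
  have "path_weight S A x m z * A m z y = path_weight S B x m z * B m z y" if "z \<in> S" for z
    using Suc.IH[of z] Suc.prems that by simp
  then show ?case by simp
qed simp

text \<open>\<open>path_weight S A x m y\<close> is the (x, y) entry of the product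
  \<open>A 0 ... A (m - 1)\<close>, so this is associativity, with the index of the second block
  shifted by \<open>m\<close>.\<close>

lemma path_weight_add:
  assumes "finite S" "y \<in> S"
  shows "path_weight S A x (m + d) y
    = (\<Sum>z\<in>S. path_weight S A x m z * path_weight S (\<lambda>i. A (m + i)) z d y)"
  using assms(2)
proof (induction d arbitrary: y)
  case 0
  then show ?case using assms(1) by (simp add: of_bool_def if_distrib cong: if_cong)
next
  case (Suc d)
  have "path_weight S A x (m + Suc d) y
    = (\<Sum>w\<in>S. (\<Sum>z\<in>S. path_weight S A x m z * path_weight S (\<lambda>i. A (m + i)) z d w) * A (m + d) w y)"
    using Suc.IH by simp
  also have "\<dots> = (\<Sum>z\<in>S. \<Sum>w\<in>S. path_weight S A x m z * path_weight S (\<lambda>i. A (m + i)) z d w * A (m + d) w y)"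
    by (subst sum.swap) (simp add: sum_distrib_right)
  also have "\<dots> = (\<Sum>z\<in>S. path_weight S A x m z * path_weight S (\<lambda>i. A (m + i)) z (Suc d) y)"
    by (simp add: sum_distrib_left mult.assoc)
  finally show ?case .
qed

lemma path_weight_nonneg:
  assumes "\<And>l. l < m \<Longrightarrow> substochastic_on S (A l)" "y \<in> S"
  shows "0 \<le> path_weight S A x m y"
  using assms
proof (induction m arbitrary: y)
  case (Suc m)
  then show ?case
    by (auto intro!: sum_nonneg mult_nonneg_nonneg simp: substochastic_on_def)
qed simp

lemma path_weight_sum_le:
  assumes "finite S" "x \<in> S" "\<And>l. l < m \<Longrightarrow> substochastic_on S (A l)"
  shows "(\<Sum>y\<in>S. path_weight S A x m y) \<le> 1"
  using assms(3)
proof (induction m)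
  case 0
  then show ?case using assms by (simp add: of_bool_def)
next
  case (Suc m)
  have "(\<Sum>y\<in>S. path_weight S A x (Suc m) y) = (\<Sum>z\<in>S. path_weight S A x m z * (\<Sum>y\<in>S. A m z y))"
    by (simp add: sum_distrib_left, subst sum.swap, simp)
  also have "\<dots> \<le> (\<Sum>z\<in>S. path_weight S A x m z * 1)"
    using Suc.prems by (intro sum_mono mult_left_mono path_weight_nonneg) (auto simp: substochastic_on_def)
  finally show ?case using Suc by simp
qed

lemma path_weight_le_1:
  assumes "finite S" "x \<in> S" "y \<in> S" "\<And>l. l < m \<Longrightarrow> substochastic_on S (A l)"
  shows "path_weight S A x m y \<le> 1"
proof -
  have "path_weight S A x m y \<le> (\<Sum>y\<in>S. path_weight S A x m y)"
    using assms by (intro member_le_sum path_weight_nonneg) auto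
  then show ?thesis using path_weight_sum_le[OF assms(1,2,4)] by fastforce
qed

text \<open>Telescoping one factor at a time, \<open>a A - b B = (a - b) A + b (A - B)\<close>. Row
  sums at most 1 keep earlier errors from growing, so the errors of the factors, measured by rows,
  simply add up.\<close>

lemma path_weight_diff:
  assumes "finite S" "x \<in> S"
    and "\<And>l. l < m \<Longrightarrow> substochastic_on S (A l)" "\<And>l. l < m \<Longrightarrow> substochastic_on S (B l)"
    and "\<And>l z. l < m \<Longrightarrow> z \<in> S \<Longrightarrow> (\<Sum>y\<in>S. \<bar>A l z y - B l z y\<bar>) \<le> e l"
  shows "(\<Sum>y\<in>S. \<bar>path_weight S A x m y - path_weight S B x m y\<bar>) \<le> (\<Sum>l<m. e l)"
  using assms(3-)
proof (induction m)
  case (Suc m)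
  let ?a = "path_weight S A x m" and ?b = "path_weight S B x m"
  have "(\<Sum>y\<in>S. \<bar>path_weight S A x (Suc m) y - path_weight S B x (Suc m) y\<bar>)
    = (\<Sum>y\<in>S. \<bar>\<Sum>z\<in>S. (?a z - ?b z) * A m z y + ?b z * (A m z y - B m z y)\<bar>)"
    by (simp add: sum_subtractf[symmetric] algebra_simps)
  also have "\<dots> \<le> (\<Sum>y\<in>S. \<Sum>z\<in>S. \<bar>?a z - ?b z\<bar> * A m z y + ?b z * \<bar>A m z y - B m z y\<bar>)"
  proof (intro sum_mono order_trans[OF sum_abs])
    fix y z assume "y \<in> S" "z \<in> S"
    then have "0 \<le> A m z y" "0 \<le> ?b z"
      using Suc.prems path_weight_nonneg[of m S B z x] by (auto simp: substochastic_on_def)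
    then show "\<bar>(?a z - ?b z) * A m z y + ?b z * (A m z y - B m z y)\<bar>
        \<le> \<bar>?a z - ?b z\<bar> * A m z y + ?b z * \<bar>A m z y - B m z y\<bar>"
      by (intro order_trans[OF abs_triangle_ineq]) (simp add: abs_mult)
  qed
  also have "\<dots> = (\<Sum>z\<in>S. \<bar>?a z - ?b z\<bar> * (\<Sum>y\<in>S. A m z y)) + (\<Sum>z\<in>S. ?b z * (\<Sum>y\<in>S. \<bar>A m z y - B m z y\<bar>))"
    by (subst sum.swap) (simp add: sum_distrib_left sum.distrib)
  also have "\<dots> \<le> (\<Sum>z\<in>S. \<bar>?a z - ?b z\<bar> * 1) + (\<Sum>z\<in>S. ?b z * e m)"
    using Suc.prems
    by (intro add_mono sum_mono mult_left_mono path_weight_nonneg) (auto simp: substochastic_on_def)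
  \<comment> \<open>The total mass of \<open>?b\<close> is at most 1; using this needs
    \<open>e m\<close> nonnegative, which the hypothesis at the row \<open>x\<close>
    provides.\<close>
  also have "(\<Sum>z\<in>S. ?b z * e m) \<le> e m"
  proof -
    have "0 \<le> (\<Sum>y\<in>S. \<bar>A m x y - B m x y\<bar>)" by (simp add: sum_nonneg)
    also have "\<dots> \<le> e m" using Suc.prems(3)[of m x] assms(2) by simp
    finally have "0 \<le> e m" .
    moreover have "(\<Sum>z\<in>S. ?b z) \<le> 1"
      using assms(1,2) Suc.prems(2) by (intro path_weight_sum_le) auto
    ultimately show ?thesis
      using mult_right_mono[of "\<Sum>z\<in>S. ?b z" 1 "e m"] by (simp add: sum_distrib_right)
  qed
  also have "(\<Sum>z\<in>S. \<bar>?a z - ?b z\<bar> * 1) \<le> (\<Sum>l<m. e l)" using Suc by simp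
  finally show ?case by simp
qed simp

section \<open>Functionals of a finite-state chain along finitely many times\<close>

lemma path_indicator_sum:
  fixes h :: "(nat \<Rightarrow> 's) \<Rightarrow> real"
  assumes "finite S" "\<And>i. i \<le> m \<Longrightarrow> u i \<in> S"
  shows "(\<Sum>\<zeta>\<in>PiE {..m} (\<lambda>_. S). h \<zeta> * of_bool (\<forall>i\<le>m. u i = \<zeta> i)) = h (restrict u {..m})"
proof -
  have T: "finite (PiE {..m} (\<lambda>_. S))" using assms(1) by (intro finite_PiE) auto
  have "(\<forall>i\<le>m. u i = \<zeta> i) \<longleftrightarrow> \<zeta> = restrict u {..m}" if "\<zeta> \<in> PiE {..m} (\<lambda>_. S)" for \<zeta>
    using that by (auto simp: PiE_iff extensional_def fun_eq_iff)
  then have "(\<Sum>\<zeta>\<in>PiE {..m} (\<lambda>_. S). h \<zeta> * of_bool (\<forall>i\<le>m. u i = \<zeta> i))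
    = (\<Sum>\<zeta>\<in>PiE {..m} (\<lambda>_. S). if \<zeta> = restrict u {..m} then h \<zeta> else 0)"
    by (intro sum.cong) auto
  also have "\<dots> = h (restrict u {..m})" using T assms(2) by auto
  finally show ?thesis .
qed

text \<open>The Markov property for a functional \<open>g\<close> of the past, obtained by expanding
  \<open>g\<close> over the finitely many pasts. The law is assumed as a product identity instead of
  a conditional probability, so that pasts of probability zero need no separate treatment.\<close>

lemma (in prob_space) path_functional_step:
  fixes g :: "(nat \<Rightarrow> 's) \<Rightarrow> real" and Y :: "nat \<Rightarrow> 'a \<Rightarrow> 's"
  assumes "finite S"
    and Y: "\<And>i \<omega>. i \<le> m \<Longrightarrow> \<omega> \<in> space M \<Longrightarrow> Y i \<omega> \<in> S"
    and meas: "\<And>i z. i \<le> Suc m \<Longrightarrow> z \<in> S \<Longrightarrow> {\<omega> \<in> space M. Y i \<omega> = z} \<in> events"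
    and law: "\<And>z. (\<forall>i\<le>Suc m. z i \<in> S) \<Longrightarrow> prob {\<omega> \<in> space M. \<forall>i\<le>Suc m. Y i \<omega> = z i}
      = prob {\<omega> \<in> space M. \<forall>i\<le>m. Y i \<omega> = z i} * p (z m) (z (Suc m))"
    and g: "\<And>u v. (\<And>i. i \<le> m \<Longrightarrow> u i = v i) \<Longrightarrow> g u = g v"
    and "z \<in> S" "y \<in> S"
  shows "expectation (\<lambda>\<omega>. g (\<lambda>i. Y i \<omega>) * of_bool (Y m \<omega> = z) * of_bool (Y (Suc m) \<omega> = y))
    = expectation (\<lambda>\<omega>. g (\<lambda>i. Y i \<omega>) * of_bool (Y m \<omega> = z)) * p z y"
proof -
  define T where "T = PiE {..m} (\<lambda>_. S)"
  have T: "finite T" unfolding T_def using assms(1) by (intro finite_PiE) auto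
  define E where "E u = {\<omega> \<in> space M. \<forall>i\<le>m. Y i \<omega> = u i}" for u
  define F where "F = {\<omega> \<in> space M. Y (Suc m) \<omega> = y}"
  have E: "E u \<in> events" if "u \<in> T" for u
  proof -
    have "E u = (\<Inter>i\<in>{..m}. {\<omega> \<in> space M. Y i \<omega> = u i})" by (auto simp: E_def)
    also have "\<dots> \<in> events" using meas that by (intro sets.finite_INT) (auto simp: T_def PiE_iff)
    finally show ?thesis .
  qed
  have F: "F \<in> events" unfolding F_def using meas assms by auto
  have decomp: "g (\<lambda>i. Y i \<omega>) * of_bool (Y m \<omega> = z) = (\<Sum>u\<in>T. g u * of_bool (u m = z) * indicator (E u) \<omega>)"
    if "\<omega> \<in> space M" for \<omega>
  proof -
    have "(\<Sum>u\<in>T. g u * of_bool (u m = z) * indicator (E u) \<omega>)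
      = (\<Sum>u\<in>T. (g u * of_bool (u m = z)) * of_bool (\<forall>i\<le>m. Y i \<omega> = u i))"
      using that by (intro sum.cong) (auto simp: E_def indicator_def)
    also have "\<dots> = g (restrict (\<lambda>i. Y i \<omega>) {..m}) * of_bool (restrict (\<lambda>i. Y i \<omega>) {..m} m = z)"
      unfolding T_def using Y that assms(1) by (subst path_indicator_sum) auto
    also have "g (restrict (\<lambda>i. Y i \<omega>) {..m}) = g (\<lambda>i. Y i \<omega>)" by (rule g) simp
    finally show ?thesis by simp
  qed
  have "expectation (\<lambda>\<omega>. g (\<lambda>i. Y i \<omega>) * of_bool (Y m \<omega> = z) * of_bool (Y (Suc m) \<omega> = y))
    = expectation (\<lambda>\<omega>. \<Sum>u\<in>T. g u * of_bool (u m = z) * indicator (E u \<inter> F) \<omega>)"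
  proof (rule Bochner_Integration.integral_cong[OF refl])
    fix \<omega> assume w: "\<omega> \<in> space M"
    then have "of_bool (Y (Suc m) \<omega> = y) = (indicator F \<omega> :: real)" by (auto simp: F_def)
    then show "g (\<lambda>i. Y i \<omega>) * of_bool (Y m \<omega> = z) * of_bool (Y (Suc m) \<omega> = y)
      = (\<Sum>u\<in>T. g u * of_bool (u m = z) * indicator (E u \<inter> F) \<omega>)"
      unfolding decomp[OF w] by (simp add: sum_distrib_right indicator_inter_arith mult.assoc)
  qed
  also have "\<dots> = (\<Sum>u\<in>T. g u * of_bool (u m = z) * prob (E u \<inter> F))"
    using E F by (subst Bochner_Integration.integral_sum) (auto intro!: integrable_real_indicator simp: less_top[symmetric])
  also have "\<dots> = (\<Sum>u\<in>T. g u * of_bool (u m = z) * prob (E u) * p z y)"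
  proof (rule sum.cong[OF refl])
    fix u assume u: "u \<in> T"
    define u' where "u' = u(Suc m := y)"
    have "prob (E u \<inter> F) = prob (E u) * p (u m) y"
    proof -
      have "E u \<inter> F = {\<omega> \<in> space M. \<forall>i\<le>Suc m. Y i \<omega> = u' i}"
        by (auto simp: E_def F_def u'_def le_Suc_eq)
      moreover have "E u = {\<omega> \<in> space M. \<forall>i\<le>m. Y i \<omega> = u' i}"
        by (auto simp: E_def u'_def)
      moreover have "\<forall>i\<le>Suc m. u' i \<in> S" using u assms by (auto simp: u'_def T_def)
      ultimately show ?thesis using law[of u'] by (simp add: u'_def)
    qed
    then show "g u * of_bool (u m = z) * prob (E u \<inter> F) = g u * of_bool (u m = z) * prob (E u) * p z y"
      by auto
  qed
  also have "\<dots> = (\<Sum>u\<in>T. g u * of_bool (u m = z) * prob (E u)) * p z y"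
    by (simp add: sum_distrib_right)
  also have "(\<Sum>u\<in>T. g u * of_bool (u m = z) * prob (E u))
    = expectation (\<lambda>\<omega>. \<Sum>u\<in>T. g u * of_bool (u m = z) * indicator (E u) \<omega>)"
    using E by (subst Bochner_Integration.integral_sum) (auto intro!: integrable_real_indicator simp: less_top[symmetric])
  also have "\<dots> = expectation (\<lambda>\<omega>. g (\<lambda>i. Y i \<omega>) * of_bool (Y m \<omega> = z))"
    by (rule Bochner_Integration.integral_cong) (simp_all add: decomp)
  finally show ?thesis .
qed

text \<open>A discrete Feynman--Kac formula: a weight collected on arrival in a state is absorbed
  into the matrix entry of the step that leads there. The proof peels off the last step.\<close>

lemma (in prob_space) chain_expectation:
  fixes Y :: "nat \<Rightarrow> 'a \<Rightarrow> 's"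
  assumes "finite S"
    and Y: "\<And>i \<omega>. i \<le> m \<Longrightarrow> \<omega> \<in> space M \<Longrightarrow> Y i \<omega> \<in> S"
    and meas: "\<And>i z. i \<le> m \<Longrightarrow> z \<in> S \<Longrightarrow> {\<omega> \<in> space M. Y i \<omega> = z} \<in> events"
    and law: "\<And>l z. l < m \<Longrightarrow> (\<forall>i\<le>Suc l. z i \<in> S) \<Longrightarrow> prob {\<omega> \<in> space M. \<forall>i\<le>Suc l. Y i \<omega> = z i}
      = prob {\<omega> \<in> space M. \<forall>i\<le>l. Y i \<omega> = z i} * p l (z l) (z (Suc l))"
    and "x \<in> S" "y \<in> S"
  shows "expectation (\<lambda>\<omega>. of_bool (Y 0 \<omega> = x) * (\<Prod>i<m. w i (Y (Suc i) \<omega>)) * of_bool (Y m \<omega> = y))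
    = prob {\<omega> \<in> space M. Y 0 \<omega> = x} * path_weight S (\<lambda>i z y. p i z y * w i y) x m y"
  using Y meas law \<open>y \<in> S\<close>
proof (induction m arbitrary: y)
  case 0
  have "expectation (\<lambda>\<omega>. of_bool (Y 0 \<omega> = x) * (\<Prod>i<0. w i (Y (Suc i) \<omega>)) * of_bool (Y 0 \<omega> = y))
     = expectation (\<lambda>\<omega>. indicator {\<omega> \<in> space M. Y 0 \<omega> = x} \<omega> * of_bool (x = y))"
    by (intro Bochner_Integration.integral_cong) auto
  then show ?case using 0(2)[of 0 x] \<open>x \<in> S\<close> by (simp add: Int_absorb1 sets.sets_into_space)
next
  case (Suc m)
  let ?g = "\<lambda>u::nat \<Rightarrow> 's. of_bool (u 0 = x) * (\<Prod>i<m. w i (u (Suc i)))"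
  have step: "expectation (\<lambda>\<omega>. ?g (\<lambda>i. Y i \<omega>) * of_bool (Y m \<omega> = z) * of_bool (Y (Suc m) \<omega> = y))
      = prob {\<omega> \<in> space M. Y 0 \<omega> = x} * path_weight S (\<lambda>i z y. p i z y * w i y) x m z * p m z y"
    if "z \<in> S" for z
  proof -
    have "expectation (\<lambda>\<omega>. ?g (\<lambda>i. Y i \<omega>) * of_bool (Y m \<omega> = z) * of_bool (Y (Suc m) \<omega> = y))
      = expectation (\<lambda>\<omega>. ?g (\<lambda>i. Y i \<omega>) * of_bool (Y m \<omega> = z)) * p m z y"
      by (rule path_functional_step[where S=S]) (use Suc.prems assms(1) that in \<open>auto intro!: prod.cong\<close>)
    also have "expectation (\<lambda>\<omega>. ?g (\<lambda>i. Y i \<omega>) * of_bool (Y m \<omega> = z))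
      = prob {\<omega> \<in> space M. Y 0 \<omega> = x} * path_weight S (\<lambda>i z y. p i z y * w i y) x m z"
      using Suc.IH[of z] Suc.prems that by simp
    finally show ?thesis .
  qed
  have int: "integrable M (\<lambda>\<omega>. ?g (\<lambda>i. Y i \<omega>) * of_bool (Y m \<omega> = z) * of_bool (Y (Suc m) \<omega> = y))"
    if "z \<in> S" for z
  proof (rule integrable_const_bound)
    define C where "C = (\<Prod>i<m. \<Sum>z\<in>S. \<bar>w i z\<bar>)"
    have "\<bar>\<Prod>i<m. w i (Y (Suc i) \<omega>)\<bar> \<le> C" if "\<omega> \<in> space M" for \<omega>
      unfolding C_def abs_prod
      by (intro prod_mono conjI abs_ge_zero member_le_sum[of _ S "\<lambda>z. \<bar>w _ z\<bar>"] Suc.prems(1) that assms(1)) auto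
    then show "AE \<omega> in M. norm (?g (\<lambda>i. Y i \<omega>) * of_bool (Y m \<omega> = z) * of_bool (Y (Suc m) \<omega> = y)) \<le> C"
      by (intro AE_I2) (auto simp: abs_mult of_bool_def C_def intro!: prod_nonneg sum_nonneg)
    have ev: "(\<lambda>\<omega>. h (Y i \<omega>)) \<in> borel_measurable M" if "i \<le> Suc m" for i and h :: "'s \<Rightarrow> real"
    proof -
      have "(\<lambda>\<omega>. \<Sum>z\<in>S. h z * indicator {\<omega> \<in> space M. Y i \<omega> = z} \<omega>) \<in> borel_measurable M"
        using Suc.prems(2)[OF that] by (intro borel_measurable_sum borel_measurable_times borel_measurable_indicator) auto
      also have "?this \<longleftrightarrow> (\<lambda>\<omega>. h (Y i \<omega>)) \<in> borel_measurable M"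
      proof (rule measurable_cong)
        fix \<omega> assume w: "\<omega> \<in> space M"
        then have "(\<Sum>z\<in>S. h z * indicator {\<omega> \<in> space M. Y i \<omega> = z} \<omega>) = (\<Sum>z\<in>S. if Y i \<omega> = z then h z else 0)"
          by (intro sum.cong) (auto simp: indicator_def)
        also have "\<dots> = h (Y i \<omega>)" using Suc.prems(1)[OF that w] assms(1) by simp
        finally show "(\<Sum>z\<in>S. h z * indicator {\<omega> \<in> space M. Y i \<omega> = z} \<omega>) = h (Y i \<omega>)" .
      qed
      finally show ?thesis .
    qed
    show "(\<lambda>\<omega>. ?g (\<lambda>i. Y i \<omega>) * of_bool (Y m \<omega> = z) * of_bool (Y (Suc m) \<omega> = y)) \<in> borel_measurable M"
      by (intro borel_measurable_times borel_measurable_prod ev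
        ev[of _ "\<lambda>v. of_bool (v = _)"]) auto
  qed
  \<comment> \<open>On the event \<open>Y (Suc m) \<omega> = y\<close> the last weight is the
    constant \<open>w m y\<close>; the sum over \<open>z\<close> fixes the state before it, as the
    induction hypothesis requires.\<close>
  have "expectation (\<lambda>\<omega>. of_bool (Y 0 \<omega> = x) * (\<Prod>i<Suc m. w i (Y (Suc i) \<omega>)) * of_bool (Y (Suc m) \<omega> = y))
    = expectation (\<lambda>\<omega>. \<Sum>z\<in>S. (?g (\<lambda>i. Y i \<omega>) * of_bool (Y m \<omega> = z) * of_bool (Y (Suc m) \<omega> = y)) * w m y)"
  proof (rule Bochner_Integration.integral_cong[OF refl])
    fix \<omega> assume w: "\<omega> \<in> space M"
    have "(\<Sum>z\<in>S. (?g (\<lambda>i. Y i \<omega>) * of_bool (Y m \<omega> = z) * of_bool (Y (Suc m) \<omega> = y)) * w m y)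
      = (\<Sum>z\<in>S. if Y m \<omega> = z then ?g (\<lambda>i. Y i \<omega>) * of_bool (Y (Suc m) \<omega> = y) * w m y else 0)"
      by (intro sum.cong) auto
    also have "\<dots> = ?g (\<lambda>i. Y i \<omega>) * of_bool (Y (Suc m) \<omega> = y) * w m y"
      using Suc.prems(1)[of m \<omega>] w assms(1) by simp
    finally show "of_bool (Y 0 \<omega> = x) * (\<Prod>i<Suc m. w i (Y (Suc i) \<omega>)) * of_bool (Y (Suc m) \<omega> = y)
      = (\<Sum>z\<in>S. (?g (\<lambda>i. Y i \<omega>) * of_bool (Y m \<omega> = z) * of_bool (Y (Suc m) \<omega> = y)) * w m y)"
      by auto
  qed
  also have "\<dots> = (\<Sum>z\<in>S. expectation (\<lambda>\<omega>. ?g (\<lambda>i. Y i \<omega>) * of_bool (Y m \<omega> = z) * of_bool (Y (Suc m) \<omega> = y)) * w m y)"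
    using int by (subst Bochner_Integration.integral_sum) (auto intro: integrable_mult_left)
  also have "\<dots> = (\<Sum>z\<in>S. prob {\<omega> \<in> space M. Y 0 \<omega> = x} * path_weight S (\<lambda>i z y. p i z y * w i y) x m z * p m z y * w m y)"
    by (intro sum.cong refl) (simp add: step)
  finally show ?case by (simp add: sum_distrib_left mult.assoc)
qed

section \<open>Poisson increments and independence\<close>

text \<open>\<open>exp (- u) \<le> 1 / (1 + u)\<close>, and
  \<open>(1 + u) * (1 - u + u\<^sup>2) = 1 + u ^ 3\<close>.\<close>

lemma exp_minus_le_quadratic:
  fixes u :: real
  assumes "0 \<le> u"
  shows "exp (- u) \<le> 1 - u + u\<^sup>2"
proof -
  have "exp (- u) \<le> 1 / (1 + u)"
    using exp_ge_add_one_self[of u] assms by (simp add: exp_minus field_simps)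
  also have "\<dots> \<le> 1 - u + u\<^sup>2"
    using assms by (simp add: field_simps power2_eq_square power3_eq_cube)
  finally show ?thesis .
qed

text \<open>Up to second order only zero or one arrival occurs. Of the three errors, each at most
  \<open>\<mu>\<^sup>2\<close>, those from no arrival and from at least two are nonnegative, and
  that from a single arrival enters negatively; hence the constant 2 rather than 3.\<close>

lemma poisson_expectation_approx:
  fixes f :: "nat \<Rightarrow> real"
  assumes "0 < \<mu>" and f: "\<And>d. 0 \<le> f d" "\<And>d. f d \<le> 1"
  shows "\<bar>measure_pmf.expectation (poisson_pmf \<mu>) f - ((1 - \<mu>) * f 0 + \<mu> * f 1)\<bar> \<le> 2 * \<mu>\<^sup>2"
proof -
  let ?p = "poisson_pmf \<mu>"
  have int: "integrable ?p g" if "\<And>d. \<bar>g d\<bar> \<le> 1" for g :: "nat \<Rightarrow> real"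
    by (rule measure_pmf.integrable_const_bound[where B=1]) (use that in auto)
  define R where "R = measure_pmf.expectation ?p (\<lambda>d. f d * indicator {2..} d)"
  have ind: "measure_pmf.expectation ?p (indicator {d} :: nat \<Rightarrow> real) = pmf ?p d" for d
    by (simp add: measure_pmf_single)
  have "f d = f 0 * indicator {0} d + f 1 * indicator {1} d + f d * indicator {2..} d" for d
    by (cases d; cases "d - 1") (auto simp: indicator_def)
  then have "measure_pmf.expectation ?p f
    = measure_pmf.expectation ?p (\<lambda>d. f 0 * indicator {0} d + f 1 * indicator {1} d + f d * indicator {2..} d)"
    by (intro Bochner_Integration.integral_cong) auto
  also have "\<dots> = f 0 * pmf ?p 0 + f 1 * pmf ?p 1 + R"
  proof -
    have "integrable ?p (\<lambda>d. f c * indicator {c} d)" for c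
      using f by (intro int) (auto simp: indicator_def)
    moreover have "integrable ?p (\<lambda>d. f d * indicator {2..} d)"
      using f by (intro int) (auto simp: indicator_def)
    ultimately show ?thesis unfolding R_def
      by (simp add: Bochner_Integration.integral_add ind measure_pmf_single del: pmf_poisson)
  qed
  finally have eq: "measure_pmf.expectation ?p f = f 0 * exp (-\<mu>) + f 1 * (\<mu> * exp (-\<mu>)) + R"
    using assms(1) by simp
  have R0: "0 \<le> R" unfolding R_def using f by (intro integral_nonneg_AE) auto
  have "R \<le> measure_pmf.expectation ?p (\<lambda>d. 1 - indicator {0} d - indicator {1} d)"
    unfolding R_def
    by (intro integral_mono int) (auto simp: indicator_def f abs_mult)
  also have "\<dots> = 1 - pmf ?p 0 - pmf ?p 1"
  proof -
    have "integrable ?p (indicator {c} :: nat \<Rightarrow> real)" for c by (intro int) (auto simp: indicator_def)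
    then show ?thesis by (simp add: Bochner_Integration.integral_diff ind measure_pmf_single del: pmf_poisson)
  qed
  finally have R1: "R \<le> 1 - exp (-\<mu>) - \<mu> * exp (-\<mu>)" using assms(1) by simp
  have e1: "1 - \<mu> \<le> exp (-\<mu>)" using exp_ge_add_one_self[of "-\<mu>"] by simp
  have e2: "exp (-\<mu>) \<le> 1 - \<mu> + \<mu>\<^sup>2"
    using assms(1) by (intro exp_minus_le_quadratic) simp
  have e3: "\<mu> * (1 - \<mu>) \<le> \<mu> * exp (-\<mu>)" "\<mu> * exp (-\<mu>) \<le> \<mu>" using e1 assms(1) by auto
  have e4: "0 \<le> \<mu> - \<mu> * exp (-\<mu>)" "\<mu> - \<mu> * exp (-\<mu>) \<le> \<mu>\<^sup>2"
    using e3 by (auto simp: power2_eq_square algebra_simps)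
  have a: "0 \<le> f 0 * (exp (-\<mu>) - (1 - \<mu>))" "f 0 * (exp (-\<mu>) - (1 - \<mu>)) \<le> \<mu>\<^sup>2"
    using f e1 e2 mult_mono[of "f 0" 1 "exp (-\<mu>) - (1 - \<mu>)" "\<mu>\<^sup>2"] by auto
  have b: "0 \<le> f 1 * (\<mu> - \<mu> * exp (-\<mu>))" "f 1 * (\<mu> - \<mu> * exp (-\<mu>)) \<le> \<mu>\<^sup>2"
    using f e4 mult_mono[of "f 1" 1 "\<mu> - \<mu> * exp (-\<mu>)" "\<mu>\<^sup>2"] by auto
  have c: "R \<le> \<mu>\<^sup>2" using R1 e1 e3 by (simp add: power2_eq_square algebra_simps)
  show ?thesis unfolding eq using a b c R0 by (simp add: algebra_simps abs_le_iff)
qed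

text \<open>For independent random matrices the expectation of the product is the product of the
  expectations. This turns the Poisson counts of the cells into deterministic cell matrices.\<close>

lemma (in prob_space) expectation_path_weight:
  fixes D :: "nat \<Rightarrow> 'a \<Rightarrow> nat"
  assumes "finite S" and ind: "indep_vars (\<lambda>_. count_space UNIV) D {..<q}"
    and A: "\<And>l d. substochastic_on S (A l d)" and "x \<in> S" "y \<in> S"
  shows "expectation (\<lambda>\<omega>. path_weight S (\<lambda>l. A l (D l \<omega>)) x q y)
    = path_weight S (\<lambda>l z y. expectation (\<lambda>\<omega>. A l (D l \<omega>) z y)) x q y"
proof -
  have D[measurable]: "D l \<in> measurable M (count_space UNIV)" if "l < q" for l
    using ind that by (auto simp: indep_vars_def)
  have meas: "(\<lambda>\<omega>. path_weight S (\<lambda>l. A l (D l \<omega>)) x m z) \<in> borel_measurable M" if "m \<le> q" for m z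
    using that
  proof (induction m arbitrary: z)
    case (Suc m)
    have [measurable]: "D m \<in> measurable M (count_space UNIV)" using Suc.prems by simp
    have [measurable]: "(\<lambda>\<omega>. path_weight S (\<lambda>l. A l (D l \<omega>)) x m z) \<in> borel_measurable M" for z
      using Suc by simp
    show ?case unfolding path_weight.simps by measurable
  qed simp
  \<comment> \<open>The induction needs bounded scalar functions \<open>h l\<close> of the
    increments not yet used: the factor peeled off at step \<open>m\<close> is stored there until
    independence is applied in the base case. For \<open>m = q\<close> this product is
    empty.\<close>
  have gen: "expectation (\<lambda>\<omega>. path_weight S (\<lambda>l. A l (D l \<omega>)) x m y * (\<Prod>l=m..<q. h l (D l \<omega>)))
    = path_weight S (\<lambda>l z y. expectation (\<lambda>\<omega>. A l (D l \<omega>) z y)) x m y * (\<Prod>l=m..<q. expectation (\<lambda>\<omega>. h l (D l \<omega>)))"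
    if "m \<le> q" "\<And>l d. \<bar>h l d\<bar> \<le> 1" "y \<in> S" for m y and h :: "nat \<Rightarrow> nat \<Rightarrow> real"
    using that
  proof (induction m arbitrary: y h)
    case 0
    have "expectation (\<lambda>\<omega>. \<Prod>l=0..<q. h l (D l \<omega>)) = (\<Prod>l=0..<q. expectation (\<lambda>\<omega>. h l (D l \<omega>)))"
    proof (rule indep_vars_lebesgue_integral)
      show "indep_vars (\<lambda>_. borel) (\<lambda>l \<omega>. h l (D l \<omega>)) {0..<q}"
        by (rule indep_vars_compose2[where M'="\<lambda>_. count_space UNIV"]) (use ind in \<open>auto simp: lessThan_atLeast0\<close>)
      show "integrable M (\<lambda>\<omega>. h l (D l \<omega>))" if "l \<in> {0..<q}" for l
      proof (rule integrable_const_bound[where B=1])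
        have [measurable]: "D l \<in> measurable M (count_space UNIV)" using that by simp
        show "(\<lambda>\<omega>. h l (D l \<omega>)) \<in> borel_measurable M" by measurable
      qed (use 0 in auto)
    qed auto
    then show ?case by simp
  next
    case (Suc m)
    have mq: "m < q" using Suc.prems by simp
    \<comment> \<open>Slot \<open>m\<close> of \<open>h\<close> is free in the claim for
      \<open>Suc m\<close>, so it can hold the matrix entry.\<close>
    define H where "H z = h(m := (\<lambda>d. A m d z y))" for z
    have A1: "\<bar>A m d z y\<bar> \<le> 1" if "z \<in> S" for d z
    proof -
      have "A m d z y \<le> (\<Sum>y\<in>S. A m d z y)"
        using A[of m d] that Suc.prems assms(1) by (intro member_le_sum) (auto simp: substochastic_on_def)
      then show ?thesis using A[of m d] that Suc.prems by (fastforce simp: substochastic_on_def)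
    qed
    have H1: "\<bar>H z l d\<bar> \<le> 1" if "z \<in> S" for z l d
      using A1[OF that] Suc.prems by (auto simp: H_def)
    have split: "(\<Prod>l=m..<q. H z l (D l \<omega>)) = A m (D m \<omega>) z y * (\<Prod>l=Suc m..<q. h l (D l \<omega>))" for z \<omega>
      using mq by (subst prod.atLeast_Suc_lessThan) (auto simp: H_def)
    have "expectation (\<lambda>\<omega>. path_weight S (\<lambda>l. A l (D l \<omega>)) x (Suc m) y * (\<Prod>l=Suc m..<q. h l (D l \<omega>)))
      = expectation (\<lambda>\<omega>. \<Sum>z\<in>S. path_weight S (\<lambda>l. A l (D l \<omega>)) x m z * (\<Prod>l=m..<q. H z l (D l \<omega>)))"
      unfolding split by (simp add: sum_distrib_right mult.assoc)
    also have "\<dots> = (\<Sum>z\<in>S. expectation (\<lambda>\<omega>. path_weight S (\<lambda>l. A l (D l \<omega>)) x m z * (\<Prod>l=m..<q. H z l (D l \<omega>))))"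
    proof (rule Bochner_Integration.integral_sum, rule integrable_const_bound[where B=1])
      fix z assume z: "z \<in> S"
      show "AE \<omega> in M. norm (path_weight S (\<lambda>l. A l (D l \<omega>)) x m z * (\<Prod>l=m..<q. H z l (D l \<omega>))) \<le> 1"
      proof (rule AE_I2)
        fix \<omega>
        have "\<bar>\<Prod>l=m..<q. H z l (D l \<omega>)\<bar> \<le> 1"
          unfolding abs_prod using H1[OF z] by (intro prod_le_1) auto
        moreover have "\<bar>path_weight S (\<lambda>l. A l (D l \<omega>)) x m z\<bar> \<le> 1"
          using path_weight_nonneg[of m S "\<lambda>l. A l (D l \<omega>)" z x]
            path_weight_le_1[of S x z m "\<lambda>l. A l (D l \<omega>)"] A z assms by auto
        ultimately show "norm (path_weight S (\<lambda>l. A l (D l \<omega>)) x m z * (\<Prod>l=m..<q. H z l (D l \<omega>))) \<le> 1"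
          by (simp add: abs_mult mult_le_one)
      qed
      have [measurable]: "(\<lambda>\<omega>. H z l (D l \<omega>)) \<in> borel_measurable M" if "l \<in> {m..<q}" for l
      proof -
        have [measurable]: "D l \<in> measurable M (count_space UNIV)" using that by simp
        show ?thesis by measurable
      qed
      have [measurable]: "(\<lambda>\<omega>. path_weight S (\<lambda>l. A l (D l \<omega>)) x m z) \<in> borel_measurable M"
        using mq by (intro meas) simp
      show "(\<lambda>\<omega>. path_weight S (\<lambda>l. A l (D l \<omega>)) x m z * (\<Prod>l=m..<q. H z l (D l \<omega>))) \<in> borel_measurable M"
        by (intro borel_measurable_times borel_measurable_prod) auto
    qed
    also have "\<dots> = (\<Sum>z\<in>S. path_weight S (\<lambda>l z y. expectation (\<lambda>\<omega>. A l (D l \<omega>) z y)) x m z *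
        (\<Prod>l=m..<q. expectation (\<lambda>\<omega>. H z l (D l \<omega>))))"
      using Suc.IH[OF _ H1] mq by (intro sum.cong) auto
    also have "\<dots> = (\<Sum>z\<in>S. path_weight S (\<lambda>l z y. expectation (\<lambda>\<omega>. A l (D l \<omega>) z y)) x m z *
        (expectation (\<lambda>\<omega>. A m (D m \<omega>) z y) * (\<Prod>l=Suc m..<q. expectation (\<lambda>\<omega>. h l (D l \<omega>)))))"
    proof (intro sum.cong refl)
      fix z
      have "(\<Prod>l=Suc m..<q. expectation (\<lambda>\<omega>. H z l (D l \<omega>))) = (\<Prod>l=Suc m..<q. expectation (\<lambda>\<omega>. h l (D l \<omega>)))"
        by (intro prod.cong) (auto simp: H_def)
      then show "path_weight S (\<lambda>l z y. expectation (\<lambda>\<omega>. A l (D l \<omega>) z y)) x m z *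
        (\<Prod>l=m..<q. expectation (\<lambda>\<omega>. H z l (D l \<omega>))) = path_weight S (\<lambda>l z y. expectation (\<lambda>\<omega>. A l (D l \<omega>) z y)) x m z *
        (expectation (\<lambda>\<omega>. A m (D m \<omega>) z y) * (\<Prod>l=Suc m..<q. expectation (\<lambda>\<omega>. h l (D l \<omega>))))"
        using mq by (subst prod.atLeast_Suc_lessThan) (auto simp: H_def)
    qed
    finally show ?case by (simp add: sum_distrib_right mult.assoc)
  qed
  show ?thesis using gen[of q "\<lambda>_ _. 0" y] assms(5) by simp
qed

section \<open>Independent sigma-algebras and conditioning on a discrete variable\<close>

lemma (in prob_space) indep_sets_expectation_prod:
  fixes Y :: "'i \<Rightarrow> 'a \<Rightarrow> real"
  assumes "finite I" "indep_sets G I"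
    and Y: "\<And>i B. i \<in> I \<Longrightarrow> B \<in> sets borel \<Longrightarrow> Y i -` B \<inter> space M \<in> G i"
    and bd: "\<And>i \<omega>. i \<in> I \<Longrightarrow> \<omega> \<in> space M \<Longrightarrow> \<bar>Y i \<omega>\<bar> \<le> 1"
  shows "expectation (\<lambda>\<omega>. \<Prod>i\<in>I. Y i \<omega>) = (\<Prod>i\<in>I. expectation (Y i))"
proof (rule indep_vars_lebesgue_integral[OF assms(1)])
  have rv: "Y i \<in> borel_measurable M" if "i \<in> I" for i
    using Y[OF that] assms(2) that by (intro measurableI) (auto simp: indep_sets_def)
  show "indep_vars (\<lambda>_. borel) Y I"
    unfolding indep_vars_def2 using rv Y by (auto intro: indep_sets_mono_sets[OF assms(2)])
  show "integrable M (Y i)" if "i \<in> I" for i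
    by (rule integrable_const_bound[where B=1]) (use rv bd that in auto)
qed

text \<open>Makes the generated events the sigma-algebra of a measure space, so that membership of
  an event can be derived from measurability of functions.\<close>

lemma sets_generated_events [simp]:
  "sets (sigma (space M) (generated_events M B Y I)) = generated_events M B Y I"
proof -
  have sub: "{Y i -` A \<inter> space M | i A. i \<in> I \<and> A \<in> sets B} \<subseteq> Pow (space M)" by auto
  have "generated_events M B Y I \<subseteq> Pow (space M)"
    unfolding generated_events_def using sigma_sets_into_sp[OF sub] by auto
  then show ?thesis
    by (simp add: generated_events_def sigma_sets_sigma_sets_eq[OF sub])
qed

lemma measurable_generated_events:
  assumes "i \<in> I" "\<And>\<omega>. \<omega> \<in> space M \<Longrightarrow> Y i \<omega> \<in> space B"
  shows "Y i \<in> measurable (sigma (space M) (generated_events M B Y I)) B"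
proof (rule measurableI)
  fix A assume "A \<in> sets B"
  then show "Y i -` A \<inter> space (sigma (space M) (generated_events M B Y I)) \<in> sets (sigma (space M) (generated_events M B Y I))"
    unfolding sets_generated_events using assms(1)
    by (auto simp: generated_events_def space_measure_of_conv)
qed (use assms(2) in \<open>auto simp: space_measure_of_conv\<close>)

lemma generated_events_measurableD:
  "f \<in> borel_measurable (sigma (space M) (generated_events M B Y I)) \<Longrightarrow> A \<in> sets borel \<Longrightarrow>
    f -` A \<inter> space M \<in> generated_events M B Y I"
  using measurable_sets[of f "sigma (space M) (generated_events M B Y I)" borel A]
  by (simp add: space_measure_of_conv)

text \<open>If every frozen integrand \<open>G v\<close> is uncorrelated with the event
  \<open>V = v\<close>, then averaging over \<open>V\<close> may be done last. Countability of the
  values reduces this to finite sums over codes and dominated convergence.\<close>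

lemma (in prob_space) expectation_freeze:
  fixes V :: "'a \<Rightarrow> 'v::countable"
  assumes V: "V \<in> measurable M (count_space UNIV)"
    and G: "\<And>v. G v \<in> borel_measurable M" "\<And>v \<omega>. \<omega> \<in> space M \<Longrightarrow> \<bar>G v \<omega>\<bar> \<le> 1"
    and fr: "\<And>v. expectation (\<lambda>\<omega>. of_bool (V \<omega> = v) * G v \<omega>) = prob {\<omega> \<in> space M. V \<omega> = v} * expectation (G v)"
  shows "expectation (\<lambda>\<omega>. G (V \<omega>) \<omega>) = expectation (\<lambda>\<omega>. expectation (G (V \<omega>)))"
proof -
  note [measurable] = V G(1)
  have lim: "(\<lambda>n. expectation (\<lambda>\<omega>. \<Sum>i<n. of_bool (to_nat (V \<omega>) = i) * H (from_nat i) \<omega>))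
      \<longlonglongrightarrow> expectation (\<lambda>\<omega>. H (V \<omega>) \<omega>)"
    if H[measurable]: "\<And>v. H v \<in> borel_measurable M" and b: "\<And>v \<omega>. \<omega> \<in> space M \<Longrightarrow> \<bar>H v \<omega>\<bar> \<le> 1"
    for H :: "'v \<Rightarrow> 'a \<Rightarrow> real"
  proof -
    have eq: "(\<Sum>i<n. of_bool (to_nat (V \<omega>) = i) * H (from_nat i) \<omega>)
      = (if to_nat (V \<omega>) < n then H (V \<omega>) \<omega> else 0)" for n \<omega>
    proof -
      have "(\<Sum>i<n. of_bool (to_nat (V \<omega>) = i) * H (from_nat i) \<omega>) = (\<Sum>i<n. if to_nat (V \<omega>) = i then H (from_nat i) \<omega> else 0)"
        by (intro sum.cong) auto
      also have "\<dots> = (if to_nat (V \<omega>) < n then H (V \<omega>) \<omega> else 0)" by simp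
      finally show ?thesis .
    qed
    have ptw: "(\<lambda>n. \<Sum>i<n. of_bool (to_nat (V \<omega>) = i) * H (from_nat i) \<omega>) \<longlonglongrightarrow> H (V \<omega>) \<omega>" for \<omega>
      unfolding eq by (rule tendsto_eventually, rule eventually_sequentiallyI[of "Suc (to_nat (V \<omega>))"]) auto
    have m: "(\<lambda>\<omega>. \<Sum>i<n. of_bool (to_nat (V \<omega>) = i) * H (from_nat i) \<omega>) \<in> borel_measurable M" for n
      by measurable
    have "(\<lambda>\<omega>. H (V \<omega>) \<omega>) \<in> borel_measurable M"
      by (rule borel_measurable_LIMSEQ_metric[OF m ptw])
    moreover have "AE \<omega> in M. norm (\<Sum>i<n. of_bool (to_nat (V \<omega>) = i) * H (from_nat i) \<omega>) \<le> 1" for n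
      using b by (intro AE_I2) (auto simp: eq)
    ultimately show ?thesis
      using ptw m by (intro integral_dominated_convergence[where w="\<lambda>_. 1"]) (auto intro: AE_I2)
  qed
  have part: "expectation (\<lambda>\<omega>. \<Sum>i<n. of_bool (to_nat (V \<omega>) = i) * G (from_nat i) \<omega>)
    = expectation (\<lambda>\<omega>. \<Sum>i<n. of_bool (to_nat (V \<omega>) = i) * expectation (G (from_nat i)))" for n
  proof -
    have int: "integrable M (\<lambda>\<omega>. of_bool (to_nat (V \<omega>) = i) * H \<omega>)"
      if [measurable]: "H \<in> borel_measurable M" and "\<And>\<omega>. \<omega> \<in> space M \<Longrightarrow> \<bar>H \<omega>\<bar> \<le> 1" for i and H :: "'a \<Rightarrow> real"
      by (rule integrable_const_bound[where B=1]) (use that(2) in \<open>auto simp: abs_mult\<close>)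
    have E1: "\<bar>expectation (G v)\<bar> \<le> 1" for v
    proof -
      have iG: "integrable M (G v)" by (rule integrable_const_bound[where B=1]) (use G in auto)
      have "\<bar>expectation (G v)\<bar> \<le> expectation (\<lambda>\<omega>. \<bar>G v \<omega>\<bar>)" by (rule integral_abs_bound)
      also have "\<dots> \<le> expectation (\<lambda>_. 1)" using iG G by (intro integral_mono) auto
      finally show ?thesis by (simp add: prob_space)
    qed
    have "expectation (\<lambda>\<omega>. of_bool (to_nat (V \<omega>) = i) * G (from_nat i) \<omega>)
      = expectation (\<lambda>\<omega>. of_bool (to_nat (V \<omega>) = i) * expectation (G (from_nat i)))" for i
    proof (cases "i \<in> range (to_nat :: 'v \<Rightarrow> nat)")
      case True
      then obtain v :: 'v where v: "i = to_nat v" by auto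
      have "expectation (\<lambda>\<omega>. of_bool (V \<omega> = v) * expectation (G v)) = prob {\<omega> \<in> space M. V \<omega> = v} * expectation (G v)"
      proof -
        have "expectation (\<lambda>\<omega>. of_bool (V \<omega> = v)) = expectation (indicator {\<omega> \<in> space M. V \<omega> = v})"
          by (intro Bochner_Integration.integral_cong) (auto simp: indicator_def)
        also have "\<dots> = prob {\<omega> \<in> space M. V \<omega> = v}" by (simp add: Int_absorb1)
        finally show ?thesis by simp
      qed
      then show ?thesis using fr[of v] by (auto simp: v)
    next
      \<comment> \<open>Codes outside the range of \<open>to_nat\<close> carry no mass, whatever
        \<open>from_nat\<close> returns on them.\<close>
      case False
      then have "to_nat (V \<omega>) \<noteq> i" for \<omega> by auto
      then show ?thesis by simp
    qed
    then show ?thesis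
      by (subst (1 2) Bochner_Integration.integral_sum) (use int[of "\<lambda>_. 1"] in \<open>auto intro!: int G E1\<close>)
  qed
  have "\<bar>expectation (G v)\<bar> \<le> 1" for v
  proof -
    have iG: "integrable M (G v)" by (rule integrable_const_bound[where B=1]) (use G in auto)
    have "\<bar>expectation (G v)\<bar> \<le> expectation (\<lambda>\<omega>. \<bar>G v \<omega>\<bar>)" by (rule integral_abs_bound)
    also have "\<dots> \<le> expectation (\<lambda>_. 1)" using iG G by (intro integral_mono) auto
    finally show ?thesis by (simp add: prob_space)
  qed
  then have lim': "(\<lambda>n. expectation (\<lambda>\<omega>. \<Sum>i<n. of_bool (to_nat (V \<omega>) = i) * expectation (G (from_nat i))))
      \<longlonglongrightarrow> expectation (\<lambda>\<omega>. expectation (G (V \<omega>)))"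
    by (intro lim) auto
  show ?thesis by (rule LIMSEQ_unique[OF lim[of G, OF G, unfolded part] lim'])
qed

section \<open>The transform of the queue\<close>

lemma jump_time_le: "0 \<le> s \<Longrightarrow> i \<le> N s \<omega> \<Longrightarrow> jump_time N i \<omega> \<le> s"
  unfolding jump_time_def by (rule cInf_lower) (auto intro: bdd_belowI[of _ 0])

text \<open>Right-continuity keeps the count at \<open>N s\<close> for a while after
  \<open>s\<close>, which makes the inequality strict. The bound \<open>i \<le> N t\<close> keeps
  the set in \<open>jump_time\<close> nonempty, so that \<open>Inf\<close> has its usual
  meaning.\<close>

lemma jump_time_gt:
  assumes "0 \<le> s" "N s \<omega> < i" "i \<le> N t \<omega>" "0 \<le> t" "mono_on {0..} (\<lambda>t. N t \<omega>)"
    and cont: "continuous (at s within ({0..} \<inter> {s..})) (\<lambda>t. N t \<omega> :: nat)"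
  shows "s < jump_time N i \<omega>"
proof -
  have "eventually (\<lambda>v. N v \<omega> = N s \<omega>) (at s within ({0..} \<inter> {s..}))"
    using cont by (simp add: continuous_within tendsto_discrete)
  then obtain d where d: "d > 0" "\<And>v. v \<in> {0..} \<inter> {s..} \<Longrightarrow> v \<noteq> s \<Longrightarrow> dist v s < d \<Longrightarrow> N v \<omega> = N s \<omega>"
    unfolding eventually_at by auto
  have "s + d / 2 \<le> jump_time N i \<omega>"
    unfolding jump_time_def
  proof (rule cInf_greatest)
    show "{s. 0 \<le> s \<and> i \<le> N s \<omega>} \<noteq> {}" using assms by auto
    fix w assume w: "w \<in> {s. 0 \<le> s \<and> i \<le> N s \<omega>}"
    show "s + d / 2 \<le> w"
    proof (rule ccontr)
      assume "\<not> s + d / 2 \<le> w"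
      then have "N w \<omega> \<le> N s \<omega>"
      proof (cases "w \<le> s")
        case True
        then show ?thesis using w assms(1) monotone_onD[OF assms(5), of w s] by auto
      next
        case False
        then have "N w \<omega> = N s \<omega>"
          using w assms(1) \<open>\<not> s + d / 2 \<le> w\<close> d by (intro d(2)) (auto simp: dist_real_def)
        then show ?thesis by simp
      qed
      then show False using w assms(2) by auto
    qed
  qed
  then show ?thesis using d(1) by simp
qed

text \<open>With \<open>m l\<close> the number of arrivals up to the \<open>l\<close>-th grid time,
  this is the index of the cell that holds the \<open>i\<close>-th arrival. Arrivals are numbered
  from 1.\<close>

definition cell :: "(nat \<Rightarrow> nat) \<Rightarrow> nat \<Rightarrow> nat" where
  "cell m i = (LEAST l. i \<le> m (Suc l))"

lemma cell_eq:
  assumes "mono m" "m l < i" "i \<le> m (Suc l)"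
  shows "cell m i = l"
  unfolding cell_def
proof (rule Least_equality)
  fix l' assume "i \<le> m (Suc l')"
  then show "l \<le> l'" using assms monoD[OF assms(1), of "Suc l'" l] by (force simp: not_le[symmetric])
qed fact

lemma cell_bounds:
  assumes "m 0 < i" "i \<le> m q"
  shows "m (cell m i) < i" "i \<le> m (Suc (cell m i))" "cell m i < q"
proof -
  obtain q' where q': "q = Suc q'" using assms by (cases q) auto
  show "i \<le> m (Suc (cell m i))"
    unfolding cell_def by (rule LeastI[of _ q']) (use assms q' in auto)
  have "cell m i \<le> q'"
    unfolding cell_def by (rule Least_le) (use assms q' in auto)
  then show "cell m i < q" using q' by simp
  show "m (cell m i) < i"
  proof (cases "cell m i")
    case (Suc l)
    then have "\<not> i \<le> m (Suc l)"
      unfolding cell_def using not_less_Least[of l "\<lambda>l. i \<le> m (Suc l)"] by auto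
    then show ?thesis using Suc by simp
  qed (use assms in simp)
qed

text \<open>All arrivals of one cell carry the same matrix, so the product over arrivals groups into
  powers, one for each cell. The shift \<open>Suc i\<close> arises because arrivals are numbered
  from 1 and matrices from 0.\<close>

lemma path_weight_blocks:
  assumes "finite S" "mono m" "m 0 = 0" "y \<in> S"
  shows "path_weight S (\<lambda>i. W (cell m (Suc i))) x (m q) y
    = path_weight S (\<lambda>l z y. path_weight S (\<lambda>_. W l) z (m (Suc l) - m l) y) x q y"
  using assms(4)
proof (induction q arbitrary: y)
  case 0
  then show ?case using assms(3) by simp
next
  case (Suc q)
  define d where "d = m (Suc q) - m q"
  have d: "m (Suc q) = m q + d" using monoD[OF assms(2), of q "Suc q"] by (simp add: d_def)
  have "path_weight S (\<lambda>i. W (cell m (Suc (m q + i)))) z d y = path_weight S (\<lambda>_. W q) z d y" for z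
    using Suc.prems by (intro path_weight_cong) (auto simp: cell_eq[OF assms(2), of q] d)
  then show ?case
    unfolding path_weight.simps(2) d_def[symmetric] d path_weight_add[OF assms(1) Suc.prems]
    using Suc.IH by simp
qed

lemma substochastic_path_weight:
  assumes "finite S" "\<And>l. l < m \<Longrightarrow> substochastic_on S (A l)"
  shows "substochastic_on S (\<lambda>x y. path_weight S A x m y)"
  using assms path_weight_nonneg[of m S A] path_weight_sum_le[OF assms(1), of _ m A]
  by (auto simp: substochastic_on_def)

lemma borel_measurable_vecI:
  fixes f :: "'a \<Rightarrow> real ^ 'k"
  assumes "\<And>j. (\<lambda>\<omega>. f \<omega> $ j) \<in> borel_measurable M"
  shows "f \<in> borel_measurable M"
  by (subst borel_measurable_euclidean_space) (auto simp: Basis_vec_def inner_axis assms)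

lemma borel_measurable_vec_nth [measurable (raw)]:
  fixes f :: "'a \<Rightarrow> real ^ 'k"
  assumes "f \<in> borel_measurable M"
  shows "(\<lambda>\<omega>. f \<omega> $ j) \<in> borel_measurable M"
  by (rule measurable_compose[OF assms borel_measurable_nth])

text \<open>One fixed n: \<open>p\<close>, \<open>r\<close>, \<open>c\<close> stand for the rescaled
  matrix, the arrival rate and the divisor n of the service times, \<open>F j\<close> is the common
  tail of the unscaled \<open>L i j\<close>, and \<open>s\<close> is the argument of the Laplace
  transform.\<close>

locale rescaled_queue = prob_space M for M :: "'a measure" +
  fixes S :: "(real ^ 'k) set" and p :: "real ^ 'k \<Rightarrow> real ^ 'k \<Rightarrow> real" and \<pi> :: "real ^ 'k \<Rightarrow> real"
    and N :: "real \<Rightarrow> 'a \<Rightarrow> nat" and X :: "nat \<Rightarrow> 'a \<Rightarrow> real ^ 'k" and L :: "nat \<Rightarrow> 'k \<Rightarrow> 'a \<Rightarrow> real"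
    and r c t :: real and F :: "'k \<Rightarrow> real \<Rightarrow> real" and s :: "'k \<Rightarrow> real"
  assumes S: "finite S" "\<And>x j. x \<in> S \<Longrightarrow> 0 \<le> x $ j"
    and stoch: "stochastic_matrix_on S p"
    and N: "poisson_process M {0..} r N"
    and X: "markov_chain M S \<pi> p X"
    and L: "indep_vars (\<lambda>_. borel) (\<lambda>(i, j). L i j) UNIV"
    and F: "\<And>i j z. prob {\<omega> \<in> space M. L i j \<omega> > z} = F j z"
    and indep: "indep_sets (\<lambda>m. [generated_events M (count_space UNIV) N {0..},
                 generated_events M borel X UNIV,
                 generated_events M borel (\<lambda>(i, j). L i j) UNIV] ! m) {..<3}"
    and pos: "0 < r" "0 < c" "0 < t" and s: "\<And>j. 0 \<le> s j"
begin

text \<open>The Laplace transform of what one customer with marks \<open>y\<close> contributes a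
  time \<open>\<rho>\<close> after arrival: coordinate \<open>j\<close> still counts with
  probability \<open>F j (c * \<rho>)\<close>, independently over \<open>j\<close>.\<close>

definition \<phi> :: "real ^ 'k \<Rightarrow> real \<Rightarrow> real" where
  "\<phi> y \<rho> = (\<Prod>j\<in>UNIV. 1 - (1 - exp (- (s j * y $ j))) * F j (c * \<rho>))"

lemma meas_L [measurable]: "L i j \<in> borel_measurable M"
  using L unfolding indep_vars_def by (metis (mono_tags, lifting) UNIV_I case_prod_conv)

lemma meas_X [measurable]: "X i \<in> borel_measurable M"
  using X by (simp add: markov_chain_def)

lemma X_in: "\<omega> \<in> space M \<Longrightarrow> X i \<omega> \<in> S"
  using X by (simp add: markov_chain_def)

lemma meas_N: "0 \<le> v \<Longrightarrow> N v \<in> measurable M (count_space UNIV)"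
  using N by (simp add: poisson_process_def)

lemma F_bounds: "0 \<le> F j z" "F j z \<le> 1"
  using F[where i=0 and j=j and z=z] measure_nonneg prob_le_1 by metis+

lemma \<phi>_factor: "y \<in> S \<Longrightarrow> 0 \<le> 1 - (1 - exp (- (s j * y $ j))) * F j z \<and> 1 - (1 - exp (- (s j * y $ j))) * F j z \<le> 1"
  using F_bounds[of j z] S(2)[of y j] s[of j]
    mult_mono[of "1 - exp (- (s j * y $ j))" 1 "F j z" 1] by auto

lemma \<phi>_bounds: "y \<in> S \<Longrightarrow> 0 \<le> \<phi> y \<rho>" "y \<in> S \<Longrightarrow> \<phi> y \<rho> \<le> 1"
  unfolding \<phi>_def using \<phi>_factor by (auto intro!: prod_nonneg prod_le_1)

lemma substochastic: "substochastic_on S (\<lambda>z y. p z y * \<phi> y \<rho>)"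
  unfolding substochastic_on_def
proof (intro conjI ballI)
  fix x assume x: "x \<in> S"
  have "(\<Sum>y\<in>S. p x y * \<phi> y \<rho>) \<le> (\<Sum>y\<in>S. p x y * 1)"
    using stoch x \<phi>_bounds by (intro sum_mono mult_left_mono) (auto simp: stochastic_matrix_on_def)
  also have "\<dots> = 1" using stoch x by (simp add: stochastic_matrix_on_def)
  finally show "(\<Sum>y\<in>S. p x y * \<phi> y \<rho>) \<le> 1" .
next
  fix x y assume "x \<in> S" "y \<in> S"
  then show "0 \<le> p x y * \<phi> y \<rho>" using stoch \<phi>_bounds by (auto simp: stochastic_matrix_on_def)
qed

text \<open>If the past has probability zero, so has its extension; the product form therefore holds
  without conditioning.\<close>

lemma X_law:
  assumes "\<forall>i\<le>Suc l. z i \<in> S"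
  shows "prob {\<omega> \<in> space M. \<forall>i\<le>Suc l. X i \<omega> = z i}
      = prob {\<omega> \<in> space M. \<forall>i\<le>l. X i \<omega> = z i} * p (z l) (z (Suc l))"
proof (cases "prob {\<omega> \<in> space M. \<forall>i\<le>l. X i \<omega> = z i} > 0")
  case True
  then have "cond_prob M (\<lambda>\<omega>. X (Suc l) \<omega> = z (Suc l)) (\<lambda>\<omega>. \<forall>i\<le>l. X i \<omega> = z i) = p (z l) (z (Suc l))"
    using X assms unfolding markov_chain_def by blast
  moreover have "{\<omega> \<in> space M. X (Suc l) \<omega> = z (Suc l) \<and> (\<forall>i\<le>l. X i \<omega> = z i)} = {\<omega> \<in> space M. \<forall>i\<le>Suc l. X i \<omega> = z i}"
    by (auto simp: le_Suc_eq)
  ultimately show ?thesis using True unfolding cond_prob_def by (simp add: field_simps)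
next
  case False
  have "prob {\<omega> \<in> space M. \<forall>i\<le>Suc l. X i \<omega> = z i} \<le> prob {\<omega> \<in> space M. \<forall>i\<le>l. X i \<omega> = z i}"
    by (intro finite_measure_mono) auto
  then show ?thesis using False measure_nonneg[of M] by (smt (verit) mult_eq_0_iff)
qed

text \<open>For a frozen path of marks and frozen ages \<open>\<tau> i\<close>, the exponential is a
  product over customers and coordinates of functions of independent service times.\<close>

lemma expectation_service:
  assumes "\<And>i. i \<in> {1..m} \<Longrightarrow> \<zeta> i \<in> S"
  shows "expectation (\<lambda>\<omega>. exp (- (\<Sum>j\<in>UNIV. s j * (\<Sum>i=1..m. \<zeta> i $ j * of_bool (\<tau> i < L i j \<omega> / c)))))
    = (\<Prod>i=1..m. \<phi> (\<zeta> i) (\<tau> i))"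
proof -
  define Y where "Y = (\<lambda>(i, j) l. exp (- (s j * (\<zeta> i $ j * of_bool (\<tau> i < l / c)))))"
  have [measurable]: "Y a \<in> borel_measurable borel" for a by (cases a) (simp add: Y_def)
  have EY: "expectation (\<lambda>\<omega>. Y (i, j) (L i j \<omega>)) = 1 - (1 - exp (- (s j * \<zeta> i $ j))) * F j (c * \<tau> i)" for i j
  proof -
    have "expectation (\<lambda>\<omega>. Y (i, j) (L i j \<omega>))
      = expectation (\<lambda>\<omega>. 1 - (1 - exp (- (s j * \<zeta> i $ j))) * indicator {\<omega> \<in> space M. L i j \<omega> > c * \<tau> i} \<omega>)"
      using pos(2) by (intro Bochner_Integration.integral_cong) (auto simp: Y_def indicator_def field_simps)
    also have "\<dots> = 1 - (1 - exp (- (s j * \<zeta> i $ j))) * prob {\<omega> \<in> space M. L i j \<omega> > c * \<tau> i}"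
      by (subst Bochner_Integration.integral_diff)
        (auto intro!: integrable_mult_right integrable_real_indicator simp: prob_space less_top[symmetric] Int_absorb1)
    finally show ?thesis by (simp add: F)
  qed
  have "exp (- (\<Sum>j\<in>UNIV. s j * (\<Sum>i=1..m. \<zeta> i $ j * of_bool (\<tau> i < L i j \<omega> / c))))
    = (\<Prod>a\<in>{1..m} \<times> UNIV. Y a ((\<lambda>(i, j). L i j) a \<omega>))" for \<omega>
  proof -
    have "(\<Sum>j\<in>UNIV. s j * (\<Sum>i=1..m. \<zeta> i $ j * of_bool (\<tau> i < L i j \<omega> / c)))
      = (\<Sum>i=1..m. \<Sum>j\<in>UNIV. s j * (\<zeta> i $ j * of_bool (\<tau> i < L i j \<omega> / c)))"
      by (subst sum.swap) (simp only: sum_distrib_left)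
    then show ?thesis
      by (simp add: sum.cartesian_product sum_negf[symmetric] exp_sum Y_def split_def)
  qed
  then have "expectation (\<lambda>\<omega>. exp (- (\<Sum>j\<in>UNIV. s j * (\<Sum>i=1..m. \<zeta> i $ j * of_bool (\<tau> i < L i j \<omega> / c)))))
    = expectation (\<lambda>\<omega>. \<Prod>a\<in>{1..m} \<times> UNIV. Y a ((\<lambda>(i, j). L i j) a \<omega>))" by simp
  also have "\<dots> = (\<Prod>a\<in>{1..m} \<times> UNIV. expectation (\<lambda>\<omega>. Y a ((\<lambda>(i, j). L i j) a \<omega>)))"
  proof (rule indep_vars_lebesgue_integral)
    show "indep_vars (\<lambda>_. borel) (\<lambda>a \<omega>. Y a ((\<lambda>(i, j). L i j) a \<omega>)) ({1..m} \<times> UNIV)"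
      by (rule indep_vars_compose2[where M'="\<lambda>_. borel"]) (auto intro: indep_vars_subset[OF L])
    show "integrable M (\<lambda>\<omega>. Y a ((\<lambda>(i, j). L i j) a \<omega>))" if "a \<in> {1..m} \<times> UNIV" for a
    proof (rule integrable_const_bound[where B=1])
      have "0 \<le> s (snd a) * \<zeta> (fst a) $ snd a"
        using that assms s S(2) by auto
      then show "AE \<omega> in M. norm (Y a ((\<lambda>(i, j). L i j) a \<omega>)) \<le> 1"
        by (intro AE_I2) (auto simp: Y_def split_def of_bool_def)
    qed (auto simp: split_def)
  qed auto
  also have "\<dots> = (\<Prod>a\<in>{1..m} \<times> UNIV. 1 - (1 - exp (- (s (snd a) * \<zeta> (fst a) $ snd a))) * F (snd a) (c * \<tau> (fst a)))"
    by (intro prod.cong refl) (auto simp: EY)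
  also have "\<dots> = (\<Prod>i=1..m. \<phi> (\<zeta> i) (\<tau> i))"
    unfolding \<phi>_def by (simp add: prod.cartesian_product split_def)
  finally show ?thesis .
qed

text \<open>The number of arrivals and their ages are deterministic here. The three independent
  sources then factor: the event \<open>A\<close> of the arrivals, the chain, and the service times,
  which leave the weights \<open>\<phi>\<close> on the chain. A general event \<open>A\<close>
  prepares the later conditioning on grid counts.\<close>

lemma expectation_frozen:
  assumes A: "A \<in> generated_events M (count_space UNIV) N {0..}" and "x \<in> S" "y \<in> S"
  shows "expectation (\<lambda>\<omega>. indicator A \<omega> * (of_bool (X 0 \<omega> = x) *
      exp (- (\<Sum>j\<in>UNIV. s j * (\<Sum>i=1..m. X i \<omega> $ j * of_bool (\<tau> i < L i j \<omega> / c)))) * of_bool (X m \<omega> = y)))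
    = prob A * (prob {\<omega> \<in> space M. X 0 \<omega> = x} * path_weight S (\<lambda>i z y. p z y * \<phi> y (\<tau> (Suc i))) x m y)"
proof -
  define T where "T = PiE {..m} (\<lambda>_. S)"
  have T: "finite T" unfolding T_def using S by (intro finite_PiE) auto
  define E where "E u = {\<omega> \<in> space M. \<forall>i\<le>m. X i \<omega> = u i}" for u
  have GX: "X i \<in> measurable (sigma (space M) (generated_events M borel X UNIV)) borel" for i
    by (rule measurable_generated_events) auto
  have GL: "L i j \<in> borel_measurable (sigma (space M) (generated_events M borel (\<lambda>(i, j). L i j) UNIV))" for i j
    using measurable_generated_events[of "(i, j)" UNIV M "\<lambda>(i, j). L i j" borel] by simp
  have Eg: "E u \<in> generated_events M borel X UNIV" for u
  proof -
    note [measurable] = GX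
    have "{\<omega> \<in> space (sigma (space M) (generated_events M borel X UNIV)). \<forall>i\<le>m. X i \<omega> = u i}
      \<in> sets (sigma (space M) (generated_events M borel X UNIV))"
      by measurable
    then show ?thesis unfolding sets_generated_events by (simp add: E_def space_measure_of_conv)
  qed
  have sub: "[generated_events M (count_space UNIV) N {0..}, generated_events M borel X UNIV,
      generated_events M borel (\<lambda>(i, j). L i j) UNIV] ! i \<subseteq> events" if "i < 3" for i
    using indep that unfolding indep_sets_def by blast
  have "generated_events M borel X UNIV \<subseteq> events" "generated_events M (count_space UNIV) N {0..} \<subseteq> events"
    using sub[of 1] sub[of 0] by simp_all
  then have Ev: "E u \<in> events" "A \<in> events" for u using Eg A by auto
  define \<Gamma> where "\<Gamma> \<zeta> \<omega> = exp (- (\<Sum>j\<in>UNIV. s j * (\<Sum>i=1..m. \<zeta> i $ j * of_bool (\<tau> i < L i j \<omega> / c))))" for \<zeta> \<omega>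
  have \<Gamma>b: "0 \<le> \<Gamma> \<zeta> \<omega>" "\<Gamma> \<zeta> \<omega> \<le> 1" if "\<zeta> \<in> T" for \<zeta> \<omega>
    using that s S(2) by (auto simp: \<Gamma>_def T_def PiE_iff intro!: sum_nonneg mult_nonneg_nonneg)
  have [measurable]: "\<Gamma> \<zeta> \<in> borel_measurable M" for \<zeta> unfolding \<Gamma>_def by measurable
  have prod3: "expectation (\<lambda>\<omega>. indicator A \<omega> * (indicator (E \<zeta>) \<omega> * \<Gamma> \<zeta> \<omega>)) = prob A * (prob (E \<zeta>) * expectation (\<Gamma> \<zeta>))"
    if \<zeta>: "\<zeta> \<in> T" for \<zeta>
  proof -
    define Y where "Y = (\<lambda>m::nat. [indicator A, indicator (E \<zeta>), \<Gamma> \<zeta>] ! m)"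
    have "expectation (\<lambda>\<omega>. \<Prod>i\<in>{..<3}. Y i \<omega>) = (\<Prod>i\<in>{..<3}. expectation (Y i))"
    proof (rule indep_sets_expectation_prod[OF _ indep])
      fix i :: nat and B :: "real set" assume i: "i \<in> {..<3}" and B: "B \<in> sets borel"
      have ind: "indicator A -` B \<inter> space M \<in> generated_events M C Z J"
        if "A \<in> generated_events M C Z J" for A C and Z :: "'j \<Rightarrow> 'a \<Rightarrow> 'c" and J
      proof (rule generated_events_measurableD[OF _ B])
        show "indicator A \<in> borel_measurable (sigma (space M) (generated_events M C Z J))"
          using that by (intro borel_measurable_indicator) simp
      qed
      have "\<Gamma> \<zeta> -` B \<inter> space M \<in> generated_events M borel (\<lambda>(i, j). L i j) UNIV"
        by (rule generated_events_measurableD[OF _ B]) (unfold \<Gamma>_def, use GL in measurable)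
      moreover have "i = 0 \<or> i = 1 \<or> i = 2" using i by auto
      ultimately show "Y i -` B \<inter> space M \<in> [generated_events M (count_space UNIV) N {0..},
                 generated_events M borel X UNIV,
                 generated_events M borel (\<lambda>(i, j). L i j) UNIV] ! i"
        using ind[OF A] ind[OF Eg] by (auto simp: Y_def)
    next
      fix i :: nat and \<omega> assume "i \<in> {..<3}"
      then have "i = 0 \<or> i = 1 \<or> i = 2" by auto
      then show "\<bar>Y i \<omega>\<bar> \<le> 1" using \<Gamma>b[OF \<zeta>] by (auto simp: Y_def indicator_def)
    qed auto
    then show ?thesis using Ev by (simp add: Y_def numeral_3_eq_3 lessThan_Suc mult_ac Int_absorb1 sets.sets_into_space)
  qed
  have "expectation (\<lambda>\<omega>. indicator A \<omega> * (of_bool (X 0 \<omega> = x) *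
      exp (- (\<Sum>j\<in>UNIV. s j * (\<Sum>i=1..m. X i \<omega> $ j * of_bool (\<tau> i < L i j \<omega> / c)))) * of_bool (X m \<omega> = y)))
    = expectation (\<lambda>\<omega>. \<Sum>\<zeta>\<in>T. (of_bool (\<zeta> 0 = x) * of_bool (\<zeta> m = y)) * (indicator A \<omega> * (indicator (E \<zeta>) \<omega> * \<Gamma> \<zeta> \<omega>)))"
  proof (rule Bochner_Integration.integral_cong[OF refl])
    fix \<omega> assume w: "\<omega> \<in> space M"
    have "(\<Sum>\<zeta>\<in>T. (of_bool (\<zeta> 0 = x) * of_bool (\<zeta> m = y)) * (indicator A \<omega> * (indicator (E \<zeta>) \<omega> * \<Gamma> \<zeta> \<omega>)))
      = (\<Sum>\<zeta>\<in>T. (of_bool (\<zeta> 0 = x) * of_bool (\<zeta> m = y) * indicator A \<omega> * \<Gamma> \<zeta> \<omega>) * of_bool (\<forall>i\<le>m. X i \<omega> = \<zeta> i))"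
      using w by (intro sum.cong) (auto simp: E_def indicator_def)
    also have "\<dots> = of_bool (X 0 \<omega> = x) * of_bool (X m \<omega> = y) * indicator A \<omega> * \<Gamma> (restrict (\<lambda>i. X i \<omega>) {..m}) \<omega>"
      unfolding T_def using X_in[OF w] S(1) by (subst path_indicator_sum) auto
    also have "\<Gamma> (restrict (\<lambda>i. X i \<omega>) {..m}) \<omega> = \<Gamma> (\<lambda>i. X i \<omega>) \<omega>"
      unfolding \<Gamma>_def by (intro arg_cong[where f="\<lambda>x. exp (- x)"] sum.cong refl arg_cong2[where f="(*)"]) auto
    finally show "indicator A \<omega> * (of_bool (X 0 \<omega> = x) *
      exp (- (\<Sum>j\<in>UNIV. s j * (\<Sum>i=1..m. X i \<omega> $ j * of_bool (\<tau> i < L i j \<omega> / c)))) * of_bool (X m \<omega> = y))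
      = (\<Sum>\<zeta>\<in>T. (of_bool (\<zeta> 0 = x) * of_bool (\<zeta> m = y)) * (indicator A \<omega> * (indicator (E \<zeta>) \<omega> * \<Gamma> \<zeta> \<omega>)))"
      by (simp add: \<Gamma>_def mult_ac)
  qed
  also have "\<dots> = (\<Sum>\<zeta>\<in>T. (of_bool (\<zeta> 0 = x) * of_bool (\<zeta> m = y)) * (prob A * (prob (E \<zeta>) * expectation (\<Gamma> \<zeta>))))"
  proof (subst Bochner_Integration.integral_sum)
    fix \<zeta> assume "\<zeta> \<in> T"
    then have "integrable M (\<lambda>\<omega>. indicator A \<omega> * (indicator (E \<zeta>) \<omega> * \<Gamma> \<zeta> \<omega>))"
      using Ev \<Gamma>b by (intro integrable_const_bound[where B=1]) (auto simp: indicator_def)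
    then show "integrable M (\<lambda>\<omega>. (of_bool (\<zeta> 0 = x) * of_bool (\<zeta> m = y)) * (indicator A \<omega> * (indicator (E \<zeta>) \<omega> * \<Gamma> \<zeta> \<omega>)))"
      by (rule integrable_mult_right)
  qed (auto simp: prod3 intro!: sum.cong)
  \<comment> \<open>Averaging out the service times leaves one weight per visited state, and the sum
    over paths becomes an expectation over the chain again.\<close>
  also have "\<dots> = prob A * (\<Sum>\<zeta>\<in>T. of_bool (\<zeta> 0 = x) * (\<Prod>i<m. \<phi> (\<zeta> (Suc i)) (\<tau> (Suc i))) * of_bool (\<zeta> m = y) * prob (E \<zeta>))"
    unfolding sum_distrib_left
  proof (intro sum.cong refl)
    fix \<zeta> assume "\<zeta> \<in> T"
    then have "expectation (\<Gamma> \<zeta>) = (\<Prod>i=1..m. \<phi> (\<zeta> i) (\<tau> i))"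
      unfolding \<Gamma>_def by (intro expectation_service) (auto simp: T_def PiE_iff)
    also have "\<dots> = (\<Prod>i<m. \<phi> (\<zeta> (Suc i)) (\<tau> (Suc i)))" by (simp add: prod.atLeast1_atMost_eq)
    finally show "of_bool (\<zeta> 0 = x) * of_bool (\<zeta> m = y) * (prob A * (prob (E \<zeta>) * expectation (\<Gamma> \<zeta>)))
      = prob A * (of_bool (\<zeta> 0 = x) * (\<Prod>i<m. \<phi> (\<zeta> (Suc i)) (\<tau> (Suc i))) * of_bool (\<zeta> m = y) * prob (E \<zeta>))" by simp
  qed
  also have "(\<Sum>\<zeta>\<in>T. of_bool (\<zeta> 0 = x) * (\<Prod>i<m. \<phi> (\<zeta> (Suc i)) (\<tau> (Suc i))) * of_bool (\<zeta> m = y) * prob (E \<zeta>))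
    = expectation (\<lambda>\<omega>. \<Sum>\<zeta>\<in>T. of_bool (\<zeta> 0 = x) * (\<Prod>i<m. \<phi> (\<zeta> (Suc i)) (\<tau> (Suc i))) * of_bool (\<zeta> m = y) * indicator (E \<zeta>) \<omega>)"
    using Ev by (subst Bochner_Integration.integral_sum) (auto intro!: integrable_real_indicator simp: less_top[symmetric] Int_absorb1 sets.sets_into_space)
  also have "\<dots> = expectation (\<lambda>\<omega>. of_bool (X 0 \<omega> = x) * (\<Prod>i<m. \<phi> (X (Suc i) \<omega>) (\<tau> (Suc i))) * of_bool (X m \<omega> = y))"
  proof (rule Bochner_Integration.integral_cong[OF refl])
    fix \<omega> assume w: "\<omega> \<in> space M"
    have "(\<Sum>\<zeta>\<in>T. of_bool (\<zeta> 0 = x) * (\<Prod>i<m. \<phi> (\<zeta> (Suc i)) (\<tau> (Suc i))) * of_bool (\<zeta> m = y) * indicator (E \<zeta>) \<omega>)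
      = (\<Sum>\<zeta>\<in>T. of_bool (\<zeta> 0 = x) * (\<Prod>i<m. \<phi> (\<zeta> (Suc i)) (\<tau> (Suc i))) * of_bool (\<zeta> m = y) * of_bool (\<forall>i\<le>m. X i \<omega> = \<zeta> i))"
      using w by (intro sum.cong) (auto simp: E_def indicator_def)
    also have "\<dots> = of_bool (X 0 \<omega> = x) * (\<Prod>i<m. \<phi> (X (Suc i) \<omega>) (\<tau> (Suc i))) * of_bool (X m \<omega> = y)"
      unfolding T_def using X_in[OF w] S(1) by (subst path_indicator_sum) auto
    finally show "(\<Sum>\<zeta>\<in>T. of_bool (\<zeta> 0 = x) * (\<Prod>i<m. \<phi> (\<zeta> (Suc i)) (\<tau> (Suc i))) * of_bool (\<zeta> m = y) * indicator (E \<zeta>) \<omega>)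
      = of_bool (X 0 \<omega> = x) * (\<Prod>i<m. \<phi> (X (Suc i) \<omega>) (\<tau> (Suc i))) * of_bool (X m \<omega> = y)" .
  qed
  also have "\<dots> = prob {\<omega> \<in> space M. X 0 \<omega> = x} * path_weight S (\<lambda>i z y. p z y * \<phi> y (\<tau> (Suc i))) x m y"
    by (rule chain_expectation[where p="\<lambda>_. p" and w="\<lambda>i y. \<phi> y (\<tau> (Suc i))"])
      (use X_law X_in S assms in auto)
  finally show ?thesis .
qed

section \<open>Discretization of the arrivals on a time grid\<close>

definition grid_time :: "nat \<Rightarrow> nat \<Rightarrow> real" where
  "grid_time q l = t * real l / real q"

text \<open>Constant beyond \<open>q\<close>, so that the sequence is monotone on all natural
  numbers, as the regrouping by \<open>cell\<close> requires.\<close>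

definition grid_count :: "nat \<Rightarrow> 'a \<Rightarrow> nat \<Rightarrow> nat" where
  "grid_count q \<omega> l = N (grid_time q (min l q)) \<omega>"

text \<open>Each arrival is moved back to the start of its cell. The presence of a customer then
  depends on the arrivals only through finitely many counts.\<close>

definition discretized :: "nat \<Rightarrow> 'a \<Rightarrow> 'k \<Rightarrow> real" where
  "discretized q \<omega> j = (\<Sum>i=1..N t \<omega>. X i \<omega> $ j *
     of_bool (t - grid_time q (cell (grid_count q \<omega>) i) < L i j \<omega> / c))"

lemma grid_time_nonneg: "0 \<le> grid_time q l"
  using pos by (simp add: grid_time_def)

lemma grid_time_mono: "l \<le> l' \<Longrightarrow> grid_time q l \<le> grid_time q l'"
  using pos by (auto simp: grid_time_def intro!: divide_right_mono mult_left_mono)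

lemma grid_time_end: "0 < q \<Longrightarrow> grid_time q q = t"
  by (simp add: grid_time_def)

lemma N_mono: "\<omega> \<in> space M \<Longrightarrow> mono_on {0..} (\<lambda>v. N v \<omega>)"
  using N by (simp add: poisson_process_def)

lemma N_0: "\<omega> \<in> space M \<Longrightarrow> N 0 \<omega> = 0"
  using N by (simp add: poisson_process_def)

lemma grid_count_mono: "\<omega> \<in> space M \<Longrightarrow> mono (grid_count q \<omega>)"
  unfolding grid_count_def
  by (intro monoI monotone_onD[OF N_mono]) (auto intro!: grid_time_nonneg grid_time_mono)

lemma grid_count_0: "\<omega> \<in> space M \<Longrightarrow> grid_count q \<omega> 0 = 0"
  by (simp add: grid_count_def grid_time_def N_0)

lemma grid_count_end: "0 < q \<Longrightarrow> grid_count q \<omega> q = N t \<omega>"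
  by (simp add: grid_count_def grid_time_end)

text \<open>The start \<open>u\<close> of the cell lies strictly before the jump time and tends to
  it. Strictness settles the boundary case: a customer who has left by \<open>t\<close>, even
  exactly at \<open>t\<close>, is absent on every grid, while one still present is present on all
  fine grids.\<close>

lemma discretized_tendsto:
  assumes w: "\<omega> \<in> space M"
  shows "(\<lambda>q. discretized (Suc q) \<omega> j) \<longlonglongrightarrow> queue_process N X (\<lambda>i j \<omega>. L i j \<omega> / c) t \<omega> $ j"
  unfolding discretized_def queue_process_def vec_lambda_beta
proof (intro tendsto_sum tendsto_mult tendsto_const)
  fix i assume i: "i \<in> {1..N t \<omega>}"
  define T where "T = jump_time N i \<omega>"
  define u where "u q = grid_time (Suc q) (cell (grid_count (Suc q) \<omega>) i)" for q
  have u: "u q < T" "T \<le> u q + t / Suc q" for q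
  proof -
    have "grid_count (Suc q) \<omega> 0 < i" "i \<le> grid_count (Suc q) \<omega> (Suc q)"
      using i by (simp_all add: grid_count_0[OF w] grid_count_end)
    note c' = cell_bounds[OF this]
    have c: "N (u q) \<omega> < i" "i \<le> N (grid_time (Suc q) (Suc (cell (grid_count (Suc q) \<omega>) i))) \<omega>"
      using c' by (simp_all add: u_def grid_count_def[of _ _ "cell _ _"] grid_count_def[of _ _ "Suc _"])
    show "u q < T"
      unfolding T_def
    proof (rule jump_time_gt)
      show "continuous (at (u q) within {0..} \<inter> {u q..}) (\<lambda>t. N t \<omega>)"
        using N w grid_time_nonneg unfolding poisson_process_def u_def by auto
    qed (use c i pos w N_mono in \<open>auto simp: u_def grid_time_nonneg\<close>)
    have "T \<le> grid_time (Suc q) (Suc (cell (grid_count (Suc q) \<omega>) i))"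
      unfolding T_def by (rule jump_time_le) (use c in \<open>auto simp: grid_time_nonneg\<close>)
    also have "\<dots> = u q + t / Suc q"
      unfolding u_def grid_time_def add_divide_distrib[symmetric] by (simp add: distrib_left)
    finally show "T \<le> u q + t / Suc q" .
  qed
  show "(\<lambda>q. of_bool (t - grid_time (Suc q) (cell (grid_count (Suc q) \<omega>) i) < L i j \<omega> / c))
    \<longlonglongrightarrow> (of_bool (t < L i j \<omega> / c + jump_time N i \<omega>) :: real)"
  proof (cases "t < L i j \<omega> / c + T")
    case True
    have "(\<lambda>q. t / real (Suc q)) \<longlonglongrightarrow> 0" by (rule LIMSEQ_Suc[OF lim_const_over_n])
    then have "eventually (\<lambda>q. t / real (Suc q) < L i j \<omega> / c + T - t) sequentially"
      using True by (intro order_tendstoD) auto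
    then have "eventually (\<lambda>q. t - u q < L i j \<omega> / c) sequentially"
    proof eventually_elim
      case (elim q)
      then show ?case using u[of q] by linarith
    qed
    then show ?thesis using True
      by (intro tendsto_eventually) (auto elim!: eventually_mono simp: u_def T_def)
  next
    case False
    have "\<not> t - u q < L i j \<omega> / c" for q using False u(1)[of q] by linarith
    then show ?thesis using False by (simp add: u_def T_def)
  qed
qed

lemma meas_compose_N:
  assumes "\<And>m. f m \<in> borel_measurable M" "0 \<le> v"
  shows "(\<lambda>\<omega>. f (N v \<omega>) \<omega>) \<in> measurable M (borel :: 'b::topological_space measure)"
  by (rule measurable_compose_countable[where f=f and g="N v"]) (use assms meas_N in auto)

text \<open>The grid counts as one variable with countably many values, the form in which
  conditioning on them is possible.\<close>

definition grid_list :: "nat \<Rightarrow> 'a \<Rightarrow> nat list" where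
  "grid_list q \<omega> = map (\<lambda>l. N (grid_time q l) \<omega>) [0..<Suc q]"

lemma grid_list_event: "{\<omega> \<in> space M. grid_list q \<omega> = v} \<in> generated_events M (count_space UNIV) N {0..}"
proof (cases "length v = Suc q")
  case True
  let ?G = "sigma (space M) (generated_events M (count_space UNIV) N {0..})"
  have [measurable]: "N (grid_time q l) \<in> measurable ?G (count_space UNIV)" for l
    by (rule measurable_generated_events) (auto simp: grid_time_nonneg)
  have "{\<omega> \<in> space ?G. \<forall>l\<le>q. N (grid_time q l) \<omega> = v ! l} \<in> sets ?G" by measurable
  moreover have "grid_list q \<omega> = v \<longleftrightarrow> (\<forall>l\<le>q. N (grid_time q l) \<omega> = v ! l)" for \<omega>
    unfolding grid_list_def list_eq_iff_nth_eq using True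
    by (auto simp del: upt_Suc simp: less_Suc_eq_le)
  ultimately show ?thesis unfolding sets_generated_events by (simp add: space_measure_of_conv)
next
  case False
  then have "{\<omega> \<in> space M. grid_list q \<omega> = v} = {}" by (auto simp: grid_list_def)
  then show ?thesis unfolding generated_events_def by (simp only: sigma_sets.Empty)
qed

lemma meas_grid_list [measurable]: "grid_list q \<in> measurable M (count_space UNIV)"
proof (subst measurable_count_space_eq_countable, simp, intro conjI ballI)
  fix v :: "nat list"
  have sub: "generated_events M (count_space UNIV) N {0..} \<subseteq> events"
    using indep unfolding indep_sets_def by (metis (no_types, lifting) lessThan_iff nth_Cons_0 zero_less_numeral)
  have "grid_list q -` {v} \<inter> space M = {\<omega> \<in> space M. grid_list q \<omega> = v}" by auto
  then show "grid_list q -` {v} \<inter> space M \<in> events" using grid_list_event sub by auto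
qed simp

text \<open>The integrand of the discretized transform with the random grid counts replaced by a
  fixed list \<open>v\<close>.\<close>

definition frozen :: "real ^ 'k \<Rightarrow> real ^ 'k \<Rightarrow> nat \<Rightarrow> nat list \<Rightarrow> 'a \<Rightarrow> real" where
  "frozen x y q v \<omega> = of_bool (X 0 \<omega> = x) *
      exp (- (\<Sum>j\<in>UNIV. s j * (\<Sum>i=1..v ! q. X i \<omega> $ j *
        of_bool (t - grid_time q (cell (\<lambda>l. v ! min l q) i) < L i j \<omega> / c)))) * of_bool (X (v ! q) \<omega> = y)"

lemma frozen_measurable [measurable]: "frozen x y q v \<in> borel_measurable M"
  unfolding frozen_def by measurable

lemma frozen_bound: "\<omega> \<in> space M \<Longrightarrow> \<bar>frozen x y q v \<omega>\<bar> \<le> 1"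
  using X_in[of \<omega>] S(2) s by (auto simp: frozen_def of_bool_def intro!: sum_nonneg mult_nonneg_nonneg)

lemma grid_list_nth: "l \<le> q \<Longrightarrow> grid_list q \<omega> ! l = N (grid_time q l) \<omega>"
  unfolding grid_list_def by (subst nth_map) (auto simp del: upt_Suc)

lemma grid_list_count: "(\<lambda>l. grid_list q \<omega> ! min l q) = grid_count q \<omega>"
  by (simp add: fun_eq_iff grid_count_def grid_list_nth)

lemma frozen_grid_list:
  assumes "0 < q"
  shows "frozen x y q (grid_list q \<omega>) \<omega> = of_bool (X 0 \<omega> = x) *
      exp (- (\<Sum>j\<in>UNIV. s j * discretized q \<omega> j)) * of_bool (X (N t \<omega>) \<omega> = y)"
  unfolding frozen_def discretized_def
  by (simp only: grid_list_count grid_list_nth[OF order_refl] grid_time_end[OF assms])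

text \<open>The expected matrix of a cell: the thinned one-step matrix raised to the Poisson number
  of its arrivals.\<close>

definition step_matrix :: "nat \<Rightarrow> nat \<Rightarrow> real ^ 'k \<Rightarrow> real ^ 'k \<Rightarrow> real" where
  "step_matrix q l z y = measure_pmf.expectation (poisson_pmf (r * (t / real q)))
     (\<lambda>d. path_weight S (\<lambda>_ z y. p z y * \<phi> y (t - grid_time q l)) z d y)"

lemma X0: "x \<in> S \<Longrightarrow> prob {\<omega> \<in> space M. X 0 \<omega> = x} = \<pi> x"
  using X by (simp add: markov_chain_def)

lemma expectation_discretized:
  assumes q: "0 < q" and xy: "x \<in> S" "y \<in> S"
  shows "expectation (\<lambda>\<omega>. of_bool (X 0 \<omega> = x) *
      exp (- (\<Sum>j\<in>UNIV. s j * discretized q \<omega> j)) * of_bool (X (N t \<omega>) \<omega> = y))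
    = \<pi> x * path_weight S (step_matrix q) x q y"
proof -
  let ?W = "\<lambda>l z y. p z y * \<phi> y (t - grid_time q l)"
  let ?A = "\<lambda>l d z y. path_weight S (\<lambda>_. ?W l) z d y"
  let ?D = "\<lambda>l \<omega>. N (grid_time q (Suc l)) \<omega> - N (grid_time q l) \<omega>"
  \<comment> \<open>The sure event in the role of \<open>A\<close> gives the expectation for fixed
    counts.\<close>
  have E1: "expectation (frozen x y q v) = \<pi> x * path_weight S (\<lambda>i. ?W (cell (\<lambda>l. v ! min l q) (Suc i))) x (v ! q) y" for v
  proof -
    have "space M \<in> generated_events M (count_space UNIV) N {0..}"
      unfolding generated_events_def by (rule sigma_sets_top)
    from expectation_frozen[OF this xy, where m="v ! q" and \<tau>="\<lambda>i. t - grid_time q (cell (\<lambda>l. v ! min l q) i)"]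
    have "expectation (\<lambda>\<omega>. indicator (space M) \<omega> * frozen x y q v \<omega>)
      = \<pi> x * path_weight S (\<lambda>i. ?W (cell (\<lambda>l. v ! min l q) (Suc i))) x (v ! q) y"
      by (simp add: frozen_def prob_space X0 xy)
    also have "expectation (\<lambda>\<omega>. indicator (space M) \<omega> * frozen x y q v \<omega>) = expectation (frozen x y q v)"
      by (intro Bochner_Integration.integral_cong) auto
    finally show ?thesis .
  qed
  have "expectation (\<lambda>\<omega>. frozen x y q (grid_list q \<omega>) \<omega>)
    = expectation (\<lambda>\<omega>. expectation (frozen x y q (grid_list q \<omega>)))"
  proof (rule expectation_freeze)
    fix v
    have "expectation (\<lambda>\<omega>. of_bool (grid_list q \<omega> = v) * frozen x y q v \<omega>)
      = expectation (\<lambda>\<omega>. indicator {\<omega> \<in> space M. grid_list q \<omega> = v} \<omega> * frozen x y q v \<omega>)"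
      by (intro Bochner_Integration.integral_cong) (auto simp: indicator_def)
    also have "\<dots> = prob {\<omega> \<in> space M. grid_list q \<omega> = v} * expectation (frozen x y q v)"
      unfolding E1 unfolding frozen_def
      using expectation_frozen[OF grid_list_event xy, where m="v ! q" and \<tau>="\<lambda>i. t - grid_time q (cell (\<lambda>l. v ! min l q) i)"]
      by (simp add: X0 xy)
    finally show "expectation (\<lambda>\<omega>. of_bool (grid_list q \<omega> = v) * frozen x y q v \<omega>)
      = prob {\<omega> \<in> space M. grid_list q \<omega> = v} * expectation (frozen x y q v)" .
  qed (use frozen_bound in auto)
  also have "\<dots> = expectation (\<lambda>\<omega>. \<pi> x * path_weight S (\<lambda>l. ?A l (?D l \<omega>)) x q y)"
  proof (rule Bochner_Integration.integral_cong[OF refl])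
    fix \<omega> assume w: "\<omega> \<in> space M"
    have eq: "(\<lambda>l. grid_list q \<omega> ! min l q) = grid_count q \<omega>" "grid_list q \<omega> ! q = grid_count q \<omega> q"
      by (rule grid_list_count) (simp add: grid_count_def grid_list_nth)
    \<comment> \<open>Regrouping by cells leaves only the increments of the counting process, which
      are independent.\<close>
    have "path_weight S (\<lambda>i. ?W (cell (grid_count q \<omega>) (Suc i))) x (grid_count q \<omega> q) y
      = path_weight S (\<lambda>l. ?A l (grid_count q \<omega> (Suc l) - grid_count q \<omega> l)) x q y"
      by (rule path_weight_blocks) (use S w xy in \<open>auto simp: grid_count_mono grid_count_0\<close>)
    also have "\<dots> = path_weight S (\<lambda>l. ?A l (?D l \<omega>)) x q y"
      by (rule path_weight_cong) (auto simp: grid_count_def xy min_def)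
    finally show "expectation (frozen x y q (grid_list q \<omega>)) = \<pi> x * path_weight S (\<lambda>l. ?A l (?D l \<omega>)) x q y"
      unfolding E1 eq by simp
  qed
  also have "\<dots> = \<pi> x * path_weight S (\<lambda>l z y. expectation (\<lambda>\<omega>. ?A l (?D l \<omega>) z y)) x q y"
  proof -
    have "indep_vars (\<lambda>_. count_space UNIV) ?D {..<q}"
      using N unfolding poisson_process_def
      by (elim conjE) (drule spec[of _ q], drule spec[of _ "grid_time q"], auto simp: grid_time_nonneg grid_time_mono)
    then have "expectation (\<lambda>\<omega>. path_weight S (\<lambda>l. ?A l (?D l \<omega>)) x q y)
      = path_weight S (\<lambda>l z y. expectation (\<lambda>\<omega>. ?A l (?D l \<omega>) z y)) x q y"
      by (intro expectation_path_weight substochastic_path_weight substochastic S xy)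
    then show ?thesis by simp
  qed
  also have "path_weight S (\<lambda>l z y. expectation (\<lambda>\<omega>. ?A l (?D l \<omega>) z y)) x q y = path_weight S (step_matrix q) x q y"
  proof (rule path_weight_cong)
    fix l z y assume "l < q"
    have lt: "grid_time q l < grid_time q (Suc l)" using pos q by (auto simp: grid_time_def divide_strict_right_mono)
    have diff: "grid_time q (Suc l) - grid_time q l = t / real q" using q by (simp add: grid_time_def field_simps)
    have "distr M (count_space UNIV) (?D l) = measure_pmf (poisson_pmf (r * (grid_time q (Suc l) - grid_time q l)))"
      using N lt grid_time_nonneg[of q] unfolding poisson_process_def by auto
    then have "step_matrix q l z y = integral\<^sup>L (distr M (count_space UNIV) (?D l)) (\<lambda>d. ?A l d z y)"
      by (simp add: step_matrix_def diff)
    also have "\<dots> = expectation (\<lambda>\<omega>. ?A l (?D l \<omega>) z y)"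
    proof (rule integral_distr)
      have [measurable]: "N (grid_time q l) \<in> measurable M (count_space UNIV)" for l
        by (rule meas_N[OF grid_time_nonneg])
      show "?D l \<in> measurable M (count_space UNIV)" by measurable
    qed simp
    finally show "expectation (\<lambda>\<omega>. ?A l (?D l \<omega>) z y) = step_matrix q l z y" by simp
  qed fact
  finally show ?thesis by (simp add: frozen_grid_list q)
qed

lemma queue_measurable: "queue_process N X (\<lambda>i j \<omega>. L i j \<omega> / c) t \<in> borel_measurable M"
proof (rule borel_measurable_vecI)
  fix j
  have "(\<lambda>\<omega>. discretized (Suc q) \<omega> j) \<in> borel_measurable M" for q
  proof -
    have "(\<lambda>\<omega>. (\<lambda>v \<omega>. \<Sum>i=1..v ! Suc q. X i \<omega> $ j *
      of_bool (t - grid_time (Suc q) (cell (\<lambda>l. v ! min l (Suc q)) i) < L i j \<omega> / c)) (grid_list (Suc q) \<omega>) \<omega>) \<in> borel_measurable M"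
      by (rule measurable_compose_countable[where g="grid_list (Suc q)"]) measurable
    also have "(\<lambda>\<omega>. (\<lambda>v \<omega>. \<Sum>i=1..v ! Suc q. X i \<omega> $ j *
      of_bool (t - grid_time (Suc q) (cell (\<lambda>l. v ! min l (Suc q)) i) < L i j \<omega> / c)) (grid_list (Suc q) \<omega>) \<omega>)
      = (\<lambda>\<omega>. discretized (Suc q) \<omega> j)"
      by (simp only: discretized_def grid_list_count grid_list_nth[OF order_refl] grid_time_end[OF zero_less_Suc])
    finally show ?thesis .
  qed
  then show "(\<lambda>\<omega>. queue_process N X (\<lambda>i j \<omega>. L i j \<omega> / c) t \<omega> $ j) \<in> borel_measurable M"
    by (rule borel_measurable_LIMSEQ_metric) (rule discretized_tendsto)
qed

lemma terminal_measurable: "(\<lambda>\<omega>. X (N t \<omega>) \<omega>) \<in> borel_measurable M"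
  by (rule meas_compose_N[where f=X]) (use pos in auto)

text \<open>The arrival rate and the scaling stay fixed while the grid is refined; the integrands
  lie in the unit interval, so their pointwise limit passes through the expectation.\<close>

lemma queue_transform:
  assumes xy: "x \<in> S" "y \<in> S"
  shows "(\<lambda>q. \<pi> x * path_weight S (step_matrix (Suc q)) x (Suc q) y) \<longlonglongrightarrow>
    expectation (\<lambda>\<omega>. of_bool (X 0 \<omega> = x) *
      exp (- (\<Sum>j\<in>UNIV. s j * queue_process N X (\<lambda>i j \<omega>. L i j \<omega> / c) t \<omega> $ j)) * of_bool (X (N t \<omega>) \<omega> = y))"
proof -
  note [measurable] = queue_measurable terminal_measurable
  have m: "(\<lambda>\<omega>. frozen x y (Suc q) (grid_list (Suc q) \<omega>) \<omega>) \<in> borel_measurable M" for q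
    by (rule measurable_compose_countable[where g="grid_list (Suc q)"]) measurable
  have "(\<lambda>q. expectation (\<lambda>\<omega>. frozen x y (Suc q) (grid_list (Suc q) \<omega>) \<omega>)) \<longlonglongrightarrow>
    expectation (\<lambda>\<omega>. of_bool (X 0 \<omega> = x) *
      exp (- (\<Sum>j\<in>UNIV. s j * queue_process N X (\<lambda>i j \<omega>. L i j \<omega> / c) t \<omega> $ j)) * of_bool (X (N t \<omega>) \<omega> = y))"
  proof (rule integral_dominated_convergence[where w="\<lambda>_. 1"])
    show "AE \<omega> in M. (\<lambda>q. frozen x y (Suc q) (grid_list (Suc q) \<omega>) \<omega>) \<longlonglongrightarrow> of_bool (X 0 \<omega> = x) *
      exp (- (\<Sum>j\<in>UNIV. s j * queue_process N X (\<lambda>i j \<omega>. L i j \<omega> / c) t \<omega> $ j)) * of_bool (X (N t \<omega>) \<omega> = y)"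
      by (intro AE_I2, subst frozen_grid_list, simp, intro tendsto_intros discretized_tendsto)
    show "AE \<omega> in M. norm (frozen x y (Suc q) (grid_list (Suc q) \<omega>) \<omega>) \<le> 1" for q
      using frozen_bound by (intro AE_I2) simp
    show "(\<lambda>\<omega>. of_bool (X 0 \<omega> = x) *
      exp (- (\<Sum>j\<in>UNIV. s j * queue_process N X (\<lambda>i j \<omega>. L i j \<omega> / c) t \<omega> $ j)) * of_bool (X (N t \<omega>) \<omega> = y)) \<in> borel_measurable M"
      by measurable
  qed (use m in auto)
  then show ?thesis by (simp add: frozen_grid_list expectation_discretized xy)
qed

end

section \<open>Partitions and sample paths\<close>

text \<open>Partitions of \<open>[a, 1]\<close> into \<open>q\<close> cells. They need not be
  nested: only the mesh has to vanish.\<close>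

locale refining_partitions =
  fixes V :: "nat \<Rightarrow> nat \<Rightarrow> real" and a :: real and mesh :: "nat \<Rightarrow> real"
  assumes start: "V q 0 = a" and finish: "0 < q \<Longrightarrow> V q q = 1"
    and strict: "l < q \<Longrightarrow> V q l < V q (Suc l)"
    and mesh: "l < q \<Longrightarrow> V q (Suc l) - V q l \<le> mesh q" and mesh_lim: "mesh \<longlonglongrightarrow> 0"
begin

text \<open>Cells are open on the left and closed on the right, in accordance with jumps counted in
  (a, b].\<close>

definition idx :: "nat \<Rightarrow> real \<Rightarrow> nat" where
  "idx q v = (LEAST l. v \<le> V q (Suc l))"

lemma V_mono:
  assumes "l \<le> l'" "l' \<le> q"
  shows "V q l \<le> V q l'"
  using assms
proof (induction l' rule: dec_induct)
  case (step n)
  then show ?case using strict[of n q] by simp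
qed simp

lemma V_bounds: "0 < q \<Longrightarrow> l \<le> q \<Longrightarrow> a \<le> V q l \<and> V q l \<le> 1"
  using V_mono[of 0 l q] V_mono[of l q q] by (simp add: start finish)

lemma a_le_1: "a \<le> 1"
  using V_bounds[of 1 0] by (simp add: start)

lemma idx_bounds:
  assumes "0 < q" "a < v" "v \<le> 1"
  shows "idx q v < q" "V q (idx q v) < v" "v \<le> V q (Suc (idx q v))"
proof -
  obtain q' where q': "q = Suc q'" using assms by (cases q) auto
  have ex: "v \<le> V q (Suc q')" using assms finish[of q] by (simp add: q')
  show "v \<le> V q (Suc (idx q v))" unfolding idx_def by (rule LeastI) (rule ex)
  have "idx q v \<le> q'" unfolding idx_def by (rule Least_le) (rule ex)
  then show "idx q v < q" using q' by simp
  show "V q (idx q v) < v"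
  proof (cases "idx q v")
    case (Suc l)
    then have "\<not> v \<le> V q (Suc l)" using not_less_Least[of l "\<lambda>l. v \<le> V q (Suc l)"] by (simp add: idx_def)
    then show ?thesis using Suc by simp
  qed (use assms start in simp)
qed

lemma idx_eq:
  assumes "l < q" "V q l < v" "v \<le> V q (Suc l)"
  shows "idx q v = l"
  unfolding idx_def
proof (rule Least_equality)
  fix l' assume "v \<le> V q (Suc l')"
  then show "l \<le> l'" using assms V_mono[of "Suc l'" l q] by (cases "Suc l' \<le> l") auto
qed fact

lemma mesh_Suc_lim: "(\<lambda>q. mesh (Suc q)) \<longlonglongrightarrow> 0"
  using mesh_lim by (rule LIMSEQ_Suc)

text \<open>The upper end of the cell of \<open>v\<close> never lies below \<open>v\<close>, so
  right-continuity controls the values there; at \<open>v = 1\<close> the upper end is 1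
  itself.\<close>

lemma tendsto_upper_endpoint:
  fixes f :: "real \<Rightarrow> 'c::topological_space"
  assumes "a < v" "v \<le> 1" and f: "v < 1 \<Longrightarrow> (f \<longlongrightarrow> f v) (at_right v)"
  shows "(\<lambda>q. f (V (Suc q) (Suc (idx (Suc q) v)))) \<longlonglongrightarrow> f v"
proof (cases "v < 1")
  case True
  show ?thesis
  proof (rule topological_tendstoI)
    fix U assume U: "open U" "f v \<in> U"
    then have "eventually (\<lambda>w. f w \<in> U) (at_right v)" using f[OF True] by (simp add: tendsto_def)
    then obtain b where b: "b > v" "\<And>w. v < w \<Longrightarrow> w < b \<Longrightarrow> f w \<in> U"
      unfolding eventually_at_right_field by blast
    have "eventually (\<lambda>q. mesh (Suc q) < b - v) sequentially"
      using b(1) by (intro order_tendstoD(2)[OF mesh_Suc_lim]) simp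
    then show "eventually (\<lambda>q. f (V (Suc q) (Suc (idx (Suc q) v))) \<in> U) sequentially"
    proof eventually_elim
      case (elim q)
      define w where "w = V (Suc q) (Suc (idx (Suc q) v))"
      have "v \<le> w" "w < b"
        using idx_bounds[of "Suc q" v] mesh[of "idx (Suc q) v" "Suc q"] assms elim by (auto simp: w_def)
      then have "f w \<in> U" using b U by (cases "v = w") auto
      then show ?case by (simp add: w_def)
    qed
  qed
next
  case False
  then have v: "v = 1" using assms by simp
  have "V (Suc q) (Suc (idx (Suc q) v)) = 1" for q
    using idx_bounds[of "Suc q" v] V_bounds[of "Suc q" "Suc (idx (Suc q) v)"] assms v by simp
  then show ?thesis using v by simp
qed

lemma sum_idx:
  fixes g :: "nat \<Rightarrow> 'c::real_vector"
  assumes "0 < q"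
  shows "(\<Sum>l<q. indicator {V q l<..V q (Suc l)} v *\<^sub>R g l) = (if a < v \<and> v \<le> 1 then g (idx q v) else 0)"
proof (cases "a < v \<and> v \<le> 1")
  case True
  have "(\<Sum>l<q. indicator {V q l<..V q (Suc l)} v *\<^sub>R g l) = (\<Sum>l<q. if l = idx q v then g l else 0)"
  proof (rule sum.cong[OF refl])
    fix l assume "l \<in> {..<q}"
    then have "v \<in> {V q l<..V q (Suc l)} \<longleftrightarrow> l = idx q v"
      using idx_eq[of l q v] idx_bounds(2,3)[OF assms, of v] True by auto
    then show "indicator {V q l<..V q (Suc l)} v *\<^sub>R g l = (if l = idx q v then g l else 0)"
      by (simp add: indicator_def)
  qed
  then show ?thesis using True idx_bounds(1)[OF assms] by simp
next
  case False
  then have "indicator {V q l<..V q (Suc l)} v = (0::real)" if "l < q" for l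
    using V_bounds[of q l] V_bounds[of q "Suc l"] that by (auto simp: indicator_def)
  then show ?thesis using False by auto
qed

text \<open>The sum is the integral of a step function sampling \<open>f\<close> at upper end
  points, and these step functions converge at every point of (a, 1]. Measurability of
  \<open>f\<close> there is inherited from them.\<close>

lemma riemann_sum_tendsto:
  fixes f :: "real \<Rightarrow> 'c::{banach, second_countable_topology}"
  assumes f: "\<And>v. a \<le> v \<Longrightarrow> v < 1 \<Longrightarrow> (f \<longlongrightarrow> f v) (at_right v)"
    and B: "\<And>v. a \<le> v \<Longrightarrow> v \<le> 1 \<Longrightarrow> norm (f v) \<le> B"
  shows "(\<lambda>q. \<Sum>l<Suc q. (V (Suc q) (Suc l) - V (Suc q) l) *\<^sub>R f (V (Suc q) (Suc l)))
    \<longlonglongrightarrow> (LINT v:{a..1}|lborel. f v)"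
proof -
  let ?h = "\<lambda>q v. \<Sum>l<Suc q. indicator {V (Suc q) l<..V (Suc q) (Suc l)} v *\<^sub>R f (V (Suc q) (Suc l))"
  let ?f = "\<lambda>v. indicator {a<..1} v *\<^sub>R f v"
  have h: "?h q v = (if a < v \<and> v \<le> 1 then f (V (Suc q) (Suc (idx (Suc q) v))) else 0)" for q v
    by (rule sum_idx) simp
  have lim: "(\<lambda>q. ?h q v) \<longlonglongrightarrow> ?f v" for v
    unfolding h using tendsto_upper_endpoint[of v f] f[of v] by (auto simp: indicator_def)
  have hm: "?h q \<in> borel_measurable lborel" for q by measurable
  have fm: "?f \<in> borel_measurable lborel" by (rule borel_measurable_LIMSEQ_metric[OF hm lim])
  have "(\<lambda>q. integral\<^sup>L lborel (?h q)) \<longlonglongrightarrow> integral\<^sup>L lborel ?f"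
  proof (rule integral_dominated_convergence[where w="\<lambda>v. indicator {a..1} v * B"])
    show "integrable lborel (\<lambda>v. indicator {a..1} v * B)"
      by (intro integrable_mult_left integrable_real_indicator) (auto simp: emeasure_lborel_Icc_eq)
    have "norm (?h q v) \<le> indicator {a..1} v * B" for q v
    proof (cases "a < v \<and> v \<le> 1")
      case True
      then have "norm (f (V (Suc q) (Suc (idx (Suc q) v)))) \<le> B"
        using idx_bounds[of "Suc q" v] V_bounds[of "Suc q" "Suc (idx (Suc q) v)"] by (intro B) auto
      then show ?thesis unfolding h using True by simp
    next
      case False
      have "0 \<le> B" using B[of 1] a_le_1 norm_ge_zero order_trans by blast
      then show ?thesis unfolding h using False by (auto simp: indicator_def)
    qed
    then show "AE v in lborel. norm (?h q v) \<le> indicator {a..1} v * B" for q by auto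
  qed (use lim hm fm in auto)
  moreover have "integral\<^sup>L lborel (?h q) = (\<Sum>l<Suc q. (V (Suc q) (Suc l) - V (Suc q) l) *\<^sub>R f (V (Suc q) (Suc l)))" for q
  proof -
    have "integral\<^sup>L lborel (?h q) = (\<Sum>l<Suc q. integral\<^sup>L lborel (\<lambda>v. indicator {V (Suc q) l<..V (Suc q) (Suc l)} v *\<^sub>R f (V (Suc q) (Suc l))))"
      using strict[of _ "Suc q"]
      by (intro Bochner_Integration.integral_sum integrable_scaleR_left integrable_real_indicator)
        (auto simp: less_imp_le)
    also have "\<dots> = (\<Sum>l<Suc q. (V (Suc q) (Suc l) - V (Suc q) l) *\<^sub>R f (V (Suc q) (Suc l)))"
      using strict[of _ "Suc q"] by (intro sum.cong) (auto simp: less_imp_le)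
    finally show ?thesis .
  qed
  moreover have "integral\<^sup>L lborel ?f = (LINT v:{a..1}|lborel. f v)"
  proof -
    \<comment> \<open>The two intervals differ by the null set of the point \<open>a\<close>; adding
      the value at \<open>a\<close> transfers measurability.\<close>
    have ae: "AE v in lborel. ?f v = indicator {a..1} v *\<^sub>R f v"
      using AE_lborel_singleton[of a] by eventually_elim (auto simp: indicator_def)
    have "(\<lambda>v. ?f v + indicator {a} v *\<^sub>R f a) \<in> borel_measurable lborel"
      using fm by measurable
    also have "(\<lambda>v. ?f v + indicator {a} v *\<^sub>R f a) = (\<lambda>v. indicator {a..1} v *\<^sub>R f v)"
      using a_le_1 by (auto simp: fun_eq_iff indicator_def)
    finally show ?thesis
      unfolding set_lebesgue_integral_def using fm ae by (intro integral_cong_AE) auto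
  qed
  ultimately show ?thesis by simp
qed

text \<open>A path has finitely many jumps, since its values at them are distinct and bounded. On a
  fine partition each jump has a cell of its own, and the sum becomes one over jumps with
  \<open>f\<close> taken at the upper end. Both sides count a jump once, whatever its
  height.\<close>

lemma jump_sum_tendsto:
  fixes f :: "real \<Rightarrow> real" and n :: "real \<Rightarrow> nat"
  assumes a: "0 \<le> a"
    and f: "\<And>v. a \<le> v \<Longrightarrow> v < 1 \<Longrightarrow> (f \<longlongrightarrow> f v) (at_right v)"
    and n: "mono_on {0..1} n" "\<And>v. v \<in> {0..1} \<Longrightarrow> continuous (at v within ({0..1} \<inter> {v..})) n"
  shows "(\<lambda>q. \<Sum>l<Suc q. f (V (Suc q) (Suc l)) * of_bool (n (V (Suc q) l) < n (V (Suc q) (Suc l))))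
    \<longlonglongrightarrow> jump_integral a 1 f n"
proof -
  define J where "J = {v \<in> {a<..1}. \<forall>u\<in>{0..<v}. n u < n v}"
  have J: "a < v" "v \<le> 1" "\<And>u. 0 \<le> u \<Longrightarrow> u < v \<Longrightarrow> n u < n v" if "v \<in> J" for v
    using that by (auto simp: J_def)
  have "finite J"
  proof (rule finite_imageD)
    have "n v \<le> n 1" if "v \<in> J" for v using J[OF that] a by (intro monotone_onD[OF n(1)]) auto
    then show "finite (n ` J)" by (intro finite_subset[of "n ` J" "{..n 1}"]) auto
    have "n v < n w" if "v \<in> J" "w \<in> J" "v < w" for v w
      using J(3)[OF that(2), of v] J(1)[OF that(1)] a that(3) by simp
    then show "inj_on n J" by (intro linorder_inj_onI) (auto, metis less_irrefl)
  qed
  have img: "idx (Suc q) ` J = {l. l < Suc q \<and> n (V (Suc q) l) < n (V (Suc q) (Suc l))}" for q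
  proof (intro set_eqI iffI)
    fix l assume "l \<in> idx (Suc q) ` J"
    then obtain v where v: "v \<in> J" "l = idx (Suc q) v" by auto
    note b = idx_bounds[of "Suc q" v, OF _ J(1,2)[OF v(1)], folded v(2)]
    have bb: "0 \<le> V (Suc q) l" "V (Suc q) (Suc l) \<le> 1"
      using V_bounds[of "Suc q" l] V_bounds[of "Suc q" "Suc l"] b a by auto
    have "n (V (Suc q) l) < n v" using J(3)[OF v(1)] b bb by auto
    also have "\<dots> \<le> n (V (Suc q) (Suc l))" using b bb by (intro monotone_onD[OF n(1)]) auto
    finally show "l \<in> {l. l < Suc q \<and> n (V (Suc q) l) < n (V (Suc q) (Suc l))}" using b by auto
  next
    fix l assume "l \<in> {l. l < Suc q \<and> n (V (Suc q) l) < n (V (Suc q) (Suc l))}"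
    then have l: "l < Suc q" "n (V (Suc q) l) < n (V (Suc q) (Suc l))" by auto
    define b c where "b = V (Suc q) l" and "c = V (Suc q) (Suc l)"
    have bc: "a \<le> b" "b < c" "c \<le> 1" "n b < n c"
      using l V_bounds[of "Suc q" l] V_bounds[of "Suc q" "Suc l"] strict[of l "Suc q"] by (auto simp: b_def c_def)
    \<comment> \<open>A cell with a positive increment contains a jump: the first time at which the
      value at its left end is exceeded. Right-continuity shows that the infimum is
      attained.\<close>
    define W where "W = {u. b \<le> u \<and> u \<le> c \<and> n b < n u}"
    define w where "w = Inf W"
    have cW: "c \<in> W" using bc by (auto simp: W_def)
    have bdd: "bdd_below W" by (rule bdd_belowI[of _ b]) (auto simp: W_def)
    have wc: "w \<le> c" unfolding w_def by (rule cInf_lower[OF cW bdd])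
    have bw: "b \<le> w" unfolding w_def by (rule cInf_greatest) (use cW in \<open>auto simp: W_def\<close>)
    have below: "n u \<le> n b" if "0 \<le> u" "u < w" for u
    proof (cases "b \<le> u")
      case True
      have "u \<notin> W" using that cInf_lower[of u W] bdd unfolding w_def by force
      then show ?thesis using True that wc by (auto simp: W_def)
    next
      case False
      then show ?thesis using that bc by (intro monotone_onD[OF n(1)]) auto
    qed
    have nw: "n b < n w"
    proof (rule ccontr)
      assume neg: "\<not> n b < n w"
      have "n b \<le> n w" using bw bc a wc by (intro monotone_onD[OF n(1)]) auto
      then have eq: "n w = n b" using neg by simp
      have w01: "w \<in> {0..1}" using bw bc a wc by auto
      have "eventually (\<lambda>u. n u = n w) (at w within ({0..1} \<inter> {w..}))"
        using n(2)[OF w01] by (simp add: continuous_within tendsto_discrete)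
      then obtain d where d: "d > 0" "\<And>u. u \<in> {0..1} \<inter> {w..} \<Longrightarrow> u \<noteq> w \<Longrightarrow> dist u w < d \<Longrightarrow> n u = n w"
        unfolding eventually_at by auto
      have "w + d \<le> Inf W"
      proof (rule cInf_greatest)
        fix u assume u: "u \<in> W"
        then have "w \<le> u" unfolding w_def using bdd by (intro cInf_lower)
        moreover have "n u \<noteq> n w" using u eq by (auto simp: W_def)
        moreover have "n u = n w" if "u < w + d"
        proof (rule d(2))
          show "u \<in> {0..1} \<inter> {w..}" "u \<noteq> w" "dist u w < d"
            using u bc a that \<open>w \<le> u\<close> \<open>n u \<noteq> n w\<close> by (auto simp: W_def dist_real_def)
        qed
        ultimately show "w + d \<le> u" by linarith
      qed (use cW in auto)
      then show False using d(1) by (simp add: w_def[symmetric])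
    qed
    then have "b < w" using bw by (cases "b = w") auto
    then have "w \<in> J" using bc wc nw below by (fastforce simp: J_def)
    moreover have "idx (Suc q) w = l"
      using l \<open>b < w\<close> wc by (intro idx_eq) (auto simp: b_def c_def)
    ultimately show "l \<in> idx (Suc q) ` J" by blast
  qed
  have inj: "eventually (\<lambda>q. inj_on (idx (Suc q)) J) sequentially"
  proof -
    \<comment> \<open>Once the mesh is below all gaps between jumps, no cell holds two of
      them.\<close>
    have "eventually (\<lambda>q. \<forall>v\<in>J. \<forall>w\<in>J. v < w \<longrightarrow> mesh (Suc q) < w - v) sequentially"
    proof (intro eventually_ball_finite \<open>finite J\<close> ballI)
      fix v w show "eventually (\<lambda>q. v < w \<longrightarrow> mesh (Suc q) < w - v) sequentially"
        using order_tendstoD(2)[OF mesh_Suc_lim, of "w - v"] by (cases "v < w") auto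
    qed
    then show ?thesis
    proof eventually_elim
      case (elim q)
      have "idx (Suc q) v \<noteq> idx (Suc q) w" if "v \<in> J" "w \<in> J" "v < w" for v w
      proof
        assume eq: "idx (Suc q) v = idx (Suc q) w"
        have "w - v \<le> V (Suc q) (Suc (idx (Suc q) w)) - V (Suc q) (idx (Suc q) v)"
          using idx_bounds[of "Suc q" v] idx_bounds[of "Suc q" w] J(1,2) that by force
        also have "\<dots> \<le> mesh (Suc q)" unfolding eq using idx_bounds(1)[of "Suc q" w] J(1,2) that by (intro mesh) auto
        finally show False using elim that by force
      qed
      then show ?case by (intro linorder_inj_onI) auto
    qed
  qed
  have "(\<lambda>q. \<Sum>v\<in>J. f (V (Suc q) (Suc (idx (Suc q) v)))) \<longlonglongrightarrow> (\<Sum>v\<in>J. f v)"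
    using J by (intro tendsto_sum tendsto_upper_endpoint f) (auto intro: less_imp_le)
  moreover have "eventually (\<lambda>q. (\<Sum>v\<in>J. f (V (Suc q) (Suc (idx (Suc q) v))))
      = (\<Sum>l<Suc q. f (V (Suc q) (Suc l)) * of_bool (n (V (Suc q) l) < n (V (Suc q) (Suc l))))) sequentially"
    using inj
  proof eventually_elim
    case (elim q)
    have "(\<Sum>v\<in>J. f (V (Suc q) (Suc (idx (Suc q) v)))) = (\<Sum>l\<in>idx (Suc q) ` J. f (V (Suc q) (Suc l)))"
      using elim by (simp add: sum.reindex)
    also have "\<dots> = (\<Sum>l\<in>{l \<in> {..<Suc q}. n (V (Suc q) l) < n (V (Suc q) (Suc l))}. f (V (Suc q) (Suc l)))"
      unfolding img by (intro sum.cong) auto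
    also have "\<dots> = (\<Sum>l<Suc q. if n (V (Suc q) l) < n (V (Suc q) (Suc l)) then f (V (Suc q) (Suc l)) else 0)"
      by (rule sum.inter_filter) simp
    also have "\<dots> = (\<Sum>l<Suc q. f (V (Suc q) (Suc l)) * of_bool (n (V (Suc q) l) < n (V (Suc q) (Suc l))))"
      by (intro sum.cong) auto
    finally show ?case .
  qed
  ultimately have "(\<lambda>q. \<Sum>l<Suc q. f (V (Suc q) (Suc l)) * of_bool (n (V (Suc q) l) < n (V (Suc q) (Suc l))))
    \<longlonglongrightarrow> (\<Sum>v\<in>J. f v)"
    by (rule Lim_transform_eventually)
  then show ?thesis by (simp add: jump_integral_def J_def)
qed

end

section \<open>Transition functions with a given generator\<close>

text \<open>The functions \<open>h - f\<close> and \<open>h + f\<close> are both nondecreasing.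
  Derivatives are required in the open interval only, because the time change is differentiated only
  below 1.\<close>

lemma abs_increment_le:
  fixes f h :: "real \<Rightarrow> real"
  assumes "s \<le> r" and cf: "continuous_on {s..r} f" and ch: "continuous_on {s..r} h"
    and f: "\<And>\<rho>. s < \<rho> \<Longrightarrow> \<rho> < r \<Longrightarrow> (f has_real_derivative f' \<rho>) (at \<rho>)"
    and h: "\<And>\<rho>. s < \<rho> \<Longrightarrow> \<rho> < r \<Longrightarrow> (h has_real_derivative h' \<rho>) (at \<rho>)"
    and le: "\<And>\<rho>. s < \<rho> \<Longrightarrow> \<rho> < r \<Longrightarrow> \<bar>f' \<rho>\<bar> \<le> h' \<rho>"
  shows "\<bar>f r - f s\<bar> \<le> h r - h s"
proof -
  have "h s - f s \<le> h r - f r"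
  proof (rule DERIV_nonneg_imp_increasing_open[OF assms(1)])
    fix x assume x: "s < x" "x < r"
    have "((\<lambda>x. h x - f x) has_real_derivative h' x - f' x) (at x)"
      using f[OF x] h[OF x] by (intro derivative_intros)
    moreover have "0 \<le> h' x - f' x" using le[OF x] by linarith
    ultimately show "\<exists>y. ((\<lambda>x. h x - f x) has_real_derivative y) (at x) \<and> 0 \<le> y" by blast
  qed (intro continuous_intros cf ch)
  moreover have "h s + f s \<le> h r + f r"
  proof (rule DERIV_nonneg_imp_increasing_open[OF assms(1)])
    fix x assume x: "s < x" "x < r"
    have "((\<lambda>x. h x + f x) has_real_derivative h' x + f' x) (at x)"
      using f[OF x] h[OF x] by (intro derivative_intros)
    moreover have "0 \<le> h' x + f' x" using le[OF x] by linarith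
    ultimately show "\<exists>y. ((\<lambda>x. h x + f x) has_real_derivative y) (at x) \<and> 0 \<le> y" by blast
  qed (intro continuous_intros cf ch)
  ultimately show ?thesis by linarith
qed

locale generated_transitions =
  fixes S :: "'s set" and p :: "real \<Rightarrow> real \<Rightarrow> 's \<Rightarrow> 's \<Rightarrow> real" and Q :: "real \<Rightarrow> 's \<Rightarrow> 's \<Rightarrow> real"
  assumes fin: "finite S" and tf: "transition_function S p" and gen: "has_generator S p Q"
begin

lemma p_stochastic: "0 \<le> s \<Longrightarrow> s \<le> t \<Longrightarrow> t \<le> 1 \<Longrightarrow> stochastic_matrix_on S (p s t)"
  using tf[unfolded transition_function_def, THEN conjunct1] by blast

lemma p_refl: "0 \<le> s \<Longrightarrow> s \<le> 1 \<Longrightarrow> x \<in> S \<Longrightarrow> y \<in> S \<Longrightarrow> p s s x y = identity_matrix x y"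
  using tf[unfolded transition_function_def, THEN conjunct2, THEN conjunct1] by simp

lemma chapman_kolmogorov:
  "0 \<le> s \<Longrightarrow> s \<le> t \<Longrightarrow> t \<le> u \<Longrightarrow> u \<le> 1 \<Longrightarrow> x \<in> S \<Longrightarrow> y \<in> S \<Longrightarrow> p s u x y = (\<Sum>z\<in>S. p s t x z * p t u z y)"
  using tf[unfolded transition_function_def, THEN conjunct2, THEN conjunct2, THEN spec[of _ s],
    THEN spec[of _ t], THEN spec[of _ u]] by blast

lemma p_nonneg: "0 \<le> s \<Longrightarrow> s \<le> t \<Longrightarrow> t \<le> 1 \<Longrightarrow> x \<in> S \<Longrightarrow> y \<in> S \<Longrightarrow> 0 \<le> p s t x y"
  using p_stochastic[of s t] by (simp add: stochastic_matrix_on_def)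

lemma p_sum: "0 \<le> s \<Longrightarrow> s \<le> t \<Longrightarrow> t \<le> 1 \<Longrightarrow> x \<in> S \<Longrightarrow> (\<Sum>y\<in>S. p s t x y) = 1"
  using p_stochastic[of s t] by (simp add: stochastic_matrix_on_def)

lemma p_le_1: "0 \<le> s \<Longrightarrow> s \<le> t \<Longrightarrow> t \<le> 1 \<Longrightarrow> x \<in> S \<Longrightarrow> y \<in> S \<Longrightarrow> p s t x y \<le> 1"
  using p_sum[of s t x] p_nonneg[of s t x] member_le_sum[of y S "p s t x"] fin by auto

lemma identity_sum: "x \<in> S \<Longrightarrow> (\<Sum>z\<in>S. f z * identity_matrix z x) = (f x :: real)"
  using fin by (simp add: identity_matrix_def of_bool_def if_distrib cong: if_cong)

lemma identity_sum': "x \<in> S \<Longrightarrow> (\<Sum>z\<in>S. identity_matrix x z * f z) = (f x :: real)"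
proof -
  assume "x \<in> S"
  have "(\<Sum>z\<in>S. identity_matrix x z * f z) = (\<Sum>z\<in>S. if x = z then f z else 0)"
    by (intro sum.cong) (auto simp: identity_matrix_def)
  then show ?thesis using fin \<open>x \<in> S\<close> by simp
qed

lemma increment_right:
  assumes "0 \<le> s" "s \<le> \<rho>" "\<rho> \<le> \<rho>'" "\<rho>' \<le> 1" "x \<in> S" "y \<in> S"
  shows "p s \<rho>' x y - p s \<rho> x y = (\<Sum>z\<in>S. p s \<rho> x z * (p \<rho> \<rho>' z y - identity_matrix z y))"
  using assms chapman_kolmogorov[of s \<rho> \<rho>' x y]
  by (simp add: right_diff_distrib sum_subtractf identity_sum)

lemma generator_right:
  "0 \<le> t \<Longrightarrow> t < 1 \<Longrightarrow> x \<in> S \<Longrightarrow> y \<in> S \<Longrightarrow>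
    ((\<lambda>h. (p t (t + h) x y - identity_matrix x y) / h) \<longlongrightarrow> Q t x y) (at_right 0)"
  using gen by (simp add: has_generator_def)

lemma generator_left:
  "0 < t \<Longrightarrow> t \<le> 1 \<Longrightarrow> x \<in> S \<Longrightarrow> y \<in> S \<Longrightarrow>
    ((\<lambda>h. (p (t - h) t x y - identity_matrix x y) / h) \<longlongrightarrow> Q t x y) (at_right 0)"
  using gen by (simp add: has_generator_def)

lemma tendsto_of_quotient:
  fixes f :: "real \<Rightarrow> real"
  assumes "((\<lambda>h. (f h - c) / h) \<longlongrightarrow> d) (at_right 0)"
  shows "((\<lambda>h. f h - c) \<longlongrightarrow> 0) (at_right 0)"
proof -
  have "((\<lambda>h. (f h - c) / h * h) \<longlongrightarrow> 0) (at_right 0)"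
    using tendsto_mult[OF assms tendsto_ident_at] by simp
  moreover have "eventually (\<lambda>h. (f h - c) / h * h = f h - c) (at_right (0::real))"
    by (auto simp: eventually_at_filter)
  ultimately show ?thesis by (rule Lim_transform_eventually)
qed

text \<open>The left-hand limit of the generator enters here: the factor
  \<open>p s (\<rho> - h)\<close> varies with \<open>h\<close> but has entries in the unit interval,
  and \<open>p (\<rho> - h) \<rho>\<close> tends to the identity.\<close>

lemma left_limit:
  assumes "0 \<le> s" "s < \<rho>" "\<rho> \<le> 1" "x \<in> S" "y \<in> S"
  shows "((\<lambda>h. p s (\<rho> - h) x y) \<longlongrightarrow> p s \<rho> x y) (at_right 0)"
proof -
  have ev: "eventually (\<lambda>h. h < \<rho> - s \<and> 0 < h) (at_right (0::real))"
    using assms by (auto simp: eventually_at_right_field intro!: exI[of _ "\<rho> - s"])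
  have "((\<lambda>h. \<Sum>z\<in>S. p s (\<rho> - h) x z * (p (\<rho> - h) \<rho> z y - identity_matrix z y)) \<longlongrightarrow> (\<Sum>z\<in>S. 0)) (at_right 0)"
  proof (rule tendsto_sum)
    fix z assume z: "z \<in> S"
    have "((\<lambda>h. p (\<rho> - h) \<rho> z y - identity_matrix z y) \<longlongrightarrow> 0) (at_right 0)"
      using assms z by (intro tendsto_of_quotient[OF generator_left]) auto
    then show "((\<lambda>h. p s (\<rho> - h) x z * (p (\<rho> - h) \<rho> z y - identity_matrix z y)) \<longlongrightarrow> 0) (at_right 0)"
    proof (rule Lim_null_comparison[rotated, OF tendsto_rabs_zero])
      show "eventually (\<lambda>h. norm (p s (\<rho> - h) x z * (p (\<rho> - h) \<rho> z y - identity_matrix z y))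
        \<le> \<bar>p (\<rho> - h) \<rho> z y - identity_matrix z y\<bar>) (at_right 0)"
        using ev
      proof eventually_elim
        case (elim h)
        then have "0 \<le> p s (\<rho> - h) x z" "p s (\<rho> - h) x z \<le> 1"
          using assms z by (auto intro!: p_nonneg p_le_1)
        then show ?case by (simp add: abs_mult mult_left_le_one_le)
      qed
    qed
  qed
  moreover have "eventually (\<lambda>h. (\<Sum>z\<in>S. p s (\<rho> - h) x z * (p (\<rho> - h) \<rho> z y - identity_matrix z y)) = p s \<rho> x y - p s (\<rho> - h) x y) (at_right 0)"
    using ev
  proof eventually_elim
    case (elim h)
    then show ?case using assms by (subst increment_right) auto
  qed
  ultimately have "((\<lambda>h. p s \<rho> x y - p s (\<rho> - h) x y) \<longlongrightarrow> (\<Sum>z\<in>S. 0)) (at_right 0)"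
    by (rule Lim_transform_eventually)
  from tendsto_diff[OF tendsto_const[of "p s \<rho> x y"] this] show ?thesis by simp
qed

lemma right_limit:
  assumes "0 \<le> s" "s \<le> \<rho>" "\<rho> < 1" "x \<in> S" "y \<in> S"
  shows "((\<lambda>h. p s (\<rho> + h) x y) \<longlongrightarrow> p s \<rho> x y) (at_right 0)"
proof -
  have ev: "eventually (\<lambda>h. h < 1 - \<rho> \<and> 0 < h) (at_right (0::real))"
    using assms by (auto simp: eventually_at_right_field intro!: exI[of _ "1 - \<rho>"])
  have "((\<lambda>h. \<Sum>z\<in>S. p s \<rho> x z * (p \<rho> (\<rho> + h) z y - identity_matrix z y)) \<longlongrightarrow> (\<Sum>z\<in>S. p s \<rho> x z * 0)) (at_right 0)"
    using assms by (intro tendsto_sum tendsto_mult tendsto_const tendsto_of_quotient[OF generator_right]) auto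
  moreover have "eventually (\<lambda>h. (\<Sum>z\<in>S. p s \<rho> x z * (p \<rho> (\<rho> + h) z y - identity_matrix z y)) = p s (\<rho> + h) x y - p s \<rho> x y) (at_right 0)"
    using ev
  proof eventually_elim
    case (elim h)
    then show ?case using assms by (subst increment_right) auto
  qed
  ultimately have "((\<lambda>h. p s (\<rho> + h) x y - p s \<rho> x y) \<longlongrightarrow> (\<Sum>z\<in>S. p s \<rho> x z * 0)) (at_right 0)"
    by (rule Lim_transform_eventually)
  from tendsto_add[OF tendsto_const[of "p s \<rho> x y"] this] show ?thesis by simp
qed

lemma continuous_p:
  assumes "0 \<le> s" "s \<le> 1" "x \<in> S" "y \<in> S"
  shows "continuous_on {s..1} (\<lambda>\<rho>. p s \<rho> x y)"
proof (cases "s < 1")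
  case True
  have R: "((\<lambda>\<rho>. p s \<rho> x y) \<longlongrightarrow> p s \<rho> x y) (at_right \<rho>)" if "s \<le> \<rho>" "\<rho> < 1" for \<rho>
    using right_limit[OF assms(1) that assms(3,4)] by (subst filterlim_at_right_to_0) (simp add: add.commute)
  have L: "((\<lambda>\<rho>. p s \<rho> x y) \<longlongrightarrow> p s \<rho> x y) (at_left \<rho>)" if "s < \<rho>" "\<rho> \<le> 1" for \<rho>
    using left_limit[OF assms(1) that assms(3,4)]
    by (subst filterlim_at_left_to_right, subst filterlim_at_right_to_0) simp
  show ?thesis
    by (rule continuous_on_IccI) (use True R L in \<open>auto intro!: filterlim_split_at\<close>)
next
  case False
  then have "{s..1} = {s}" using assms by auto
  then show ?thesis by simp
qed

text \<open>Kolmogorov's forward equation. From the right the factor \<open>p s \<rho>\<close> stays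
  fixed; from the left it is \<open>p s (\<rho> - h)\<close>, which is why left continuity is
  established first.\<close>

lemma forward_equation:
  assumes "0 \<le> s" "s < \<rho>" "\<rho> < 1" "x \<in> S" "y \<in> S"
  shows "((\<lambda>\<rho>. p s \<rho> x y) has_real_derivative (\<Sum>z\<in>S. p s \<rho> x z * Q \<rho> z y)) (at \<rho>)"
  unfolding DERIV_def
proof (rule filterlim_split_at)
  have "((\<lambda>h. \<Sum>z\<in>S. p s \<rho> x z * ((p \<rho> (\<rho> + h) z y - identity_matrix z y) / h)) \<longlongrightarrow> (\<Sum>z\<in>S. p s \<rho> x z * Q \<rho> z y)) (at_right 0)"
    using assms by (intro tendsto_sum tendsto_mult tendsto_const generator_right) auto
  moreover have "eventually (\<lambda>h. (\<Sum>z\<in>S. p s \<rho> x z * ((p \<rho> (\<rho> + h) z y - identity_matrix z y) / h)) = (p s (\<rho> + h) x y - p s \<rho> x y) / h) (at_right 0)"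
    unfolding eventually_at_right_field
  proof (intro exI conjI allI impI)
    show "0 < 1 - \<rho>" using assms by simp
    fix h assume "0 < h" "h < 1 - \<rho>"
    then show "(\<Sum>z\<in>S. p s \<rho> x z * ((p \<rho> (\<rho> + h) z y - identity_matrix z y) / h)) = (p s (\<rho> + h) x y - p s \<rho> x y) / h"
      using assms by (subst increment_right) (auto simp: sum_divide_distrib)
  qed
  ultimately show "((\<lambda>h. (p s (\<rho> + h) x y - p s \<rho> x y) / h) \<longlongrightarrow> (\<Sum>z\<in>S. p s \<rho> x z * Q \<rho> z y)) (at_right 0)"
    by (rule Lim_transform_eventually)
next
  have "((\<lambda>h. \<Sum>z\<in>S. p s (\<rho> - h) x z * ((p (\<rho> - h) \<rho> z y - identity_matrix z y) / h)) \<longlongrightarrow> (\<Sum>z\<in>S. p s \<rho> x z * Q \<rho> z y)) (at_right 0)"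
    using assms by (intro tendsto_sum tendsto_mult left_limit generator_left) auto
  moreover have "eventually (\<lambda>h. (\<Sum>z\<in>S. p s (\<rho> - h) x z * ((p (\<rho> - h) \<rho> z y - identity_matrix z y) / h)) = (p s (\<rho> - h) x y - p s \<rho> x y) / (- h)) (at_right 0)"
    unfolding eventually_at_right_field
  proof (intro exI conjI allI impI)
    show "0 < \<rho> - s" using assms by simp
    fix h assume h: "0 < h" "h < \<rho> - s"
    have "(p s (\<rho> - h) x y - p s \<rho> x y) / (- h) = (p s \<rho> x y - p s (\<rho> - h) x y) / h"
      using h by (simp add: field_simps)
    then show "(\<Sum>z\<in>S. p s (\<rho> - h) x z * ((p (\<rho> - h) \<rho> z y - identity_matrix z y) / h)) = (p s (\<rho> - h) x y - p s \<rho> x y) / (- h)"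
      using assms h by (simp only:, subst increment_right) (auto simp: sum_divide_distrib)
  qed
  ultimately show "((\<lambda>h. (p s (\<rho> + h) x y - p s \<rho> x y) / h) \<longlongrightarrow> (\<Sum>z\<in>S. p s \<rho> x z * Q \<rho> z y)) (at_left 0)"
    by (subst filterlim_at_left_to_right) (auto intro: Lim_transform_eventually)
qed

end

text \<open>The generator is \<open>G' v\<close> times \<open>lam (P - I)\<close>, where \<open>G'\<close> is the derivative of \<open>G\<close>: in the time
  scale \<open>G\<close> the chain is homogeneous.\<close>

locale time_changed_chain =
  fixes S :: "'s set" and P :: "'s \<Rightarrow> 's \<Rightarrow> real" and \<alpha> lam :: real and p
  assumes finS: "finite S" and stochP: "stochastic_matrix_on S P" and par: "0 < lam" "0 < \<alpha>" "\<alpha> < 1"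
    and tf: "transition_function S p" and gen: "has_generator S p (limit_generator \<alpha> lam P)"
begin

sublocale generated_transitions S p "limit_generator \<alpha> lam P"
  by unfold_locales (fact finS tf gen)+

text \<open>The inverse of the time map: \<open>G (1 - r powr (1 - \<alpha>)) = - r\<close> for
  \<open>0 \<le> r\<close>. Equal cells of the original grid therefore have equal increments of
  \<open>G\<close>.\<close>

definition G :: "real \<Rightarrow> real" where "G v = - ((1 - v) powr (1 / (1 - \<alpha>)))"
definition G' :: "real \<Rightarrow> real" where "G' v = 1 / (1 - \<alpha>) * (1 - v) powr (\<alpha> / (1 - \<alpha>))"

lemma G'_nonneg: "0 \<le> G' v"
  using par by (simp add: G'_def)

lemma G_deriv: "v < 1 \<Longrightarrow> (G has_real_derivative G' v) (at v)"
proof -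
  assume "v < 1"
  moreover have "1 / (1 - \<alpha>) - 1 = \<alpha> / (1 - \<alpha>)" using par by (simp add: field_simps)
  ultimately show ?thesis
    unfolding G_def G'_def by (auto intro!: derivative_eq_intros)
qed

lemma G_cont: "continuous_on {s..r} G" if "r \<le> 1"
  unfolding G_def using that par by (intro continuous_on_minus continuous_on_powr' continuous_intros) auto

lemma G_mono: "s \<le> r \<Longrightarrow> r \<le> 1 \<Longrightarrow> G s \<le> G r"
  unfolding G_def using par by (auto intro!: powr_mono2)

lemma P_entry: "x \<in> S \<Longrightarrow> y \<in> S \<Longrightarrow> 0 \<le> P x y" "x \<in> S \<Longrightarrow> y \<in> S \<Longrightarrow> P x y \<le> 1"
proof -
  show 1: "x \<in> S \<Longrightarrow> y \<in> S \<Longrightarrow> 0 \<le> P x y" for x y using stochP by (simp add: stochastic_matrix_on_def)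
  assume "x \<in> S" "y \<in> S"
  then have "P x y \<le> (\<Sum>y\<in>S. P x y)" using finS 1 by (intro member_le_sum) auto
  then show "P x y \<le> 1" using stochP \<open>x \<in> S\<close> by (simp add: stochastic_matrix_on_def)
qed

lemma PI_abs: "x \<in> S \<Longrightarrow> y \<in> S \<Longrightarrow> \<bar>P x y - identity_matrix x y\<bar> \<le> 1"
  using P_entry[of x y] by (auto simp: identity_matrix_def)

lemma Q_eq: "limit_generator \<alpha> lam P v x y = lam * G' v * (P x y - identity_matrix x y)"
  by (simp add: limit_generator_def G'_def)

lemma p_cont: "0 \<le> s \<Longrightarrow> s \<le> r \<Longrightarrow> r \<le> 1 \<Longrightarrow> x \<in> S \<Longrightarrow> y \<in> S \<Longrightarrow> continuous_on {s..r} (\<lambda>\<rho>. p s \<rho> x y)"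
  by (rule continuous_on_subset[OF continuous_p]) auto

text \<open>Rows of \<open>p\<close> sum to 1 and entries of \<open>P - I\<close> are at most 1 in
  absolute value, so the forward equation bounds the derivative by
  \<open>lam * G' \<rho>\<close>.\<close>

lemma p_near_identity:
  assumes "0 \<le> s" "s \<le> r" "r \<le> 1" "x \<in> S" "y \<in> S"
  shows "\<bar>p s r x y - identity_matrix x y\<bar> \<le> lam * (G r - G s)"
proof -
  have "\<bar>p s r x y - p s s x y\<bar> \<le> lam * G r - lam * G s"
  proof (rule abs_increment_le[where f'="\<lambda>\<rho>. \<Sum>z\<in>S. p s \<rho> x z * limit_generator \<alpha> lam P \<rho> z y" and h'="\<lambda>\<rho>. lam * G' \<rho>"])
    fix \<rho> assume \<rho>: "s < \<rho>" "\<rho> < r"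
    show "((\<lambda>r. p s r x y) has_real_derivative (\<Sum>z\<in>S. p s \<rho> x z * limit_generator \<alpha> lam P \<rho> z y)) (at \<rho>)"
      using assms \<rho> by (intro forward_equation) auto
    show "((\<lambda>a. lam * G a) has_real_derivative lam * G' \<rho>) (at \<rho>)"
      using assms \<rho> by (auto intro!: derivative_eq_intros G_deriv)
    have "\<bar>\<Sum>z\<in>S. p s \<rho> x z * limit_generator \<alpha> lam P \<rho> z y\<bar> \<le> (\<Sum>z\<in>S. p s \<rho> x z * (lam * G' \<rho>))"
    proof (intro order_trans[OF sum_abs] sum_mono)
      fix z assume z: "z \<in> S"
      have "0 \<le> p s \<rho> x z" using assms \<rho> z by (intro p_nonneg) auto
      moreover have "\<bar>limit_generator \<alpha> lam P \<rho> z y\<bar> \<le> lam * G' \<rho> * 1"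
        unfolding Q_eq abs_mult using par G'_nonneg PI_abs[OF z assms(5)] by (intro mult_mono) auto
      ultimately show "\<bar>p s \<rho> x z * limit_generator \<alpha> lam P \<rho> z y\<bar> \<le> p s \<rho> x z * (lam * G' \<rho>)"
        by (simp add: abs_mult mult_left_mono)
    qed
    also have "\<dots> = lam * G' \<rho>" using p_sum[of s \<rho> x] assms \<rho> by (simp add: sum_distrib_right[symmetric])
    finally show "\<bar>\<Sum>z\<in>S. p s \<rho> x z * limit_generator \<alpha> lam P \<rho> z y\<bar> \<le> lam * G' \<rho>" .
  qed (use assms in \<open>auto intro!: p_cont continuous_intros G_cont\<close>)
  then show ?thesis using p_refl[of s x y] assms by (simp add: right_diff_distrib)
qed

text \<open>The first-order bound is fed back into the forward equation: the remainder has
  derivative \<open>lam * G'\<close> times an entry of \<open>(p - I) (P - I)\<close>, which is at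
  most \<open>card S * lam * (G \<rho> - G s)\<close>, and integrates to a square.\<close>

lemma p_second_order:
  assumes "0 \<le> s" "s \<le> r" "r \<le> 1" "x \<in> S" "y \<in> S"
  shows "\<bar>p s r x y - identity_matrix x y - lam * (G r - G s) * (P x y - identity_matrix x y)\<bar>
    \<le> real (card S) * (lam * (G r - G s))\<^sup>2"
proof -
  let ?f = "\<lambda>\<rho>. p s \<rho> x y - lam * G \<rho> * (P x y - identity_matrix x y)"
  let ?f' = "\<lambda>\<rho>. (\<Sum>z\<in>S. p s \<rho> x z * limit_generator \<alpha> lam P \<rho> z y) - lam * G' \<rho> * (P x y - identity_matrix x y)"
  let ?h = "\<lambda>\<rho>. real (card S) * (lam * (G \<rho> - G s))\<^sup>2"
  let ?h' = "\<lambda>\<rho>. real (card S) * (2 * (lam * (G \<rho> - G s)) * (lam * G' \<rho>))"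
  have "\<bar>?f r - ?f s\<bar> \<le> ?h r - ?h s"
  proof (rule abs_increment_le[where f'="?f'" and h'="?h'"])
    fix \<rho> assume \<rho>: "s < \<rho>" "\<rho> < r"
    have "((\<lambda>\<rho>. lam * G \<rho> * (P x y - identity_matrix x y)) has_real_derivative lam * G' \<rho> * (P x y - identity_matrix x y)) (at \<rho>)"
      using assms \<rho> by (intro DERIV_cmult_right DERIV_cmult G_deriv) auto
    then show "(?f has_real_derivative ?f' \<rho>) (at \<rho>)"
      using assms \<rho> by (intro DERIV_diff forward_equation) auto
    show "(?h has_real_derivative ?h' \<rho>) (at \<rho>)"
      using assms \<rho> by (auto intro!: derivative_eq_intros G_deriv)
    have G: "0 \<le> G \<rho> - G s" using G_mono[of s \<rho>] assms \<rho> by auto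
    have "(\<Sum>z\<in>S. p s \<rho> x z * limit_generator \<alpha> lam P \<rho> z y)
        = lam * G' \<rho> * (\<Sum>z\<in>S. p s \<rho> x z * (P z y - identity_matrix z y))"
      unfolding Q_eq sum_distrib_left by (intro sum.cong) (auto simp: mult_ac)
    then have "?f' \<rho> = lam * G' \<rho> * ((\<Sum>z\<in>S. p s \<rho> x z * (P z y - identity_matrix z y)) - (P x y - identity_matrix x y))"
      by (simp add: right_diff_distrib)
    also have "\<dots> = lam * G' \<rho> * (\<Sum>z\<in>S. (p s \<rho> x z - identity_matrix x z) * (P z y - identity_matrix z y))"
      using assms(4) by (simp add: left_diff_distrib sum_subtractf identity_sum')
    finally have eq: "?f' \<rho> = lam * G' \<rho> * (\<Sum>z\<in>S. (p s \<rho> x z - identity_matrix x z) * (P z y - identity_matrix z y))" .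
    have "\<bar>\<Sum>z\<in>S. (p s \<rho> x z - identity_matrix x z) * (P z y - identity_matrix z y)\<bar> \<le> (\<Sum>z\<in>S. lam * (G \<rho> - G s))"
    proof (intro order_trans[OF sum_abs] sum_mono)
      fix z assume z: "z \<in> S"
      show "\<bar>(p s \<rho> x z - identity_matrix x z) * (P z y - identity_matrix z y)\<bar> \<le> lam * (G \<rho> - G s)"
        unfolding abs_mult
        using mult_mono[OF p_near_identity[of s \<rho> x z] PI_abs[OF z assms(5)]] assms \<rho> z par G by simp
    qed
    then have "\<bar>?f' \<rho>\<bar> \<le> lam * G' \<rho> * (real (card S) * (lam * (G \<rho> - G s)))"
      unfolding eq abs_mult using par G'_nonneg[of \<rho>] by (intro mult_mono) auto
    \<comment> \<open>Slack of a factor 2, spent so that the bound is the derivative of the plain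
      square in \<open>?h\<close>.\<close>
    also have "\<dots> \<le> 2 * \<dots>"
      using par G G'_nonneg[of \<rho>] by simp
    also have "\<dots> = ?h' \<rho>" by (simp only: mult_ac)
    finally show "\<bar>?f' \<rho>\<bar> \<le> ?h' \<rho>" .
  qed (use assms in \<open>auto intro!: p_cont continuous_intros G_cont\<close>)
  moreover have "?f r - ?f s = p s r x y - identity_matrix x y - lam * (G r - G s) * (P x y - identity_matrix x y)"
    using p_refl[of s x y] assms by (simp add: left_diff_distrib right_diff_distrib)
  ultimately show ?thesis by simp
qed

text \<open>The integrating factor \<open>exp (lam * G \<rho>)\<close> compensates the rate of
  leaving \<open>x\<close>, and the inflow is nonnegative. This makes conditioning on the state at
  time \<open>a\<close> meaningful wherever \<open>\<pi>\<close> is positive.\<close>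

lemma p_diag_pos:
  assumes "0 \<le> a" "a \<le> 1" "x \<in> S"
  shows "0 < p 0 a x x"
proof -
  let ?f = "\<lambda>\<rho>. p 0 \<rho> x x * exp (lam * G \<rho>)"
  have "?f 0 \<le> ?f a"
  proof (rule DERIV_nonneg_imp_increasing_open[OF assms(1)])
    fix \<rho> assume \<rho>: "0 < \<rho>" "\<rho> < a"
    let ?s = "\<Sum>z\<in>S. p 0 \<rho> x z * limit_generator \<alpha> lam P \<rho> z x"
    have pz: "0 \<le> p 0 \<rho> x z" if "z \<in> S" for z using assms \<rho> that by (intro p_nonneg) auto
    have "(?f has_real_derivative ?s * exp (lam * G \<rho>) + p 0 \<rho> x x * (exp (lam * G \<rho>) * (lam * G' \<rho>))) (at \<rho>)"
      using assms \<rho> by (auto intro!: derivative_eq_intros G_deriv forward_equation simp: mult_ac)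
    moreover have "0 \<le> ?s * exp (lam * G \<rho>) + p 0 \<rho> x x * (exp (lam * G \<rho>) * (lam * G' \<rho>))"
    proof -
      have "0 \<le> lam * G' \<rho> * (\<Sum>z\<in>S. p 0 \<rho> x z * P z x)"
        using par G'_nonneg pz P_entry(1)[OF _ assms(3)] by (intro mult_nonneg_nonneg sum_nonneg) auto
      also have "(\<Sum>z\<in>S. p 0 \<rho> x z * P z x) = (\<Sum>z\<in>S. p 0 \<rho> x z * (P z x - identity_matrix z x)) + p 0 \<rho> x x"
        using assms(3) by (simp add: right_diff_distrib sum_subtractf identity_sum)
      also have "lam * G' \<rho> * \<dots> = ?s + p 0 \<rho> x x * (lam * G' \<rho>)"
        unfolding Q_eq by (simp add: distrib_left sum_distrib_left mult_ac)
      finally have "0 \<le> (?s + p 0 \<rho> x x * (lam * G' \<rho>)) * exp (lam * G \<rho>)" by simp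
      then show ?thesis by (simp add: algebra_simps)
    qed
    ultimately show "\<exists>y. (?f has_real_derivative y) (at \<rho>) \<and> 0 \<le> y" by blast
  qed (use assms in \<open>auto intro!: continuous_intros p_cont G_cont\<close>)
  moreover have "p 0 0 x x = 1" using p_refl[of 0 x x] assms by (simp add: identity_matrix_def)
  ultimately have "0 < ?f a" by (simp add: less_le_trans[OF exp_gt_zero])
  then show ?thesis by (simp add: zero_less_mult_iff)
qed

end

section \<open>The transform of the limit\<close>

text \<open>The indicator \<open>0 < d\<close> matches the cell sums for jump integrals, where only
  the presence of a jump counts.\<close>

lemma poisson_transform_positive:
  assumes "0 < \<mu>"
  shows "measure_pmf.expectation (poisson_pmf \<mu>) (\<lambda>d. exp (- (c * of_bool (0 < d)))) = 1 - (1 - exp (- c)) * (1 - exp (- \<mu>))"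
proof -
  have "measure_pmf.expectation (poisson_pmf \<mu>) (\<lambda>d. exp (- (c * of_bool (0 < d))))
    = measure_pmf.expectation (poisson_pmf \<mu>) (\<lambda>d. exp (- c) + (1 - exp (- c)) * indicator {0} d)"
    by (intro Bochner_Integration.integral_cong) (auto simp: indicator_def)
  also have "\<dots> = exp (- c) + (1 - exp (- c)) * pmf (poisson_pmf \<mu>) 0"
    by (subst Bochner_Integration.integral_add)
      (auto simp: measure_pmf_single less_top[symmetric] simp del: pmf_poisson)
  finally show ?thesis using assms by (simp add: algebra_simps)
qed

lemma borel_measurable_exp_compose:
  fixes f :: "'a \<Rightarrow> real"
  shows "f \<in> borel_measurable M \<Longrightarrow> (\<lambda>\<omega>. exp (f \<omega>)) \<in> borel_measurable M"
  by (rule measurable_compose[OF _ borel_measurable_exp])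

lemma borel_measurable_of_bool_less:
  fixes f g :: "'a \<Rightarrow> nat"
  assumes [measurable]: "f \<in> measurable M (count_space UNIV)" "g \<in> measurable M (count_space UNIV)"
  shows "(\<lambda>\<omega>. of_bool (f \<omega> < g \<omega>) :: real) \<in> borel_measurable M"
proof -
  have "(\<lambda>\<omega>. g \<omega> - f \<omega>) \<in> measurable M (count_space UNIV)" by measurable
  from measurable_compose[OF this, of "\<lambda>d. of_bool (0 < d) :: real" borel] show ?thesis by simp
qed

locale limit_model = prob_space M + time_changed_chain S P \<alpha> lam p + refining_partitions V a mesh
  for M :: "'b measure" and S :: "(real ^ 'k) set" and P \<alpha> lam p and V a mesh +
  fixes X :: "real \<Rightarrow> 'b \<Rightarrow> real ^ 'k" and \<nu> :: "'k \<Rightarrow> real \<Rightarrow> 'b \<Rightarrow> nat" and s :: "'k \<Rightarrow> real"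
  assumes X_meas: "\<And>v. v \<in> {0..1} \<Longrightarrow> X v \<in> borel_measurable M"
    and X_in: "\<And>v \<omega>. v \<in> {0..1} \<Longrightarrow> \<omega> \<in> space M \<Longrightarrow> X v \<omega> \<in> S"
    and X_right: "\<And>v \<omega>. v \<in> {0..<1} \<Longrightarrow> \<omega> \<in> space M \<Longrightarrow> ((\<lambda>v. X v \<omega>) \<longlongrightarrow> X v \<omega>) (at_right v)"
    and law: "\<And>m s x. (\<forall>i\<le>Suc m. s i \<in> {0..1} \<and> x i \<in> S) \<Longrightarrow> (\<forall>i\<le>m. s i < s (Suc i)) \<Longrightarrow>
            \<P>(\<omega> in M. \<forall>i\<le>m. X (s i) \<omega> = x i) > 0 \<Longrightarrow>
          \<P>(\<omega> in M. X (s (Suc m)) \<omega> = x (Suc m) \<bar> \<forall>i\<le>m. X (s i) \<omega> = x i)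
            = p (s m) (s (Suc m)) (x m) (x (Suc m))"
    and S_nonneg: "\<And>x j. x \<in> S \<Longrightarrow> 0 \<le> x $ j" and s_nonneg: "\<And>j. 0 \<le> s j" and a_nonneg: "0 \<le> a"
    and \<nu>: "\<And>j. poisson_process M {0..1} (lam / (1 - \<alpha>)) (\<nu> j)"
    and indep: "indep_sets (\<lambda>m. case m of
                  None \<Rightarrow> generated_events M borel X {0..1}
                | Some j \<Rightarrow> generated_events M (count_space UNIV) (\<nu> j) {0..1}) UNIV"
begin

abbreviation U :: "nat \<Rightarrow> nat \<Rightarrow> real" where "U q \<equiv> V (Suc q)"

abbreviation fluid_sum :: "nat \<Rightarrow> 'b \<Rightarrow> real ^ 'k" where
  "fluid_sum q \<omega> \<equiv> \<Sum>l<Suc q. (U q (Suc l) - U q l) *\<^sub>R X (U q (Suc l)) \<omega>"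

abbreviation jump_sum :: "nat \<Rightarrow> 'k \<Rightarrow> 'b \<Rightarrow> real" where
  "jump_sum q j \<omega> \<equiv> \<Sum>l<Suc q. X (U q (Suc l)) \<omega> $ j * of_bool (\<nu> j (U q l) \<omega> < \<nu> j (U q (Suc l)) \<omega>)"

lemma V01: "l \<le> Suc q \<Longrightarrow> U q l \<in> {0..1}"
  using V_bounds[of "Suc q" l] a_nonneg by auto

lemma X_V_meas [measurable]: "l \<le> Suc q \<Longrightarrow> X (U q l) \<in> borel_measurable M"
  using V01 by (intro X_meas)

lemma path_law:
  assumes "l < Suc q" "\<forall>i\<le>Suc l. z i \<in> S"
  shows "prob {\<omega> \<in> space M. \<forall>i\<le>Suc l. X (U q i) \<omega> = z i}
      = prob {\<omega> \<in> space M. \<forall>i\<le>l. X (U q i) \<omega> = z i} * p (U q l) (U q (Suc l)) (z l) (z (Suc l))"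
proof (cases "prob {\<omega> \<in> space M. \<forall>i\<le>l. X (U q i) \<omega> = z i} > 0")
  case True
  have "cond_prob M (\<lambda>\<omega>. X (U q (Suc l)) \<omega> = z (Suc l)) (\<lambda>\<omega>. \<forall>i\<le>l. X (U q i) \<omega> = z i)
      = p (U q l) (U q (Suc l)) (z l) (z (Suc l))"
    using assms V01[of _ q] strict[of _ "Suc q"] True by (intro law[of l "U q" z]) auto
  moreover have "{\<omega> \<in> space M. X (U q (Suc l)) \<omega> = z (Suc l) \<and> (\<forall>i\<le>l. X (U q i) \<omega> = z i)}
      = {\<omega> \<in> space M. \<forall>i\<le>Suc l. X (U q i) \<omega> = z i}"
    by (auto simp: le_Suc_eq)
  ultimately show ?thesis using True unfolding cond_prob_def by (simp add: field_simps)
next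
  case False
  have [measurable]: "X (U q i) \<in> borel_measurable M" if "i \<le> l" for i using that assms by simp
  have "prob {\<omega> \<in> space M. \<forall>i\<le>Suc l. X (U q i) \<omega> = z i} \<le> prob {\<omega> \<in> space M. \<forall>i\<le>l. X (U q i) \<omega> = z i}"
  proof (rule finite_measure_mono)
    have "{\<omega> \<in> space M. \<forall>i\<in>{..l}. X (U q i) \<omega> = z i} \<in> events" by measurable
    then show "{\<omega> \<in> space M. \<forall>i\<le>l. X (U q i) \<omega> = z i} \<in> events" by simp
  qed auto
  then show ?thesis using False measure_nonneg[of M] by (smt (verit) mult_eq_0_iff)
qed

text \<open>The partition begins at \<open>a\<close> and ends at 1, so the first and the last of its
  states are the conditioning state and the terminal state.\<close>

lemma partition_expectation:
  assumes "x \<in> S" "y \<in> S"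
  shows "expectation (\<lambda>\<omega>. of_bool (X a \<omega> = x) * (\<Prod>l<Suc q. w l (X (U q (Suc l)) \<omega>)) * of_bool (X 1 \<omega> = y))
    = prob {\<omega> \<in> space M. X a \<omega> = x} *
      path_weight S (\<lambda>l z y. p (U q l) (U q (Suc l)) z y * w l y) x (Suc q) y"
proof -
  have ev: "{\<omega> \<in> space M. X (U q i) \<omega> = z} \<in> events" if "i \<le> Suc q" for i z
  proof -
    have [measurable]: "X (U q i) \<in> borel_measurable M" using that by simp
    show ?thesis by measurable
  qed
  show ?thesis
    using chain_expectation[where Y="\<lambda>i. X (U q i)" and m="Suc q" and S=S and x=x and y=y and w=w
        and p="\<lambda>l. p (U q l) (U q (Suc l))"]
      finS X_in V01[of _ q] ev path_law[of _ q] assms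
    by (simp add: start finish)
qed

section \<open>The fluid integral along partitions\<close>

lemma fluid_limit:
  assumes w: "\<omega> \<in> space M"
  shows "(\<lambda>q. fluid_sum q \<omega>)
    \<longlonglongrightarrow> (LINT v:{a..1}|lborel. X v \<omega>)"
proof (rule riemann_sum_tendsto)
  show "norm (X v \<omega>) \<le> (\<Sum>x\<in>S. norm x)" if "a \<le> v" "v \<le> 1" for v
    using X_in[of v \<omega>] that a_nonneg w finS by (intro member_le_sum) auto
qed (use X_right w a_nonneg in auto)

lemma fluid_measurable: "(\<lambda>\<omega>. LINT v:{a..1}|lborel. X v \<omega>) \<in> borel_measurable M"
proof (rule borel_measurable_LIMSEQ_metric[OF _ fluid_limit])
  fix q
  show "(\<lambda>\<omega>. fluid_sum q \<omega>) \<in> borel_measurable M"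
    by (intro borel_measurable_sum borel_measurable_scaleR X_V_meas) auto
qed

lemma fluid_nonneg: "\<omega> \<in> space M \<Longrightarrow> 0 \<le> (LINT v:{a..1}|lborel. X v \<omega>) $ j"
proof (rule LIMSEQ_le_const[OF tendsto_vec_nth[OF fluid_limit]])
  assume w: "\<omega> \<in> space M"
  have "0 \<le> fluid_sum q \<omega> $ j" for q
    using X_in[OF V01 w] strict[of _ "Suc q"] S_nonneg
    by (auto simp: sum_component intro!: sum_nonneg mult_nonneg_nonneg simp del: sum.lessThan_Suc)
      (simp add: less_imp_le)
  then show "\<exists>N. \<forall>n\<ge>N. 0 \<le> (\<Sum>l<Suc n. (V (Suc n) (Suc l) - V (Suc n) l) *\<^sub>R X (V (Suc n) (Suc l)) \<omega>) $ j"
    by blast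
qed

text \<open>The exponential of a Riemann sum is a product over cells. Sampling at upper end points
  makes each factor a weight on the state in which the step over that cell ends.\<close>

lemma fluid_transform:
  assumes "x \<in> S" "y \<in> S" and r: "0 \<le> r"
  shows "(\<lambda>q. prob {\<omega> \<in> space M. X a \<omega> = x} * path_weight S (\<lambda>l z y. p (U q l) (U q (Suc l)) z y *
        exp (- (r * (U q (Suc l) - U q l) * (\<Sum>j\<in>UNIV. s j * y $ j)))) x (Suc q) y)
    \<longlonglongrightarrow> expectation (\<lambda>\<omega>. of_bool (X a \<omega> = x) *
      exp (- (\<Sum>j\<in>UNIV. s j * (r *\<^sub>R (LINT v:{a..1}|lborel. X v \<omega>)) $ j)) * of_bool (X 1 \<omega> = y))"
proof -
  let ?I = "\<lambda>\<omega>. LINT v:{a..1}|lborel. X v \<omega>"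
  note [measurable] = fluid_measurable
  have [measurable]: "X a \<in> borel_measurable M" "X 1 \<in> borel_measurable M"
    using a_nonneg a_le_1 by (auto intro: X_meas)
  have Rm[measurable]: "fluid_sum q \<in> borel_measurable M" for q
    by (intro borel_measurable_sum borel_measurable_scaleR X_V_meas) auto
  have eq: "(\<Prod>l<Suc q. exp (- (r * (U q (Suc l) - U q l) * (\<Sum>j\<in>UNIV. s j * X (U q (Suc l)) \<omega> $ j))))
    = exp (- (\<Sum>j\<in>UNIV. s j * (r *\<^sub>R fluid_sum q \<omega>) $ j))" for q \<omega>
  proof -
    have "(\<Sum>j\<in>UNIV. s j * (r *\<^sub>R fluid_sum q \<omega>) $ j)
      = (\<Sum>j\<in>UNIV. \<Sum>l<Suc q. r * (U q (Suc l) - U q l) * (s j * X (U q (Suc l)) \<omega> $ j))"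
      by (simp add: sum_component sum_distrib_left mult_ac del: sum.lessThan_Suc)
    also have "\<dots> = (\<Sum>l<Suc q. r * (U q (Suc l) - U q l) * (\<Sum>j\<in>UNIV. s j * X (U q (Suc l)) \<omega> $ j))"
      by (subst sum.swap) (simp only: sum_distrib_left)
    finally show ?thesis by (simp only: exp_sum[symmetric, OF finite_lessThan] sum_negf)
  qed
  have "(\<lambda>q. expectation (\<lambda>\<omega>. of_bool (X a \<omega> = x) * exp (- (\<Sum>j\<in>UNIV. s j * (r *\<^sub>R fluid_sum q \<omega>) $ j)) * of_bool (X 1 \<omega> = y)))
    \<longlonglongrightarrow> expectation (\<lambda>\<omega>. of_bool (X a \<omega> = x) * exp (- (\<Sum>j\<in>UNIV. s j * (r *\<^sub>R ?I \<omega>) $ j)) * of_bool (X 1 \<omega> = y))"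
  proof (rule integral_dominated_convergence[where w="\<lambda>_. 1"])
    show "AE \<omega> in M. (\<lambda>q. of_bool (X a \<omega> = x) * exp (- (\<Sum>j\<in>UNIV. s j * (r *\<^sub>R fluid_sum q \<omega>) $ j)) * of_bool (X 1 \<omega> = y))
      \<longlonglongrightarrow> of_bool (X a \<omega> = x) * exp (- (\<Sum>j\<in>UNIV. s j * (r *\<^sub>R ?I \<omega>) $ j)) * of_bool (X 1 \<omega> = y)"
      by (intro AE_I2 tendsto_mult tendsto_exp tendsto_minus tendsto_sum tendsto_vec_nth tendsto_scaleR
          tendsto_const fluid_limit)
    fix q
    show "AE \<omega> in M. norm (of_bool (X a \<omega> = x) * exp (- (\<Sum>j\<in>UNIV. s j * (r *\<^sub>R fluid_sum q \<omega>) $ j)) * of_bool (X 1 \<omega> = y)) \<le> 1"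
    proof (rule AE_I2)
      fix \<omega> assume w: "\<omega> \<in> space M"
      have "0 \<le> fluid_sum q \<omega> $ j" for j
        unfolding sum_component vector_scaleR_component
        using X_in[OF V01 w] strict[of _ "Suc q"] S_nonneg by (intro sum_nonneg mult_nonneg_nonneg) (auto simp: less_imp_le)
      then have "0 \<le> (\<Sum>j\<in>UNIV. s j * (r *\<^sub>R fluid_sum q \<omega>) $ j)"
        unfolding vector_scaleR_component real_scaleR_def using s_nonneg r by (intro sum_nonneg mult_nonneg_nonneg)
      then show "norm (of_bool (X a \<omega> = x) * exp (- (\<Sum>j\<in>UNIV. s j * (r *\<^sub>R fluid_sum q \<omega>) $ j)) * of_bool (X 1 \<omega> = y)) \<le> 1"
        by (simp add: of_bool_def)
    qed
    show "(\<lambda>\<omega>. of_bool (X a \<omega> = x) * exp (- (\<Sum>j\<in>UNIV. s j * (r *\<^sub>R fluid_sum q \<omega>) $ j)) * of_bool (X 1 \<omega> = y)) \<in> borel_measurable M"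
      by (intro borel_measurable_times borel_measurable_exp_compose borel_measurable_uminus borel_measurable_sum
        borel_measurable_vec_nth borel_measurable_scaleR Rm) measurable
  qed (measurable)
  then show ?thesis
    unfolding partition_expectation[OF assms(1,2), symmetric] eq .
qed

section \<open>The jump integrals along partitions\<close>

lemma jump_limit:
  assumes w: "\<omega> \<in> space M"
  shows "(\<lambda>q. jump_sum q j \<omega>)
    \<longlonglongrightarrow> jump_integral a 1 (\<lambda>v. X v \<omega> $ j) (\<lambda>v. \<nu> j v \<omega>)"
proof (rule jump_sum_tendsto[OF a_nonneg])
  show "((\<lambda>v. X v \<omega> $ j) \<longlongrightarrow> X v \<omega> $ j) (at_right v)" if "a \<le> v" "v < 1" for v
    using that a_nonneg by (intro tendsto_vec_nth X_right w) auto
qed (use \<nu>[of j] w in \<open>auto simp: poisson_process_def\<close>)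

lemma \<nu>_V_meas: "l \<le> Suc q \<Longrightarrow> \<nu> j (U q l) \<in> measurable M (count_space UNIV)"
  using \<nu>[of j] V01[of l q] by (simp add: poisson_process_def)

lemma jump_sum_measurable:
  "(\<lambda>\<omega>. jump_sum q j \<omega>) \<in> borel_measurable M"
proof (intro borel_measurable_sum borel_measurable_times borel_measurable_vec_nth)
  fix l assume l: "l \<in> {..<Suc q}"
  have "\<nu> j (U q l) \<in> measurable M (count_space UNIV)" "\<nu> j (U q (Suc l)) \<in> measurable M (count_space UNIV)"
    using l by (auto intro: \<nu>_V_meas)
  then show "(\<lambda>\<omega>. of_bool (\<nu> j (U q l) \<omega> < \<nu> j (U q (Suc l)) \<omega>) :: real) \<in> borel_measurable M"
    by (rule borel_measurable_of_bool_less)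
  show "X (U q (Suc l)) \<in> borel_measurable M" using l by (intro X_V_meas) auto
qed

lemma jump_measurable: "(\<lambda>\<omega>. jump_integral a 1 (\<lambda>v. X v \<omega> $ j) (\<lambda>v. \<nu> j v \<omega>)) \<in> borel_measurable M"
  by (rule borel_measurable_LIMSEQ_metric[OF jump_sum_measurable jump_limit])

lemma jump_nonneg: "\<omega> \<in> space M \<Longrightarrow> 0 \<le> jump_integral a 1 (\<lambda>v. X v \<omega> $ j) (\<lambda>v. \<nu> j v \<omega>)"
  unfolding jump_integral_def using X_in S_nonneg a_nonneg by (intro sum_nonneg) auto

text \<open>Laplace transform of the contribution of one cell when the chain is in \<open>y\<close>
  at its upper end: the coordinates jump independently, each with the probability that a Poisson
  count is positive.\<close>

definition jump_factor :: "nat \<Rightarrow> nat \<Rightarrow> real ^ 'k \<Rightarrow> real" where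
  "jump_factor q l y = (\<Prod>j\<in>UNIV. 1 - (1 - exp (- (s j * y $ j))) * (1 - exp (- (lam / (1 - \<alpha>) * (V q (Suc l) - V q l)))))"

lemma expectation_jumps:
  "expectation (\<lambda>\<omega>. exp (- (s j * (\<Sum>l<Suc q. c l * of_bool (\<nu> j (U q l) \<omega> < \<nu> j (U q (Suc l)) \<omega>)))))
    = (\<Prod>l<Suc q. 1 - (1 - exp (- (s j * c l))) * (1 - exp (- (lam / (1 - \<alpha>) * (U q (Suc l) - U q l)))))"
  if c: "\<And>l. l < Suc q \<Longrightarrow> 0 \<le> c l"
proof -
  let ?D = "\<lambda>l \<omega>. \<nu> j (U q (Suc l)) \<omega> - \<nu> j (U q l) \<omega>"
  let ?h = "\<lambda>l d. exp (- (s j * c l * of_bool (0 < (d::nat))))"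
  have ind: "indep_vars (\<lambda>_. count_space UNIV) ?D {..<Suc q}"
  proof -
    have *: "(\<forall>i\<le>m. u i \<in> {0..1}) \<and> (\<forall>i<m. u i \<le> u (Suc i)) \<longrightarrow>
        indep_vars (\<lambda>_. count_space UNIV) (\<lambda>i \<omega>. \<nu> j (u (Suc i)) \<omega> - \<nu> j (u i) \<omega>) {..<m}" for m u
      using \<nu>[of j] by (simp add: poisson_process_def)
    show ?thesis by (rule *[rule_format]) (use V01[of _ q] strict[of _ "Suc q"] in \<open>auto simp: less_imp_le\<close>)
  qed
  have "(\<lambda>\<omega>. exp (- (s j * (\<Sum>l<Suc q. c l * of_bool (\<nu> j (U q l) \<omega> < \<nu> j (U q (Suc l)) \<omega>)))))
    = (\<lambda>\<omega>. \<Prod>l<Suc q. ?h l (?D l \<omega>))"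
    by (simp only: exp_sum[symmetric, OF finite_lessThan] sum_negf sum_distrib_left zero_less_diff mult.assoc)
  then have "expectation (\<lambda>\<omega>. exp (- (s j * (\<Sum>l<Suc q. c l * of_bool (\<nu> j (U q l) \<omega> < \<nu> j (U q (Suc l)) \<omega>)))))
    = expectation (\<lambda>\<omega>. \<Prod>l<Suc q. ?h l (?D l \<omega>))" by simp
  also have "\<dots> = (\<Prod>l<Suc q. expectation (\<lambda>\<omega>. ?h l (?D l \<omega>)))"
  proof (rule indep_vars_lebesgue_integral)
    show "indep_vars (\<lambda>_. borel) (\<lambda>l \<omega>. ?h l (?D l \<omega>)) {..<Suc q}"
      by (rule indep_vars_compose2[OF ind]) simp
    show "integrable M (\<lambda>\<omega>. ?h l (?D l \<omega>))" if "l \<in> {..<Suc q}" for l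
    proof (rule integrable_const_bound[where B=1])
      have [measurable]: "\<nu> j (U q l) \<in> measurable M (count_space UNIV)" "\<nu> j (U q (Suc l)) \<in> measurable M (count_space UNIV)"
        using that by (auto intro: \<nu>_V_meas)
      show "(\<lambda>\<omega>. ?h l (?D l \<omega>)) \<in> borel_measurable M" by measurable
      show "AE \<omega> in M. norm (?h l (?D l \<omega>)) \<le> 1" using s_nonneg[of j] c[of l] that by (auto simp: of_bool_def)
    qed
  qed simp
  also have "\<dots> = (\<Prod>l<Suc q. 1 - (1 - exp (- (s j * c l))) * (1 - exp (- (lam / (1 - \<alpha>) * (U q (Suc l) - U q l)))))"
  proof (rule prod.cong[OF refl])
    fix l assume l: "l \<in> {..<Suc q}"
    have [measurable]: "\<nu> j (U q l) \<in> measurable M (count_space UNIV)" "\<nu> j (U q (Suc l)) \<in> measurable M (count_space UNIV)"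
      using l by (auto intro: \<nu>_V_meas)
    have lt: "U q l < U q (Suc l)" using l strict by simp
    have "expectation (\<lambda>\<omega>. ?h l (?D l \<omega>)) = integral\<^sup>L (distr M (count_space UNIV) (?D l)) (?h l)"
      by (subst integral_distr) auto
    also have "distr M (count_space UNIV) (?D l) = measure_pmf (poisson_pmf (lam / (1 - \<alpha>) * (U q (Suc l) - U q l)))"
      using \<nu>[of j] V01[of l q] V01[of "Suc l" q] l lt unfolding poisson_process_def by auto
    also have "integral\<^sup>L \<dots> (?h l) = 1 - (1 - exp (- (s j * c l))) * (1 - exp (- (lam / (1 - \<alpha>) * (U q (Suc l) - U q l))))"
      using lt par by (intro poisson_transform_positive) auto
    finally show "expectation (\<lambda>\<omega>. ?h l (?D l \<omega>)) = 1 - (1 - exp (- (s j * c l))) * (1 - exp (- (lam / (1 - \<alpha>) * (U q (Suc l) - U q l))))" .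
  qed
  finally show ?thesis .
qed

text \<open>With the chain frozen at the partition points, the Poisson processes are independent of
  it and of each other, so their transforms multiply; exchanging the products over coordinates and
  cells collects one weight per cell.\<close>

lemma expectation_jump_sum:
  assumes "x \<in> S" "y \<in> S"
  shows "expectation (\<lambda>\<omega>. of_bool (X a \<omega> = x) * exp (- (\<Sum>j\<in>UNIV. s j * jump_sum q j \<omega>)) * of_bool (X 1 \<omega> = y))
    = prob {\<omega> \<in> space M. X a \<omega> = x} *
      path_weight S (\<lambda>l z y. p (U q l) (U q (Suc l)) z y * jump_factor (Suc q) l y) x (Suc q) y"
proof -
  define T where "T = PiE {..Suc q} (\<lambda>_. S)"
  have T: "finite T" unfolding T_def using finS by (intro finite_PiE) auto
  define E where "E u = {\<omega> \<in> space M. \<forall>i\<le>Suc q. X (U q i) \<omega> = u i}" for u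
  have GX: "X v \<in> measurable (sigma (space M) (generated_events M borel X {0..1})) borel" if "v \<in> {0..1}" for v
    using that by (intro measurable_generated_events) auto
  have G\<nu>: "\<nu> j v \<in> measurable (sigma (space M) (generated_events M (count_space UNIV) (\<nu> j) {0..1})) (count_space UNIV)"
    if "v \<in> {0..1}" for j v
    using that by (intro measurable_generated_events) auto
  have Eg: "E u \<in> generated_events M borel X {0..1}" for u
  proof -
    have [measurable]: "X (U q i) \<in> measurable (sigma (space M) (generated_events M borel X {0..1})) borel" if "i \<in> {..Suc q}" for i
      using that V01 by (intro GX) auto
    have "{\<omega> \<in> space (sigma (space M) (generated_events M borel X {0..1})). \<forall>i\<in>{..Suc q}. X (U q i) \<omega> = u i}
      \<in> sets (sigma (space M) (generated_events M borel X {0..1}))"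
      by measurable
    moreover have "E u = {\<omega> \<in> space M. \<forall>i\<in>{..Suc q}. X (U q i) \<omega> = u i}"
      by (auto simp: E_def)
    ultimately show ?thesis unfolding sets_generated_events by (simp only: space_measure_of_conv)
  qed
  have "generated_events M borel X {0..1} \<subseteq> events"
    using indep unfolding indep_sets_def by (metis (no_types, lifting) UNIV_I option.simps(4))
  then have Ev: "E u \<in> events" for u using Eg by auto
  define g where "g \<zeta> j \<omega> = exp (- (s j * (\<Sum>l<Suc q. \<zeta> (Suc l) $ j * of_bool (\<nu> j (U q l) \<omega> < \<nu> j (U q (Suc l)) \<omega>))))"
    for \<zeta> :: "nat \<Rightarrow> real ^ 'k" and j \<omega>
  have gb: "0 \<le> g \<zeta> j \<omega>" "g \<zeta> j \<omega> \<le> 1" if "\<zeta> \<in> T" for \<zeta> j \<omega>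
    using that s_nonneg S_nonneg by (auto simp: g_def T_def PiE_iff intro!: sum_nonneg mult_nonneg_nonneg simp del: sum.lessThan_Suc)
  have gg: "g \<zeta> j \<in> borel_measurable (sigma (space M) (generated_events M (count_space UNIV) (\<nu> j) {0..1}))" for \<zeta> j
    unfolding g_def
  proof (intro borel_measurable_exp_compose borel_measurable_uminus borel_measurable_times borel_measurable_sum borel_measurable_const)
    fix l assume l: "l \<in> {..<Suc q}"
    have "\<nu> j (U q l) \<in> measurable (sigma (space M) (generated_events M (count_space UNIV) (\<nu> j) {0..1})) (count_space UNIV)"
      "\<nu> j (U q (Suc l)) \<in> measurable (sigma (space M) (generated_events M (count_space UNIV) (\<nu> j) {0..1})) (count_space UNIV)"
      using l V01 by (auto intro!: G\<nu>)
    then show "(\<lambda>\<omega>. of_bool (\<nu> j (U q l) \<omega> < \<nu> j (U q (Suc l)) \<omega>) :: real) \<in> borel_measurable (sigma (space M) (generated_events M (count_space UNIV) (\<nu> j) {0..1}))"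
      by (rule borel_measurable_of_bool_less)
  qed
  have gm: "g \<zeta> j \<in> borel_measurable M" for \<zeta> j
    unfolding g_def
  proof (intro borel_measurable_exp_compose borel_measurable_uminus borel_measurable_times borel_measurable_sum borel_measurable_const)
    fix l assume l: "l \<in> {..<Suc q}"
    have "\<nu> j (U q l) \<in> measurable M (count_space UNIV)" "\<nu> j (U q (Suc l)) \<in> measurable M (count_space UNIV)"
      using l by (auto intro: \<nu>_V_meas)
    then show "(\<lambda>\<omega>. of_bool (\<nu> j (U q l) \<omega> < \<nu> j (U q (Suc l)) \<omega>) :: real) \<in> borel_measurable M" by (rule borel_measurable_of_bool_less)
  qed
  have prodE: "expectation (\<lambda>\<omega>. indicator (E \<zeta>) \<omega> * (\<Prod>j\<in>UNIV. g \<zeta> j \<omega>)) = prob (E \<zeta>) * (\<Prod>j\<in>UNIV. expectation (g \<zeta> j))"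
    if \<zeta>: "\<zeta> \<in> T" for \<zeta>
  proof -
    define Y where "Y = case_option (indicator (E \<zeta>)) (g \<zeta>)"
    have split: "(\<Prod>m\<in>UNIV. h m) = h None * (\<Prod>j\<in>UNIV. h (Some j))" for h :: "'k option \<Rightarrow> real"
      by (simp add: UNIV_option_conv prod.reindex)
    have "expectation (\<lambda>\<omega>. \<Prod>m\<in>UNIV. Y m \<omega>) = (\<Prod>m\<in>UNIV. expectation (Y m))"
    proof (rule indep_sets_expectation_prod[OF _ indep])
      fix m :: "'k option" and B :: "real set" assume B: "B \<in> sets borel"
      show "Y m -` B \<inter> space M \<in> (case m of
                  None \<Rightarrow> generated_events M borel X {0..1}
                | Some j \<Rightarrow> generated_events M (count_space UNIV) (\<nu> j) {0..1})"
      proof (cases m)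
        case None
        have "indicator (E \<zeta>) \<in> borel_measurable (sigma (space M) (generated_events M borel X {0..1}))"
          using Eg by (intro borel_measurable_indicator) simp
        from generated_events_measurableD[OF this B] show ?thesis by (simp add: None Y_def)
      next
        case (Some j)
        from generated_events_measurableD[OF gg B] show ?thesis by (simp add: Some Y_def)
      qed
    qed (use gb[OF \<zeta>] in \<open>auto simp: Y_def indicator_def split: option.split\<close>)
    then show ?thesis using Ev by (simp add: split Y_def Int_absorb1 sets.sets_into_space)
  qed
  have "expectation (\<lambda>\<omega>. of_bool (X a \<omega> = x) * exp (- (\<Sum>j\<in>UNIV. s j * jump_sum q j \<omega>)) * of_bool (X 1 \<omega> = y))
    = expectation (\<lambda>\<omega>. \<Sum>\<zeta>\<in>T. (of_bool (\<zeta> 0 = x) * of_bool (\<zeta> (Suc q) = y)) * (indicator (E \<zeta>) \<omega> * (\<Prod>j\<in>UNIV. g \<zeta> j \<omega>)))"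
  proof (rule Bochner_Integration.integral_cong[OF refl])
    fix \<omega> assume w: "\<omega> \<in> space M"
    let ?u = "restrict (\<lambda>i. X (U q i) \<omega>) {..Suc q}"
    have "(\<Sum>\<zeta>\<in>T. (of_bool (\<zeta> 0 = x) * of_bool (\<zeta> (Suc q) = y)) * (indicator (E \<zeta>) \<omega> * (\<Prod>j\<in>UNIV. g \<zeta> j \<omega>)))
      = (\<Sum>\<zeta>\<in>T. (of_bool (\<zeta> 0 = x) * of_bool (\<zeta> (Suc q) = y) * (\<Prod>j\<in>UNIV. g \<zeta> j \<omega>)) * of_bool (\<forall>i\<le>Suc q. X (U q i) \<omega> = \<zeta> i))"
      using w by (intro sum.cong) (auto simp: E_def indicator_def)
    also have "\<dots> = of_bool (?u 0 = x) * of_bool (?u (Suc q) = y) * (\<Prod>j\<in>UNIV. g ?u j \<omega>)"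
      unfolding T_def using X_in[OF V01 w] finS by (intro path_indicator_sum) auto
    also have "(\<Prod>j\<in>UNIV. g ?u j \<omega>) = exp (- (\<Sum>j\<in>UNIV. s j * jump_sum q j \<omega>))"
    proof -
      have "(\<Sum>l<Suc q. ?u (Suc l) $ j * of_bool (\<nu> j (U q l) \<omega> < \<nu> j (U q (Suc l)) \<omega>))
        = jump_sum q j \<omega>" for j
        by (intro sum.cong) auto
      then show ?thesis unfolding g_def by (simp only: exp_sum[symmetric, OF finite] sum_negf)
    qed
    finally show "of_bool (X a \<omega> = x) * exp (- (\<Sum>j\<in>UNIV. s j * jump_sum q j \<omega>)) * of_bool (X 1 \<omega> = y)
      = (\<Sum>\<zeta>\<in>T. (of_bool (\<zeta> 0 = x) * of_bool (\<zeta> (Suc q) = y)) * (indicator (E \<zeta>) \<omega> * (\<Prod>j\<in>UNIV. g \<zeta> j \<omega>)))"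
      by (simp add: start finish mult_ac del: sum.lessThan_Suc)
  qed
  also have "\<dots> = (\<Sum>\<zeta>\<in>T. (of_bool (\<zeta> 0 = x) * of_bool (\<zeta> (Suc q) = y)) * (prob (E \<zeta>) * (\<Prod>j\<in>UNIV. expectation (g \<zeta> j))))"
  proof (subst Bochner_Integration.integral_sum)
    fix \<zeta> assume \<zeta>: "\<zeta> \<in> T"
    have "integrable M (\<lambda>\<omega>. indicator (E \<zeta>) \<omega> * (\<Prod>j\<in>UNIV. g \<zeta> j \<omega>))"
    proof (rule integrable_const_bound[where B=1])
      have "\<bar>\<Prod>j\<in>UNIV. g \<zeta> j \<omega>\<bar> \<le> 1" for \<omega>
        unfolding abs_prod using gb[OF \<zeta>] by (intro prod_le_1) auto
      then show "AE \<omega> in M. norm (indicator (E \<zeta>) \<omega> * (\<Prod>j\<in>UNIV. g \<zeta> j \<omega>)) \<le> 1"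
        by (auto simp: indicator_def)
      show "(\<lambda>\<omega>. indicator (E \<zeta>) \<omega> * (\<Prod>j\<in>UNIV. g \<zeta> j \<omega>)) \<in> borel_measurable M"
        by (intro borel_measurable_times borel_measurable_prod gm borel_measurable_indicator Ev)
    qed
    then show "integrable M (\<lambda>\<omega>. (of_bool (\<zeta> 0 = x) * of_bool (\<zeta> (Suc q) = y)) * (indicator (E \<zeta>) \<omega> * (\<Prod>j\<in>UNIV. g \<zeta> j \<omega>)))"
      by (rule integrable_mult_right)
  qed (auto simp: prodE intro!: sum.cong)
  also have "\<dots> = (\<Sum>\<zeta>\<in>T. of_bool (\<zeta> 0 = x) * (\<Prod>l<Suc q. jump_factor (Suc q) l (\<zeta> (Suc l))) * of_bool (\<zeta> (Suc q) = y) * prob (E \<zeta>))"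
  proof (intro sum.cong refl)
    fix \<zeta> assume \<zeta>: "\<zeta> \<in> T"
    let ?e = "\<lambda>l. 1 - exp (- (lam / (1 - \<alpha>) * (U q (Suc l) - U q l)))"
    have "expectation (g \<zeta> j) = (\<Prod>l<Suc q. 1 - (1 - exp (- (s j * \<zeta> (Suc l) $ j))) * ?e l)" for j
      unfolding g_def using \<zeta> S_nonneg by (intro expectation_jumps) (auto simp: T_def PiE_iff)
    then have "(\<Prod>j\<in>UNIV. expectation (g \<zeta> j)) = (\<Prod>l<Suc q. jump_factor (Suc q) l (\<zeta> (Suc l)))"
      unfolding jump_factor_def by (simp only: prod.swap[of _ "{..<Suc q}"])
    then show "(of_bool (\<zeta> 0 = x) * of_bool (\<zeta> (Suc q) = y)) * (prob (E \<zeta>) * (\<Prod>j\<in>UNIV. expectation (g \<zeta> j)))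
      = of_bool (\<zeta> 0 = x) * (\<Prod>l<Suc q. jump_factor (Suc q) l (\<zeta> (Suc l))) * of_bool (\<zeta> (Suc q) = y) * prob (E \<zeta>)"
      by (simp only: mult_ac)
  qed
  \<comment> \<open>With the Poisson processes averaged out, the sum over paths is again an
    expectation over the chain alone.\<close>
  also have "\<dots> = expectation (\<lambda>\<omega>. \<Sum>\<zeta>\<in>T. of_bool (\<zeta> 0 = x) * (\<Prod>l<Suc q. jump_factor (Suc q) l (\<zeta> (Suc l))) * of_bool (\<zeta> (Suc q) = y) * indicator (E \<zeta>) \<omega>)"
    using Ev by (subst Bochner_Integration.integral_sum)
      (auto intro!: integrable_real_indicator simp: less_top[symmetric] Int_absorb1 sets.sets_into_space simp del: prod.lessThan_Suc)
  also have "\<dots> = expectation (\<lambda>\<omega>. of_bool (X a \<omega> = x) * (\<Prod>l<Suc q. jump_factor (Suc q) l (X (U q (Suc l)) \<omega>)) * of_bool (X 1 \<omega> = y))"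
  proof (rule Bochner_Integration.integral_cong[OF refl])
    fix \<omega> assume w: "\<omega> \<in> space M"
    let ?u = "restrict (\<lambda>i. X (U q i) \<omega>) {..Suc q}"
    have "(\<Sum>\<zeta>\<in>T. of_bool (\<zeta> 0 = x) * (\<Prod>l<Suc q. jump_factor (Suc q) l (\<zeta> (Suc l))) * of_bool (\<zeta> (Suc q) = y) * indicator (E \<zeta>) \<omega>)
      = (\<Sum>\<zeta>\<in>T. of_bool (\<zeta> 0 = x) * (\<Prod>l<Suc q. jump_factor (Suc q) l (\<zeta> (Suc l))) * of_bool (\<zeta> (Suc q) = y) * of_bool (\<forall>i\<le>Suc q. X (U q i) \<omega> = \<zeta> i))"
      using w by (intro sum.cong) (auto simp: E_def indicator_def simp del: prod.lessThan_Suc)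
    also have "\<dots> = of_bool (?u 0 = x) * (\<Prod>l<Suc q. jump_factor (Suc q) l (?u (Suc l))) * of_bool (?u (Suc q) = y)"
      unfolding T_def using X_in[OF V01 w] finS by (intro path_indicator_sum) auto
    also have "(\<Prod>l<Suc q. jump_factor (Suc q) l (?u (Suc l))) = (\<Prod>l<Suc q. jump_factor (Suc q) l (X (U q (Suc l)) \<omega>))"
      by (intro prod.cong) auto
    finally show "(\<Sum>\<zeta>\<in>T. of_bool (\<zeta> 0 = x) * (\<Prod>l<Suc q. jump_factor (Suc q) l (\<zeta> (Suc l))) * of_bool (\<zeta> (Suc q) = y) * indicator (E \<zeta>) \<omega>)
      = of_bool (X a \<omega> = x) * (\<Prod>l<Suc q. jump_factor (Suc q) l (X (U q (Suc l)) \<omega>)) * of_bool (X 1 \<omega> = y)"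
      by (simp add: start finish del: prod.lessThan_Suc)
  qed
  also have "\<dots> = prob {\<omega> \<in> space M. X a \<omega> = x} *
      path_weight S (\<lambda>l z y. p (U q l) (U q (Suc l)) z y * jump_factor (Suc q) l y) x (Suc q) y"
    by (rule partition_expectation[OF assms])
  finally show ?thesis .
qed

lemma jump_transform:
  assumes "x \<in> S" "y \<in> S"
  shows "(\<lambda>q. prob {\<omega> \<in> space M. X a \<omega> = x} *
      path_weight S (\<lambda>l z y. p (U q l) (U q (Suc l)) z y * jump_factor (Suc q) l y) x (Suc q) y)
    \<longlonglongrightarrow> expectation (\<lambda>\<omega>. of_bool (X a \<omega> = x) * exp (- (\<Sum>j\<in>UNIV. s j *
        jump_integral a 1 (\<lambda>v. X v \<omega> $ j) (\<lambda>v. \<nu> j v \<omega>))) * of_bool (X 1 \<omega> = y))"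
  unfolding expectation_jump_sum[OF assms, symmetric]
proof (rule integral_dominated_convergence[where w="\<lambda>_. 1"])
  have [measurable]: "X a \<in> borel_measurable M" "X 1 \<in> borel_measurable M"
    using a_nonneg a_le_1 by (auto intro: X_meas)
  have [measurable]: "(\<lambda>\<omega>. \<Sum>j\<in>UNIV. s j * jump_integral a 1 (\<lambda>v. X v \<omega> $ j) (\<lambda>v. \<nu> j v \<omega>)) \<in> borel_measurable M"
    by (rule borel_measurable_sum, rule borel_measurable_times[OF borel_measurable_const jump_measurable])
  show "(\<lambda>\<omega>. of_bool (X a \<omega> = x) * exp (- (\<Sum>j\<in>UNIV. s j *
        jump_integral a 1 (\<lambda>v. X v \<omega> $ j) (\<lambda>v. \<nu> j v \<omega>))) * of_bool (X 1 \<omega> = y)) \<in> borel_measurable M" by measurable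
  show "AE \<omega> in M. (\<lambda>q. of_bool (X a \<omega> = x) * exp (- (\<Sum>j\<in>UNIV. s j * jump_sum q j \<omega>)) * of_bool (X 1 \<omega> = y))
    \<longlonglongrightarrow> of_bool (X a \<omega> = x) * exp (- (\<Sum>j\<in>UNIV. s j *
        jump_integral a 1 (\<lambda>v. X v \<omega> $ j) (\<lambda>v. \<nu> j v \<omega>))) * of_bool (X 1 \<omega> = y)"
    by (intro AE_I2 tendsto_mult tendsto_const tendsto_exp tendsto_minus tendsto_sum jump_limit)
  fix q
  have [measurable]: "(\<lambda>\<omega>. \<Sum>j\<in>UNIV. s j * jump_sum q j \<omega>) \<in> borel_measurable M"
    by (rule borel_measurable_sum, rule borel_measurable_times[OF borel_measurable_const jump_sum_measurable])
  show "(\<lambda>\<omega>. of_bool (X a \<omega> = x) * exp (- (\<Sum>j\<in>UNIV. s j * jump_sum q j \<omega>)) * of_bool (X 1 \<omega> = y)) \<in> borel_measurable M"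
    by measurable
  show "AE \<omega> in M. norm (of_bool (X a \<omega> = x) * exp (- (\<Sum>j\<in>UNIV. s j * jump_sum q j \<omega>)) * of_bool (X 1 \<omega> = y)) \<le> 1"
  proof (rule AE_I2)
    fix \<omega> assume w: "\<omega> \<in> space M"
    have "0 \<le> (\<Sum>j\<in>UNIV. s j * jump_sum q j \<omega>)"
      using X_in[OF V01 w] S_nonneg s_nonneg by (intro sum_nonneg mult_nonneg_nonneg) auto
    then show "norm (of_bool (X a \<omega> = x) * exp (- (\<Sum>j\<in>UNIV. s j * jump_sum q j \<omega>)) * of_bool (X 1 \<omega> = y)) \<le> 1"
      by (simp add: of_bool_def del: sum.lessThan_Suc)
  qed
qed simp

end

section \<open>Tail asymptotics and Riemann sums\<close>

text \<open>The first bound is the union bound; the second uses \<open>1 - x \<le> exp (- x)\<close>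
  and the quadratic bound on the exponential.\<close>

lemma prod_one_minus_bounds:
  fixes x :: "'i \<Rightarrow> real"
  assumes "finite I" "\<And>i. i \<in> I \<Longrightarrow> 0 \<le> x i" "\<And>i. i \<in> I \<Longrightarrow> x i \<le> 1"
  shows "1 - (\<Sum>i\<in>I. x i) \<le> (\<Prod>i\<in>I. 1 - x i)"
    and "(\<Prod>i\<in>I. 1 - x i) \<le> 1 - (\<Sum>i\<in>I. x i) + (\<Sum>i\<in>I. x i)\<^sup>2"
proof -
  show "1 - (\<Sum>i\<in>I. x i) \<le> (\<Prod>i\<in>I. 1 - x i)"
    using assms
  proof (induction I rule: finite_induct)
    case (insert i I)
    have p: "0 \<le> (\<Prod>i\<in>I. 1 - x i)" "(\<Prod>i\<in>I. 1 - x i) \<le> 1"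
      using insert by (auto intro!: prod_nonneg prod_le_1)
    then have "x i * (\<Prod>i\<in>I. 1 - x i) \<le> x i" using insert.prems by (simp add: mult_left_le)
    then show ?case using insert by (simp add: algebra_simps)
  qed simp
  have "(\<Prod>i\<in>I. 1 - x i) \<le> (\<Prod>i\<in>I. exp (- x i))"
    using assms(2,3) exp_ge_add_one_self[of "- x _"] by (intro prod_mono) auto
  also have "\<dots> = exp (- (\<Sum>i\<in>I. x i))" using assms(1) by (simp add: exp_sum[symmetric] sum_negf)
  also have "\<dots> \<le> 1 - (\<Sum>i\<in>I. x i) + (\<Sum>i\<in>I. x i)\<^sup>2"
    using assms(2) by (intro exp_minus_le_quadratic sum_nonneg) auto
  finally show "(\<Prod>i\<in>I. 1 - x i) \<le> 1 - (\<Sum>i\<in>I. x i) + (\<Sum>i\<in>I. x i)\<^sup>2" .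
qed

section \<open>Cell sums of a monotone function against integrals of a power\<close>

lemma integrable_antimono:
  fixes f :: "real \<Rightarrow> real"
  assumes "\<And>x y. a \<le> x \<Longrightarrow> x \<le> y \<Longrightarrow> y \<le> b \<Longrightarrow> f y \<le> f x"
  shows "f integrable_on {a..b}"
proof -
  have "(\<lambda>x. - f x) integrable_on {a..b}"
    by (rule integrable_on_mono_on) (auto intro!: mono_onI assms)
  then show ?thesis using integrable_neg by fastforce
qed

lemma powr_cell_integral:
  fixes x y \<alpha> :: real
  assumes "0 \<le> x" "x \<le> y" "\<alpha> < 1"
  shows "integral {x..y} (\<lambda>r. r powr (- \<alpha>)) = (y powr (1 - \<alpha>) - x powr (1 - \<alpha>)) / (1 - \<alpha>)"
proof -
  have i: "((\<lambda>r. r powr (- \<alpha>)) has_integral (c powr (1 - \<alpha>) / (1 - \<alpha>))) {0..c}" if "0 \<le> c" for c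
    using has_integral_powr_from_0[of "- \<alpha>" c] that assms by (simp add: add.commute)
  have "integral {0..x} (\<lambda>r. r powr (- \<alpha>)) + integral {x..y} (\<lambda>r. r powr (- \<alpha>)) = integral {0..y} (\<lambda>r. r powr (- \<alpha>))"
    using i[of y] assms by (intro Henstock_Kurzweil_Integration.integral_combine) (auto simp: integrable_on_def)
  then show ?thesis using integral_unique[OF i[of x]] integral_unique[OF i[of y]] assms
    by (simp add: diff_divide_distrib)
qed

lemma antimono_abs_integrable:
  fixes f :: "real \<Rightarrow> real"
  assumes f: "\<And>x y. 0 \<le> x \<Longrightarrow> x \<le> y \<Longrightarrow> y \<le> t \<Longrightarrow> f y \<le> f x" "\<And>x. 0 \<le> f x"
    and t: "0 \<le> t" and \<alpha>: "\<alpha> < 1" and h: "0 \<le> h"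
  shows "(\<lambda>r. f r - h * r powr (- \<alpha>)) absolutely_integrable_on {0..t}"
proof -
  have "f absolutely_integrable_on {0..t}"
    using f by (intro nonnegative_absolutely_integrable_1 integrable_antimono) auto
  moreover have "(\<lambda>r. h * r powr (- \<alpha>)) integrable_on {0..t}"
    using t \<alpha> by (intro integrable_on_mult_right integrable_on_powr_from_0) auto
  then have "(\<lambda>r. h * r powr (- \<alpha>)) absolutely_integrable_on {0..t}"
    using h by (intro nonnegative_absolutely_integrable_1) auto
  ultimately show ?thesis by (rule set_integral_diff)
qed

text \<open>For antitone \<open>f\<close>, the product of \<open>\<delta>\<close> and the value at
  the right end misses the integral over a cell by at most \<open>\<delta>\<close> times the drop of
  \<open>f\<close>, and the drops telescope. The power function enters through its exact cell
  integrals, so its pole at 0 causes no loss.\<close>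

lemma right_endpoint_sums:
  fixes f :: "real \<Rightarrow> real"
  assumes f: "\<And>x y. 0 \<le> x \<Longrightarrow> x \<le> y \<Longrightarrow> y \<le> t \<Longrightarrow> f y \<le> f x" "\<And>x. 0 \<le> f x"
    and t: "0 < t" and q: "0 < q" and \<alpha>: "\<alpha> < 1" and h: "0 \<le> h"
  defines "\<delta> \<equiv> t / real q"
  shows "m \<le> q \<Longrightarrow> (\<Sum>k<m. \<bar>\<delta> * f (\<delta> * real (Suc k)) - h * (((\<delta> * real (Suc k)) powr (1 - \<alpha>) - (\<delta> * real k) powr (1 - \<alpha>)) / (1 - \<alpha>))\<bar>)
      \<le> \<delta> * (f 0 - f (\<delta> * real m)) + integral {0..\<delta> * real m} (\<lambda>r. \<bar>f r - h * r powr (- \<alpha>)\<bar>)"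
    and "m \<le> q \<Longrightarrow> (\<Sum>k<m. \<delta> * f (\<delta> * real (Suc k))) \<le> integral {0..\<delta> * real m} f"
proof -
  have \<delta>: "0 < \<delta>" using t q by (simp add: \<delta>_def)
  have le_t: "\<delta> * real m \<le> t" if "m \<le> q" for m
  proof -
    have "\<delta> * real m \<le> \<delta> * real q" using that \<delta> by (intro mult_left_mono) auto
    then show ?thesis using q by (simp add: \<delta>_def)
  qed
  have f_int: "f integrable_on {x..y}" if "0 \<le> x" "y \<le> t" for x y
    using that by (intro integrable_antimono f) auto
  let ?g = "\<lambda>r. f r - h * r powr (- \<alpha>)"
  have g_abs: "?g absolutely_integrable_on {0..t}" using f t \<alpha> h by (intro antimono_abs_integrable) auto
  have g_int: "?g integrable_on {x..y}" "(\<lambda>r. \<bar>?g r\<bar>) integrable_on {x..y}" if "0 \<le> x" "y \<le> t" for x y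
  proof -
    have "?g absolutely_integrable_on {x..y}"
      by (rule set_integrable_subset[OF g_abs]) (use that in auto)
    then show "?g integrable_on {x..y}" "(\<lambda>r. \<bar>?g r\<bar>) integrable_on {x..y}"
      unfolding absolutely_integrable_on_def by auto
  qed
  have low: "\<delta> * f y \<le> integral {x..y} f" and up: "integral {x..y} f \<le> \<delta> * f x"
    if "0 \<le> x" "y \<le> t" "y = x + \<delta>" for x y
  proof -
    have "integral {x..y} (\<lambda>_. f y) \<le> integral {x..y} f"
      using that \<delta> f by (intro integral_le f_int) auto
    then show "\<delta> * f y \<le> integral {x..y} f" using that \<delta> by simp
    have "integral {x..y} f \<le> integral {x..y} (\<lambda>_. f x)"
      using that \<delta> f by (intro integral_le f_int) auto
    then show "integral {x..y} f \<le> \<delta> * f x" using that \<delta> by simp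
  qed
  show "(\<Sum>k<m. \<bar>\<delta> * f (\<delta> * real (Suc k)) - h * (((\<delta> * real (Suc k)) powr (1 - \<alpha>) - (\<delta> * real k) powr (1 - \<alpha>)) / (1 - \<alpha>))\<bar>)
      \<le> \<delta> * (f 0 - f (\<delta> * real m)) + integral {0..\<delta> * real m} (\<lambda>r. \<bar>f r - h * r powr (- \<alpha>)\<bar>)" if "m \<le> q"
    using that
  proof (induction m)
    case (Suc m)
    define x y where "x = \<delta> * real m" and "y = \<delta> * real (Suc m)"
    have xy: "0 \<le> x" "y \<le> t" "y = x + \<delta>" using \<delta> le_t[OF Suc.prems] by (auto simp: x_def y_def algebra_simps)
    have "integral {x..y} ?g = integral {x..y} f - h * ((y powr (1 - \<alpha>) - x powr (1 - \<alpha>)) / (1 - \<alpha>))"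
    proof -
      have "(\<lambda>r. r powr (- \<alpha>)) integrable_on {x..y}"
        by (rule integrable_on_subinterval[OF integrable_on_powr_from_0[of "-\<alpha>" t]]) (use t \<alpha> xy in auto)
      then show ?thesis
        using xy \<alpha> \<delta> by (subst integral_diff) (auto intro!: f_int integrable_on_mult_right simp: powr_cell_integral)
    qed
    moreover have "\<bar>integral {x..y} ?g\<bar> \<le> integral {x..y} (\<lambda>r. \<bar>?g r\<bar>)"
      using integral_norm_bound_integral[OF g_int, of x y] xy by simp
    ultimately have "\<bar>\<delta> * f y - h * ((y powr (1 - \<alpha>) - x powr (1 - \<alpha>)) / (1 - \<alpha>))\<bar>
      \<le> \<delta> * (f x - f y) + integral {x..y} (\<lambda>r. \<bar>?g r\<bar>)"
      using low[OF xy] up[OF xy] unfolding right_diff_distrib[of \<delta>] by linarith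
    moreover have "integral {0..x} (\<lambda>r. \<bar>?g r\<bar>) + integral {x..y} (\<lambda>r. \<bar>?g r\<bar>) = integral {0..y} (\<lambda>r. \<bar>?g r\<bar>)"
      using xy \<delta> by (intro Henstock_Kurzweil_Integration.integral_combine g_int) auto
    ultimately show ?case
      using Suc by (simp add: x_def[symmetric] y_def[symmetric] right_diff_distrib del: of_nat_Suc)
  qed simp
  show "(\<Sum>k<m. \<delta> * f (\<delta> * real (Suc k))) \<le> integral {0..\<delta> * real m} f" if "m \<le> q"
    using that
  proof (induction m)
    case (Suc m)
    define x y where "x = \<delta> * real m" and "y = \<delta> * real (Suc m)"
    have xy: "0 \<le> x" "y \<le> t" "y = x + \<delta>" using \<delta> le_t[OF Suc.prems] by (auto simp: x_def y_def algebra_simps)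
    have "integral {0..x} f + integral {x..y} f = integral {0..y} f"
      using xy \<delta> by (intro Henstock_Kurzweil_Integration.integral_combine f_int) auto
    then show ?case
      using Suc low[OF xy] by (simp add: x_def[symmetric] y_def[symmetric] del: of_nat_Suc)
  qed simp
qed

text \<open>The asymptotics give the constant 2 beyond some \<open>x1\<close>; below
  \<open>x1\<close> the trivial bound 1 is at most
  \<open>x1 powr \<alpha> * x powr (- \<alpha>)\<close>.\<close>

lemma tail_bound:
  fixes F :: "real \<Rightarrow> real"
  assumes F: "\<And>x. 0 \<le> F x" "\<And>x. F x \<le> 1" and lim: "((\<lambda>x. F x * x powr \<alpha>) \<longlongrightarrow> 1) at_top" and \<alpha>: "0 < \<alpha>"
  obtains C where "0 \<le> C" "\<And>x. 0 < x \<Longrightarrow> F x \<le> C * x powr (- \<alpha>)"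
proof -
  have "eventually (\<lambda>x. F x * x powr \<alpha> < 2) at_top" by (rule order_tendstoD(2)[OF lim]) simp
  then obtain x0 where x0: "\<And>x. x \<ge> x0 \<Longrightarrow> F x * x powr \<alpha> < 2" unfolding eventually_at_top_linorder by auto
  define x1 where "x1 = max x0 1"
  have x1: "0 < x1" "\<And>x. x \<ge> x1 \<Longrightarrow> F x * x powr \<alpha> < 2" using x0 by (auto simp: x1_def)
  show ?thesis
  proof (rule that[of "max 2 (x1 powr \<alpha>)"])
    fix x :: real assume x: "0 < x"
    have "F x * x powr \<alpha> \<le> max 2 (x1 powr \<alpha>)"
    proof (cases "x1 \<le> x")
      case True
      then show ?thesis using x1(2)[of x] by simp
    next
      case False
      have "F x * x powr \<alpha> \<le> 1 * x1 powr \<alpha>"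
        using False F x \<alpha> by (intro mult_mono powr_mono2) auto
      then show ?thesis by simp
    qed
    then have "F x * x powr \<alpha> * x powr (- \<alpha>) \<le> max 2 (x1 powr \<alpha>) * x powr (- \<alpha>)"
      by (rule mult_right_mono) simp
    moreover have "F x * x powr \<alpha> * x powr (- \<alpha>) = F x" using x by (simp add: powr_minus field_simps)
    ultimately show "F x \<le> max 2 (x1 powr \<alpha>) * x powr (- \<alpha>)" by simp
  qed simp
qed

text \<open>\<open>w n j\<close> will be \<open>1 - exp (- v)\<close>, with \<open>v\<close> what a
  customer adds to the exponent through coordinate \<open>j\<close>. The conditions concern its
  product with \<open>n powr (\<gamma> - \<alpha>)\<close>, which covers weights that vanish (fast
  arrivals) as well as constant ones (equilibrium).\<close>

locale thinned_tails =
  fixes F :: "'k::finite \<Rightarrow> real \<Rightarrow> real" and w :: "nat \<Rightarrow> 'k \<Rightarrow> real" and C h :: "'k \<Rightarrow> real" and \<alpha> \<gamma> :: real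
  assumes F: "\<And>j x. 0 \<le> F j x" "\<And>j x. F j x \<le> 1" "\<And>j x y. x \<le> y \<Longrightarrow> F j y \<le> F j x"
    and F_lim: "\<And>j. ((\<lambda>x. F j x * x powr \<alpha>) \<longlongrightarrow> 1) at_top"
    and \<alpha>: "0 < \<alpha>" "\<alpha> < 1" and \<gamma>: "0 < \<gamma>"
    and w: "\<And>n j. 0 \<le> w n j" "\<And>n j. w n j \<le> 1" "\<And>n j. 1 \<le> n \<Longrightarrow> real n powr (\<gamma> - \<alpha>) * w n j \<le> C j"
    and w_lim: "\<And>j. (\<lambda>n. real n powr (\<gamma> - \<alpha>) * w n j) \<longlonglongrightarrow> h j"
begin

definition g :: "nat \<Rightarrow> real \<Rightarrow> real" where
  "g n \<rho> = real n powr \<gamma> * (1 - (\<Prod>j\<in>UNIV. 1 - w n j * F j (real n * \<rho>)))"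

lemma wF: "0 \<le> w n j * F j x" "w n j * F j x \<le> 1"
  using w F by (auto intro: mult_le_one)

lemma h_nonneg: "0 \<le> h j"
  by (rule LIMSEQ_le_const[OF w_lim]) (use w in auto)

lemma C_nonneg: "0 \<le> C j"
  using w(3)[of 1 j] w(1)[of 1 j] by simp

lemma g_nonneg: "0 \<le> g n \<rho>"
  unfolding g_def using wF by (intro mult_nonneg_nonneg) (auto intro!: prod_le_1)

lemma g_le: "g n \<rho> \<le> real n powr \<gamma>"
proof -
  have "0 \<le> (\<Prod>j\<in>UNIV. 1 - w n j * F j (real n * \<rho>))" using wF by (intro prod_nonneg) auto
  then show ?thesis unfolding g_def by (intro mult_left_le) auto
qed

lemma g_antimono: "x \<le> y \<Longrightarrow> g n y \<le> g n x"
  unfolding g_def using w(1,2) F wF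
  by (intro mult_left_mono diff_left_mono prod_mono) (auto intro!: mult_left_mono F(3))

lemma scaled_powr: "1 \<le> n \<Longrightarrow> 0 < \<rho> \<Longrightarrow> real n powr \<gamma> * (real n * \<rho>) powr (- \<alpha>) = real n powr (\<gamma> - \<alpha>) * \<rho> powr (- \<alpha>)"
  by (simp add: powr_mult powr_add[symmetric])

text \<open>The domination behind both integral limits. It is uniform in n because \<open>n powr
  \<gamma> * (n * \<rho>) powr (- \<alpha>) = n powr (\<gamma> - \<alpha>) * \<rho> powr (-
  \<alpha>)\<close>.\<close>

lemma g_bound:
  obtains D where "0 \<le> D" "\<And>n \<rho>. 1 \<le> n \<Longrightarrow> 0 < \<rho> \<Longrightarrow> g n \<rho> \<le> D * \<rho> powr (- \<alpha>)"
proof -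
  have "\<forall>j. \<exists>B. 0 \<le> B \<and> (\<forall>x>0. F j x \<le> B * x powr (- \<alpha>))"
    using tail_bound[OF F(1,2) F_lim \<alpha>(1)] by metis
  then obtain B where B: "\<And>j. 0 \<le> B j" "\<And>j x. 0 < x \<Longrightarrow> F j x \<le> B j * x powr (- \<alpha>)" by metis
  show ?thesis
  proof (rule that[of "\<Sum>j\<in>UNIV. C j * B j"])
    show "0 \<le> (\<Sum>j\<in>UNIV. C j * B j)" using B C_nonneg by (intro sum_nonneg) auto
    fix n :: nat and \<rho> :: real assume n: "1 \<le> n" and \<rho>: "0 < \<rho>"
    have "g n \<rho> \<le> real n powr \<gamma> * (\<Sum>j\<in>UNIV. w n j * F j (real n * \<rho>))"
      unfolding g_def using prod_one_minus_bounds(1)[of UNIV "\<lambda>j. w n j * F j (real n * \<rho>)"] wF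
      by (intro mult_left_mono) auto
    also have "\<dots> \<le> real n powr \<gamma> * (\<Sum>j\<in>UNIV. w n j * (B j * (real n * \<rho>) powr (- \<alpha>)))"
      using w B n \<rho> by (intro mult_left_mono sum_mono) auto
    also have "\<dots> = (\<Sum>j\<in>UNIV. (real n powr \<gamma> * (real n * \<rho>) powr (- \<alpha>)) * (w n j * B j))"
      by (simp add: sum_distrib_left mult_ac)
    also have "\<dots> = (\<Sum>j\<in>UNIV. (real n powr (\<gamma> - \<alpha>) * w n j) * B j * \<rho> powr (- \<alpha>))"
      unfolding scaled_powr[OF n \<rho>] by (simp add: mult_ac)
    also have "\<dots> \<le> (\<Sum>j\<in>UNIV. C j * B j * \<rho> powr (- \<alpha>))"
      using w n B by (intro sum_mono mult_right_mono) auto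
    finally show "g n \<rho> \<le> (\<Sum>j\<in>UNIV. C j * B j) * \<rho> powr (- \<alpha>)" by (simp add: sum_distrib_right)
  qed
qed

text \<open>The complement of the product lies between \<open>s - s\<^sup>2\<close> and
  \<open>s\<close>, where \<open>s\<close> is the sum of the thinning probabilities. Since
  \<open>n powr \<gamma> * s\<close> converges and \<open>\<gamma> > 0\<close>, the square
  contributes nothing.\<close>

lemma g_tendsto:
  assumes \<rho>: "0 < \<rho>"
  shows "(\<lambda>n. g n \<rho>) \<longlonglongrightarrow> (\<Sum>j\<in>UNIV. h j) * \<rho> powr (- \<alpha>)"
proof -
  define s where "s n = (\<Sum>j\<in>UNIV. w n j * F j (real n * \<rho>))" for n
  have lim: "(\<lambda>n. real n powr \<gamma> * s n) \<longlonglongrightarrow> (\<Sum>j\<in>UNIV. h j) * \<rho> powr (- \<alpha>)"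
  proof -
    have top: "filterlim (\<lambda>n. real n * \<rho>) at_top sequentially"
      using filterlim_tendsto_pos_mult_at_top[OF tendsto_const \<rho> filterlim_real_sequentially]
      by (simp add: mult.commute)
    have "(\<lambda>n. \<Sum>j\<in>UNIV. (real n powr (\<gamma> - \<alpha>) * w n j) * (F j (real n * \<rho>) * (real n * \<rho>) powr \<alpha>) * \<rho> powr (- \<alpha>))
      \<longlonglongrightarrow> (\<Sum>j\<in>UNIV. h j * 1 * \<rho> powr (- \<alpha>))"
      by (intro tendsto_sum tendsto_mult tendsto_const w_lim filterlim_compose[OF F_lim top])
    moreover have "eventually (\<lambda>n. (\<Sum>j\<in>UNIV. (real n powr (\<gamma> - \<alpha>) * w n j) * (F j (real n * \<rho>) * (real n * \<rho>) powr \<alpha>) * \<rho> powr (- \<alpha>))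
      = real n powr \<gamma> * s n) sequentially"
      using eventually_ge_at_top[of 1]
    proof eventually_elim
      case (elim n)
      have "real n powr (\<gamma> - \<alpha>) * \<rho> powr (- \<alpha>) * (real n * \<rho>) powr \<alpha> = real n powr \<gamma>"
      proof -
        have "real n powr (\<gamma> - \<alpha>) * \<rho> powr (- \<alpha>) * (real n * \<rho>) powr \<alpha>
          = (real n powr (\<gamma> - \<alpha>) * real n powr \<alpha>) * (\<rho> powr (- \<alpha>) * \<rho> powr \<alpha>)"
          using \<rho> by (simp add: powr_mult)
        also have "\<dots> = real n powr \<gamma>" using elim \<rho> by (simp add: powr_add[symmetric])
        finally show ?thesis .
      qed
      moreover have "(real n powr (\<gamma> - \<alpha>) * w n j) * (F j (real n * \<rho>) * (real n * \<rho>) powr \<alpha>) * \<rho> powr (- \<alpha>)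
        = real n powr (\<gamma> - \<alpha>) * \<rho> powr (- \<alpha>) * (real n * \<rho>) powr \<alpha> * (w n j * F j (real n * \<rho>))" for j
        by (simp only: mult_ac)
      ultimately have "(real n powr (\<gamma> - \<alpha>) * w n j) * (F j (real n * \<rho>) * (real n * \<rho>) powr \<alpha>) * \<rho> powr (- \<alpha>)
        = real n powr \<gamma> * (w n j * F j (real n * \<rho>))" for j
        by (simp only:)
      then show ?case unfolding s_def sum_distrib_left by (simp only:)
    qed
    ultimately show ?thesis
      unfolding sum_distrib_right mult_1_right by (rule Lim_transform_eventually)
  qed
  have s0: "s \<longlonglongrightarrow> 0"
  proof -
    have "(\<lambda>n. real n powr (- \<gamma>)) \<longlonglongrightarrow> 0"
      using \<gamma> by (intro tendsto_neg_powr filterlim_real_sequentially) auto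
    from tendsto_mult[OF this lim] have "(\<lambda>n. real n powr (- \<gamma>) * (real n powr \<gamma> * s n)) \<longlonglongrightarrow> 0" by simp
    moreover have "eventually (\<lambda>n. real n powr (- \<gamma>) * (real n powr \<gamma> * s n) = s n) sequentially"
      using eventually_ge_at_top[of 1] by eventually_elim (simp add: powr_minus)
    ultimately show ?thesis by (rule Lim_transform_eventually)
  qed
  have "(\<lambda>n. real n powr \<gamma> * s n - real n powr \<gamma> * s n * s n) \<longlonglongrightarrow> (\<Sum>j\<in>UNIV. h j) * \<rho> powr (- \<alpha>) - (\<Sum>j\<in>UNIV. h j) * \<rho> powr (- \<alpha>) * 0"
    by (intro tendsto_diff tendsto_mult lim s0)
  then have lim2: "(\<lambda>n. real n powr \<gamma> * s n - real n powr \<gamma> * s n * s n) \<longlonglongrightarrow> (\<Sum>j\<in>UNIV. h j) * \<rho> powr (- \<alpha>)" by simp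
  have b: "real n powr \<gamma> * s n - real n powr \<gamma> * s n * s n \<le> g n \<rho>" "g n \<rho> \<le> real n powr \<gamma> * s n" for n
  proof -
    have p: "1 - s n \<le> (\<Prod>j\<in>UNIV. 1 - w n j * F j (real n * \<rho>))" "(\<Prod>j\<in>UNIV. 1 - w n j * F j (real n * \<rho>)) \<le> 1 - s n + (s n)\<^sup>2"
      unfolding s_def by (rule prod_one_minus_bounds; use wF in simp)+
    have "real n powr \<gamma> * (s n - (s n)\<^sup>2) \<le> g n \<rho>" unfolding g_def using p by (intro mult_left_mono) auto
    then show "real n powr \<gamma> * s n - real n powr \<gamma> * s n * s n \<le> g n \<rho>" by (simp add: power2_eq_square algebra_simps)
    show "g n \<rho> \<le> real n powr \<gamma> * s n" unfolding g_def using p by (intro mult_left_mono) auto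
  qed
  show ?thesis
    by (rule tendsto_sandwich[OF _ _ lim2 lim]) (use b in auto)
qed

lemma integral_g_tendsto:
  assumes t: "0 \<le> t"
  shows "(\<lambda>n. integral {0..t} (\<lambda>\<rho>. \<bar>g n \<rho> - (\<Sum>j\<in>UNIV. h j) * \<rho> powr (- \<alpha>)\<bar>)) \<longlonglongrightarrow> 0"
proof -
  let ?H = "\<Sum>j\<in>UNIV. h j"
  have H: "0 \<le> ?H" using h_nonneg by (intro sum_nonneg)
  obtain D where D: "0 \<le> D" "\<And>n \<rho>. 1 \<le> n \<Longrightarrow> 0 < \<rho> \<Longrightarrow> g n \<rho> \<le> D * \<rho> powr (- \<alpha>)"
    using g_bound by blast
  \<comment> \<open>The domination fails at \<rho> = 0, where \<open>0 powr (- \<alpha>)\<close> is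
    0 while \<open>g\<close> may be positive; the integrand is changed on this null set. The shift
    to \<open>Suc k\<close> excludes the index 0, for which no bound is available.\<close>
  let ?f = "\<lambda>k \<rho>. if \<rho> = 0 then 0 else \<bar>g (Suc k) \<rho> - ?H * \<rho> powr (- \<alpha>)\<bar>"
  have eq: "integral {0..t} (?f k) = integral {0..t} (\<lambda>\<rho>. \<bar>g (Suc k) \<rho> - ?H * \<rho> powr (- \<alpha>)\<bar>)" for k
    by (rule integral_spike[of "{0}"]) auto
  have "(\<lambda>k. integral {0..t} (?f k)) \<longlonglongrightarrow> integral {0..t} (\<lambda>_. 0)"
  proof (rule dominated_convergence(2)[where h="\<lambda>\<rho>. (D + ?H) * \<rho> powr (- \<alpha>)"])
    fix k
    have "(\<lambda>\<rho>. \<bar>g (Suc k) \<rho> - ?H * \<rho> powr (- \<alpha>)\<bar>) integrable_on {0..t}"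
      using antimono_abs_integrable[of t "g (Suc k)" \<alpha> ?H] g_antimono g_nonneg t \<alpha> H
      by (simp add: absolutely_integrable_on_def)
    then show "?f k integrable_on {0..t}"
      by (rule integrable_spike[of _ _ "{0}"]) auto
    fix \<rho> assume "\<rho> \<in> {0..t}"
    show "norm (?f k \<rho>) \<le> (D + ?H) * \<rho> powr (- \<alpha>)"
    proof (cases "\<rho> = 0")
      case False
      then have \<rho>: "0 < \<rho>" using \<open>\<rho> \<in> {0..t}\<close> by simp
      have "\<bar>g (Suc k) \<rho> - ?H * \<rho> powr (- \<alpha>)\<bar> \<le> g (Suc k) \<rho> + ?H * \<rho> powr (- \<alpha>)"
        using g_nonneg[of "Suc k" \<rho>] H by (intro order_trans[OF abs_triangle_ineq4]) auto
      also have "\<dots> \<le> (D + ?H) * \<rho> powr (- \<alpha>)" using D(2)[of "Suc k" \<rho>] \<rho> by (simp add: distrib_right)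
      finally show ?thesis using False by simp
    qed simp
  next
    show "(\<lambda>\<rho>. (D + ?H) * \<rho> powr (- \<alpha>)) integrable_on {0..t}"
      using t \<alpha> by (intro integrable_on_mult_right integrable_on_powr_from_0) auto
    fix \<rho> assume \<rho>: "\<rho> \<in> {0..t}"
    show "(\<lambda>k. ?f k \<rho>) \<longlonglongrightarrow> 0"
    proof (cases "\<rho> = 0")
      case False
      then have "(\<lambda>k. g (Suc k) \<rho>) \<longlonglongrightarrow> ?H * \<rho> powr (- \<alpha>)" using \<rho> by (intro LIMSEQ_Suc[OF g_tendsto]) auto
      from tendsto_rabs[OF tendsto_diff[OF this tendsto_const[of "?H * \<rho> powr (- \<alpha>)"]]] show ?thesis using False by simp
    qed simp
  qed
  then show ?thesis unfolding eq by (simp add: LIMSEQ_imp_Suc)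
qed

text \<open>The integrals of \<open>g n\<close> stay bounded. Since
  \<open>1 - \<phi> = n powr (- \<gamma>) * g n\<close>, this accounts for a chain move and a
  successful thinning that fall on the same arrival.\<close>

lemma integral_g_small:
  assumes t: "0 \<le> t"
  shows "(\<lambda>n. real n powr (- \<gamma>) * integral {0..t} (g n)) \<longlonglongrightarrow> 0"
proof -
  obtain D where D: "0 \<le> D" "\<And>n \<rho>. 1 \<le> n \<Longrightarrow> 0 < \<rho> \<Longrightarrow> g n \<rho> \<le> D * \<rho> powr (- \<alpha>)"
    using g_bound by blast
  define B where "B = integral {0..t} (\<lambda>\<rho>. D * \<rho> powr (- \<alpha>))"
  have gi: "g n integrable_on {0..t}" for n by (intro integrable_antimono g_antimono)
  have up: "integral {0..t} (g n) \<le> B" if "1 \<le> n" for n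
  proof -
    have "integral {0..t} (g n) = integral {0..t} (\<lambda>\<rho>. if \<rho> = 0 then 0 else g n \<rho>)"
      by (rule integral_spike[of "{0}"]) auto
    also have "\<dots> \<le> B" unfolding B_def
    proof (rule integral_le)
      show "(\<lambda>\<rho>. if \<rho> = 0 then 0 else g n \<rho>) integrable_on {0..t}"
        by (rule integrable_spike[OF gi, of "{0}"]) auto
      show "(\<lambda>\<rho>. D * \<rho> powr (- \<alpha>)) integrable_on {0..t}"
        using t \<alpha> by (intro integrable_on_mult_right integrable_on_powr_from_0) auto
    qed (use D that in auto)
    finally show ?thesis .
  qed
  have lo: "0 \<le> integral {0..t} (g n)" for n by (intro integral_nonneg gi g_nonneg)
  have "(\<lambda>n. real n powr (- \<gamma>)) \<longlonglongrightarrow> 0"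
    using \<gamma> by (intro tendsto_neg_powr filterlim_real_sequentially) auto
  then have lim: "(\<lambda>n. real n powr (- \<gamma>) * B) \<longlonglongrightarrow> 0" by (rule tendsto_mult_left_zero)
  show ?thesis
  proof (rule tendsto_sandwich[OF _ _ tendsto_const lim])
    show "eventually (\<lambda>n. 0 \<le> real n powr (- \<gamma>) * integral {0..t} (g n)) sequentially"
      using lo by (intro always_eventually allI mult_nonneg_nonneg) auto
    show "eventually (\<lambda>n. real n powr (- \<gamma>) * integral {0..t} (g n) \<le> real n powr (- \<gamma>) * B) sequentially"
      using eventually_ge_at_top[of 1] by eventually_elim (intro mult_left_mono up, auto)
  qed
qed

end

section \<open>Comparison of the two products\<close>

text \<open>Subadditivity of the power: on the unit interval \<open>u \<le> u powr \<beta>\<close>,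
  applied to the fractions \<open>x / (x + d)\<close> and \<open>d / (x + d)\<close>, which sum to
  1.\<close>

lemma powr_increment_le:
  fixes x d \<beta> :: real
  assumes "0 \<le> x" "0 < d" "0 < \<beta>" "\<beta> \<le> 1"
  shows "(x + d) powr \<beta> - x powr \<beta> \<le> d powr \<beta>"
proof -
  have le: "u \<le> u powr \<beta>" if "0 \<le> u" "u \<le> 1" for u :: real
    using powr_mono'[of \<beta> 1 u] that assms by (cases "u = 0") auto
  have s: "0 < x + d" using assms by simp
  have "1 = x / (x + d) + d / (x + d)" using s by (simp add: add_divide_distrib[symmetric])
  also have "\<dots> \<le> (x / (x + d)) powr \<beta> + (d / (x + d)) powr \<beta>"
    using assms by (intro add_mono le) auto
  also have "\<dots> = (x powr \<beta> + d powr \<beta>) / (x + d) powr \<beta>"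
    using assms by (simp add: powr_divide add_divide_distrib)
  finally have "(x + d) powr \<beta> \<le> x powr \<beta> + d powr \<beta>"
    using s by (simp add: le_divide_eq)
  then show ?thesis by simp
qed

definition time_grid :: "real \<Rightarrow> real \<Rightarrow> nat \<Rightarrow> nat \<Rightarrow> real" where
  "time_grid \<alpha> t q l = 1 - (t - t * real l / real q) powr (1 - \<alpha>)"

text \<open>The cells are counted backwards in the remaining time, where the pole sits at 0.\<close>

lemma time_grid_cell:
  assumes "l < q" "0 < q"
  shows "t - t * real l / real q = t / real q * real (Suc (q - Suc l))"
    and "t - t * real (Suc l) / real q = t / real q * real (q - Suc l)"
  using assms by (simp_all add: of_nat_diff diff_divide_distrib add_divide_distrib distrib_left right_diff_distrib)

text \<open>Equal cells in the remaining time have unequal images; subadditivity bounds each image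
  by that of the cell next to the pole, which gives the mesh.\<close>

lemma refining_time_grid:
  assumes t: "0 < t" and \<alpha>: "0 < \<alpha>" "\<alpha> < 1"
  shows "refining_partitions (time_grid \<alpha> t) (1 - t powr (1 - \<alpha>)) (\<lambda>q. (t / real q) powr (1 - \<alpha>))"
proof
  show "time_grid \<alpha> t q 0 = 1 - t powr (1 - \<alpha>)" for q by (simp add: time_grid_def)
  show "0 < q \<Longrightarrow> time_grid \<alpha> t q q = 1" for q by (simp add: time_grid_def)
  fix l q :: nat assume l: "l < q"
  define x where "x = t / real q * real (q - Suc l)"
  have x: "0 \<le> x" using t by (simp add: x_def)
  have "t - t * real l / real q = t / real q * real (Suc (q - Suc l))"
    by (rule time_grid_cell(1)) (use l in auto)
  also have "\<dots> = x + t / real q" unfolding x_def of_nat_Suc distrib_left by simp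
  finally have e1: "t - t * real l / real q = x + t / real q" .
  have e2: "t - t * real (Suc l) / real q = x"
    unfolding x_def by (rule time_grid_cell(2)) (use l in auto)
  note e = e1 e2
  have d: "0 < t / real q" using t l by simp
  show "time_grid \<alpha> t q l < time_grid \<alpha> t q (Suc l)"
    unfolding time_grid_def e using x d \<alpha> by (simp add: powr_less_mono2)
  show "time_grid \<alpha> t q (Suc l) - time_grid \<alpha> t q l \<le> (t / real q) powr (1 - \<alpha>)"
    unfolding time_grid_def e using powr_increment_le[OF x d, of "1 - \<alpha>"] \<alpha> by simp
next
  have "(\<lambda>q. t powr (1 - \<alpha>) * real q powr (- (1 - \<alpha>))) \<longlonglongrightarrow> t powr (1 - \<alpha>) * 0"
    using \<alpha> by (intro tendsto_mult tendsto_const tendsto_neg_powr filterlim_real_sequentially) auto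
  moreover have "(t / real q) powr (1 - \<alpha>) = t powr (1 - \<alpha>) * real q powr (- (1 - \<alpha>))" for q
    unfolding powr_minus using t powr_divide[of t "real q" "1 - \<alpha>"] by (simp only: divide_inverse)
  ultimately show "(\<lambda>q. (t / real q) powr (1 - \<alpha>)) \<longlonglongrightarrow> 0" by simp
qed

lemma substochastic_expectation:
  assumes "finite S" "\<And>d. substochastic_on S (f d)"
  shows "substochastic_on S (\<lambda>z y. measure_pmf.expectation pm (\<lambda>d. f d z y))"
  unfolding substochastic_on_def
proof (intro conjI ballI)
  have b: "0 \<le> f d z y \<and> f d z y \<le> 1" if "z \<in> S" "y \<in> S" for d z y
  proof -
    have "f d z y \<le> (\<Sum>y\<in>S. f d z y)"
      using assms that by (intro member_le_sum) (auto simp: substochastic_on_def)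
    then show ?thesis using assms(2)[of d] that by (fastforce simp: substochastic_on_def)
  qed
  show "0 \<le> measure_pmf.expectation pm (\<lambda>d. f d z y)" if "z \<in> S" "y \<in> S" for z y
    using b that by (intro integral_nonneg_AE) auto
  fix z assume z: "z \<in> S"
  have i: "integrable pm (\<lambda>d. f d z y)" if "y \<in> S" for y
    by (rule measure_pmf.integrable_const_bound[where B=1]) (use b[OF z that] in auto)
  have "(\<Sum>y\<in>S. measure_pmf.expectation pm (\<lambda>d. f d z y)) = measure_pmf.expectation pm (\<lambda>d. \<Sum>y\<in>S. f d z y)"
    using i by (subst Bochner_Integration.integral_sum) auto
  also have "\<dots> \<le> measure_pmf.expectation pm (\<lambda>d. 1)"
    using i assms(2) z by (intro integral_mono Bochner_Integration.integrable_sum) (auto simp: substochastic_on_def)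
  finally show "(\<Sum>y\<in>S. measure_pmf.expectation pm (\<lambda>d. f d z y)) \<le> 1" by simp
qed

lemma rescaled_stochastic:
  assumes "finite S" "stochastic_matrix_on S P" "0 \<le> \<gamma>" "1 \<le> n"
  shows "stochastic_matrix_on S (rescaled_matrix \<gamma> P n)"
  unfolding stochastic_matrix_on_def
proof (intro conjI ballI)
  have c: "0 < real n powr \<gamma>" "1 / real n powr \<gamma> \<le> 1"
    using assms(3,4) ge_one_powr_ge_zero[of "real n" \<gamma>] by auto
  fix x assume x: "x \<in> S"
  show "0 \<le> rescaled_matrix \<gamma> P n x y" if "y \<in> S" for y
    unfolding rescaled_matrix_def using assms(2) x that c
    by (intro add_nonneg_nonneg mult_nonneg_nonneg) (auto simp: identity_matrix_def stochastic_matrix_on_def)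
  have "(\<Sum>y\<in>S. rescaled_matrix \<gamma> P n x y)
    = (\<Sum>y\<in>S. P x y) / real n powr \<gamma> + (1 - 1 / real n powr \<gamma>) * (\<Sum>y\<in>S. identity_matrix x y)"
    by (simp add: rescaled_matrix_def sum.distrib sum_divide_distrib sum_distrib_left)
  also have "(\<Sum>y\<in>S. P x y) = 1" using assms(2) x by (simp add: stochastic_matrix_on_def)
  also have "(\<Sum>y\<in>S. identity_matrix x y) = 1"
    using assms(1) x by (simp add: identity_matrix_def of_bool_def)
  finally show "(\<Sum>y\<in>S. rescaled_matrix \<gamma> P n x y) = 1" by simp
qed

text \<open>The common setting of both regimes. \<open>E q l y\<close> is the weight of a cell in
  the limit product; what is asked of it is a first-order expansion in
  \<open>lam / (1 - \<alpha>)\<close> times the length of the cell, with the sum of the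
  \<open>h y j\<close> as coefficient.\<close>

locale step_comparison = time_changed_chain S P \<alpha> lam p
  for S :: "(real ^ 'k) set" and P \<alpha> lam p +
  fixes t \<gamma> :: real and F :: "'k \<Rightarrow> real \<Rightarrow> real" and w :: "nat \<Rightarrow> real ^ 'k \<Rightarrow> 'k \<Rightarrow> real"
    and C h :: "real ^ 'k \<Rightarrow> 'k \<Rightarrow> real" and E :: "nat \<Rightarrow> nat \<Rightarrow> real ^ 'k \<Rightarrow> real" and cE :: real
  assumes t: "0 < t" and \<gamma>: "0 < \<gamma>"
    and tails: "\<And>y. y \<in> S \<Longrightarrow> thinned_tails F (\<lambda>n j. w n y j) (C y) (h y) \<alpha> \<gamma>"
    and t_le_1: "t \<le> 1"
    and cE: "0 \<le> cE"
    and E: "\<And>q l y. l < q \<Longrightarrow> y \<in> S \<Longrightarrow> 0 \<le> E q l y \<and> E q l y \<le> 1"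
    and E1: "\<And>q l y. l < q \<Longrightarrow> y \<in> S \<Longrightarrow>
      1 - E q l y \<le> cE * (lam / (1 - \<alpha>) * (time_grid \<alpha> t q (Suc l) - time_grid \<alpha> t q l))"
    and E2: "\<And>q l y. l < q \<Longrightarrow> y \<in> S \<Longrightarrow>
      \<bar>E q l y - (1 - lam / (1 - \<alpha>) * (time_grid \<alpha> t q (Suc l) - time_grid \<alpha> t q l) * (\<Sum>j\<in>UNIV. h y j))\<bar>
        \<le> cE * (lam / (1 - \<alpha>) * (time_grid \<alpha> t q (Suc l) - time_grid \<alpha> t q l))\<^sup>2"
begin

sublocale refining_partitions "time_grid \<alpha> t" "1 - t powr (1 - \<alpha>)" "\<lambda>q. (t / real q) powr (1 - \<alpha>)"
  by (rule refining_time_grid) (use t par in auto)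

abbreviation "V \<equiv> time_grid \<alpha> t"

definition \<phi> :: "nat \<Rightarrow> real ^ 'k \<Rightarrow> real \<Rightarrow> real" where
  "\<phi> n y \<rho> = (\<Prod>j\<in>UNIV. 1 - w n y j * F j (real n * \<rho>))"

definition thinned :: "nat \<Rightarrow> real \<Rightarrow> real ^ 'k \<Rightarrow> real ^ 'k \<Rightarrow> real" where
  "thinned n \<rho> z y = rescaled_matrix \<gamma> P n z y * \<phi> n y \<rho>"

definition A :: "nat \<Rightarrow> nat \<Rightarrow> nat \<Rightarrow> real ^ 'k \<Rightarrow> real ^ 'k \<Rightarrow> real" where
  "A n q l z y = measure_pmf.expectation (poisson_pmf (lam * real n powr \<gamma> * (t / real q)))
     (\<lambda>d. path_weight S (\<lambda>_. thinned n (t - t * real l / real q)) z d y)"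

definition B :: "nat \<Rightarrow> nat \<Rightarrow> real ^ 'k \<Rightarrow> real ^ 'k \<Rightarrow> real" where
  "B q l z y = p (V q l) (V q (Suc l)) z y * E q l y"

definition \<kappa> :: "nat \<Rightarrow> real" where "\<kappa> q = lam * (t / real q)"
text \<open>Equal to \<open>lam\<close> times the integral of \<open>r powr (- \<alpha>)\<close>
  over the cell in the remaining time.\<close>

definition \<eta> :: "nat \<Rightarrow> nat \<Rightarrow> real" where "\<eta> q l = lam / (1 - \<alpha>) * (V q (Suc l) - V q l)"
definition H :: "real ^ 'k \<Rightarrow> real" where "H y = (\<Sum>j\<in>UNIV. h y j)"

lemma \<kappa>_nonneg: "0 \<le> \<kappa> q"
  using par t by (simp add: \<kappa>_def)

lemma \<eta>_nonneg: "l < q \<Longrightarrow> 0 \<le> \<eta> q l"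
  using par strict[of l q] by (simp add: \<eta>_def less_imp_le)

lemma V01: "l \<le> q \<Longrightarrow> 0 < q \<Longrightarrow> 0 \<le> V q l \<and> V q l \<le> 1"
proof -
  assume "l \<le> q" "0 < q"
  moreover have "t powr (1 - \<alpha>) \<le> 1" using t t_le_1 par by (intro powr_le1) auto
  ultimately show ?thesis using V_bounds[of q l] by auto
qed

lemma \<phi>_bounds: "y \<in> S \<Longrightarrow> 0 \<le> \<phi> n y \<rho>" "y \<in> S \<Longrightarrow> \<phi> n y \<rho> \<le> 1"
  unfolding \<phi>_def using thinned_tails.wF[OF tails] by (auto intro!: prod_nonneg prod_le_1)

lemma substochastic_thinned: "1 \<le> n \<Longrightarrow> substochastic_on S (thinned n \<rho>)"
proof -
  assume n: "1 \<le> n"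
  note st = rescaled_stochastic[OF finS stochP less_imp_le[OF \<gamma>] n, unfolded stochastic_matrix_on_def]
  have "(\<Sum>y\<in>S. thinned n \<rho> x y) \<le> 1" if "x \<in> S" for x
  proof -
    have "(\<Sum>y\<in>S. thinned n \<rho> x y) \<le> (\<Sum>y\<in>S. rescaled_matrix \<gamma> P n x y * 1)"
      unfolding thinned_def using st that \<phi>_bounds by (intro sum_mono mult_left_mono) auto
    then show ?thesis using st that by simp
  qed
  then show ?thesis using st \<phi>_bounds by (auto simp: substochastic_on_def thinned_def)
qed

lemma substochastic_A: "1 \<le> n \<Longrightarrow> substochastic_on S (A n q l)"
  unfolding A_def
  by (intro substochastic_expectation substochastic_path_weight substochastic_thinned finS)

lemma substochastic_B: "l < q \<Longrightarrow> substochastic_on S (B q l)"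
proof -
  assume l: "l < q"
  have st: "stochastic_matrix_on S (p (V q l) (V q (Suc l)))"
    using V01[of l q] V01[of "Suc l" q] strict[OF l] l by (intro p_stochastic) auto
  have "(\<Sum>y\<in>S. B q l x y) \<le> 1" if "x \<in> S" for x
  proof -
    have "(\<Sum>y\<in>S. B q l x y) \<le> (\<Sum>y\<in>S. p (V q l) (V q (Suc l)) x y * 1)"
      unfolding B_def using st that E[OF l] by (intro sum_mono mult_left_mono) (auto simp: stochastic_matrix_on_def)
    then show ?thesis using st that by (simp add: stochastic_matrix_on_def)
  qed
  then show ?thesis using st E[OF l] by (auto simp: substochastic_on_def stochastic_matrix_on_def B_def)
qed

section \<open>The two products cell by cell\<close>

lemma G_V: "l \<le> q \<Longrightarrow> 0 < q \<Longrightarrow> G (V q l) = - (t - t * real l / real q)"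
proof -
  assume l: "l \<le> q" "0 < q"
  have "t * real l \<le> t * real q" using l t by (intro mult_left_mono) auto
  then have "0 \<le> t - t * real l / real q" using l by (simp add: field_simps)
  then show ?thesis using par unfolding G_def time_grid_def by (simp add: powr_powr)
qed

text \<open>By this exact match of the time scales the first-order terms of the chain agree in both
  products.\<close>

lemma G_step: "l < q \<Longrightarrow> lam * (G (V q (Suc l)) - G (V q l)) = \<kappa> q"
proof -
  assume l: "l < q"
  have "G (V q (Suc l)) - G (V q l) = t / real q"
    using G_V[of l q] G_V[of "Suc l" q] l by (simp add: distrib_left add_divide_distrib)
  then show ?thesis by (simp only: \<kappa>_def)
qed

text \<open>\<open>\<mu>\<close> is the mean number of arrivals in a cell. As the rescaled matrix
  differs from the identity by \<open>(P - I) / n powr \<gamma>\<close>, multiplication by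
  \<open>\<mu>\<close> leaves \<open>\<kappa> q * (P - I)\<close>: the chain moves at a rate free of
  n, while thinning is tried at each of the many arrivals.\<close>

lemma A_approx:
  fixes l :: nat
  assumes n: "1 \<le> n" and q: "0 < q" and z: "z \<in> S" and y: "y \<in> S"
  defines "\<mu> \<equiv> real n powr \<gamma> * \<kappa> q" and "f \<equiv> \<phi> n y (t - t * real l / real q)"
  shows "\<bar>A n q l z y - (identity_matrix z y * (1 - \<mu> * (1 - f)) + \<kappa> q * (P z y - identity_matrix z y) * f)\<bar> \<le> 2 * \<mu>\<^sup>2"
proof -
  let ?Q = "thinned n (t - t * real l / real q)"
  have c: "0 < real n powr \<gamma>" using n by simp
  have \<mu>: "\<mu> = lam * real n powr \<gamma> * (t / real q)" by (simp add: \<mu>_def \<kappa>_def)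
  have \<mu>0: "0 < \<mu>" using par t q n by (simp add: \<mu>)
  have "\<bar>A n q l z y - ((1 - \<mu>) * path_weight S (\<lambda>_. ?Q) z 0 y + \<mu> * path_weight S (\<lambda>_. ?Q) z 1 y)\<bar> \<le> 2 * \<mu>\<^sup>2"
    unfolding A_def \<mu>[symmetric] using substochastic_thinned[OF n] finS z y
    by (intro poisson_expectation_approx \<mu>0 path_weight_nonneg path_weight_le_1) auto
  moreover have "path_weight S (\<lambda>_. ?Q) z 0 y = identity_matrix z y"
    by (simp add: identity_matrix_def)
  moreover have "path_weight S (\<lambda>_. ?Q) z 1 y = ?Q z y"
    using identity_sum'[OF z, of "\<lambda>z. ?Q z y"] by (simp add: identity_matrix_def)
  moreover have "(1 - \<mu>) * identity_matrix z y + \<mu> * ?Q z y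
    = identity_matrix z y * (1 - \<mu> * (1 - f)) + \<kappa> q * (P z y - identity_matrix z y) * f"
  proof -
    have "\<mu> * rescaled_matrix \<gamma> P n z y = \<mu> * identity_matrix z y + \<kappa> q * (P z y - identity_matrix z y)"
      using c unfolding rescaled_matrix_def \<mu>_def by (simp add: field_simps)
    then have "\<mu> * ?Q z y = (\<mu> * identity_matrix z y + \<kappa> q * (P z y - identity_matrix z y)) * f"
      unfolding thinned_def f_def by (simp add: mult.assoc[symmetric])
    then show ?thesis by (simp add: algebra_simps)
  qed
  ultimately show ?thesis by simp
qed

text \<open>In order: the Poisson error of the queue, the second-order error of the limit chain, a
  chain move combined with thinning in the queue and in the limit, the difference of the thinning
  rates, and the second-order error of the weight \<open>E\<close>.\<close>

definition cell_error :: "nat \<Rightarrow> nat \<Rightarrow> nat \<Rightarrow> real ^ 'k \<Rightarrow> real" where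
  "cell_error n q l y = 2 * (real n powr \<gamma> * \<kappa> q)\<^sup>2 + real (card S) * (\<kappa> q)\<^sup>2
     + \<kappa> q * (1 - \<phi> n y (t - t * real l / real q)) + \<kappa> q * (cE * \<eta> q l)
     + \<bar>real n powr \<gamma> * \<kappa> q * (1 - \<phi> n y (t - t * real l / real q)) - \<eta> q l * H y\<bar> + cE * (\<eta> q l)\<^sup>2"

lemma entry_error:
  assumes n: "1 \<le> n" and l: "l < q" and z: "z \<in> S" and y: "y \<in> S"
  shows "\<bar>A n q l z y - B q l z y\<bar> \<le> cell_error n q l y"
proof -
  define \<mu> where "\<mu> = real n powr \<gamma> * \<kappa> q"
  define f where "f = \<phi> n y (t - t * real l / real q)"
  define e where "e = E q l y"
  define I where "I = (identity_matrix z y :: real)"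
  define D where "D = P z y - identity_matrix z y"
  define r where "r = p (V q l) (V q (Suc l)) z y - I - \<kappa> q * D"
  have q: "0 < q" using l by simp
  have I: "0 \<le> I" "I \<le> 1" by (auto simp: I_def identity_matrix_def)
  have D: "\<bar>D\<bar> \<le> 1" unfolding D_def by (rule PI_abs[OF z y])
  have f: "0 \<le> f" "f \<le> 1" unfolding f_def by (rule \<phi>_bounds[OF y])+
  have e: "0 \<le> e" "e \<le> 1" using E[OF l y] by (auto simp: e_def)
  have r: "\<bar>r\<bar> \<le> real (card S) * (\<kappa> q)\<^sup>2"
    using p_second_order[of "V q l" "V q (Suc l)" z y] V01[of l q] V01[of "Suc l" q] strict[OF l] l z y
    by (simp add: r_def I_def D_def G_step[OF l])
  have e1: "1 - e \<le> cE * \<eta> q l" using E1[OF l y] by (simp add: e_def \<eta>_def)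
  have e2: "\<bar>e - (1 - \<eta> q l * H y)\<bar> \<le> cE * (\<eta> q l)\<^sup>2" using E2[OF l y] by (simp add: e_def \<eta>_def H_def)
  have a: "\<bar>A n q l z y - (I * (1 - \<mu> * (1 - f)) + \<kappa> q * D * f)\<bar> \<le> 2 * \<mu>\<^sup>2"
    using A_approx[OF n q z y, of l] by (simp add: \<mu>_def f_def I_def D_def)
  have b: "B q l z y = (r + I + \<kappa> q * D) * e" by (simp add: B_def r_def e_def)
  \<comment> \<open>On the identity part the difference is that of the two thinning rates; the part
    with \<open>D\<close> already carries a factor \<open>\<kappa> q\<close>, so the crude
    difference \<open>f - e\<close> suffices there.\<close>
  have "(I * (1 - \<mu> * (1 - f)) + \<kappa> q * D * f) - B q l z y
    = I * ((1 - \<eta> q l * H y - e) + (\<eta> q l * H y - \<mu> * (1 - f))) + \<kappa> q * (D * (f - e)) - r * e"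
    unfolding b by (simp add: algebra_simps)
  also have "\<bar>\<dots>\<bar> \<le> (cE * (\<eta> q l)\<^sup>2 + \<bar>\<mu> * (1 - f) - \<eta> q l * H y\<bar>) + \<kappa> q * ((1 - f) + cE * \<eta> q l) + real (card S) * (\<kappa> q)\<^sup>2"
  proof -
    have "\<bar>I * ((1 - \<eta> q l * H y - e) + (\<eta> q l * H y - \<mu> * (1 - f)))\<bar>
        \<le> \<bar>(1 - \<eta> q l * H y - e) + (\<eta> q l * H y - \<mu> * (1 - f))\<bar>"
      unfolding abs_mult using I by (simp add: mult_left_le_one_le)
    also have "\<dots> \<le> cE * (\<eta> q l)\<^sup>2 + \<bar>\<mu> * (1 - f) - \<eta> q l * H y\<bar>" using e2 by linarith
    finally have 1: "\<bar>I * ((1 - \<eta> q l * H y - e) + (\<eta> q l * H y - \<mu> * (1 - f)))\<bar> \<le> cE * (\<eta> q l)\<^sup>2 + \<bar>\<mu> * (1 - f) - \<eta> q l * H y\<bar>" .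
    have "\<bar>D * (f - e)\<bar> \<le> 1 * ((1 - f) + cE * \<eta> q l)"
      unfolding abs_mult using D f e e1 by (intro mult_mono) auto
    then have 2: "\<bar>\<kappa> q * (D * (f - e))\<bar> \<le> \<kappa> q * ((1 - f) + cE * \<eta> q l)"
      using \<kappa>_nonneg[of q] by (simp add: abs_mult mult_left_mono)
    have "\<bar>r * e\<bar> \<le> \<bar>r\<bar> * 1" unfolding abs_mult using e by (intro mult_left_mono) auto
    with r have 3: "\<bar>r * e\<bar> \<le> real (card S) * (\<kappa> q)\<^sup>2" by simp
    show ?thesis using 1 2 3 by linarith
  qed
  finally have "\<bar>(I * (1 - \<mu> * (1 - f)) + \<kappa> q * D * f) - B q l z y\<bar>
    \<le> (cE * (\<eta> q l)\<^sup>2 + \<bar>\<mu> * (1 - f) - \<eta> q l * H y\<bar>) + \<kappa> q * ((1 - f) + cE * \<eta> q l) + real (card S) * (\<kappa> q)\<^sup>2" .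
  with a have "\<bar>A n q l z y - B q l z y\<bar> \<le> 2 * \<mu>\<^sup>2 + ((cE * (\<eta> q l)\<^sup>2 + \<bar>\<mu> * (1 - f) - \<eta> q l * H y\<bar>) + \<kappa> q * ((1 - f) + cE * \<eta> q l) + real (card S) * (\<kappa> q)\<^sup>2)"
    by linarith
  then show ?thesis unfolding cell_error_def \<mu>_def[symmetric] f_def[symmetric] by (simp add: distrib_left)
qed

text \<open>What is left after the grid has been refined.\<close>

definition limit_error :: "nat \<Rightarrow> real ^ 'k \<Rightarrow> real" where
  "limit_error n y = lam * (real n powr (- \<gamma>) * integral {0..t} (thinned_tails.g F (\<lambda>n j. w n y j) \<gamma> n)
     + integral {0..t} (\<lambda>\<rho>. \<bar>thinned_tails.g F (\<lambda>n j. w n y j) \<gamma> n \<rho> - H y * \<rho> powr (- \<alpha>)\<bar>))"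

text \<open>The constants over \<open>q\<close> may grow with n, because \<open>q\<close> tends to
  infinity first. The power of \<open>t / q\<close> comes from the uneven cells in the limit
  time.\<close>

definition total_error :: "nat \<Rightarrow> nat \<Rightarrow> real ^ 'k \<Rightarrow> real" where
  "total_error n q y = (2 * (real n powr \<gamma> * (lam * t))\<^sup>2 + real (card S) * (lam * t)\<^sup>2
       + lam * t * cE * (lam / (1 - \<alpha>)) + lam * t * real n powr \<gamma>) / real q
     + cE * (lam / (1 - \<alpha>))\<^sup>2 * (t / real q) powr (1 - \<alpha>) + limit_error n y"

lemma sum_\<eta>: "0 < q \<Longrightarrow> (\<Sum>l<q. \<eta> q l) \<le> lam / (1 - \<alpha>)"
proof -
  assume q: "0 < q"
  have "(\<Sum>l<q. V q (Suc l) - V q l) = V q q - V q 0" by (rule sum_lessThan_telescope)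
  also have "\<dots> \<le> 1" using V01[of 0 q] V01[of q q] q by auto
  finally have "lam / (1 - \<alpha>) * (\<Sum>l<q. V q (Suc l) - V q l) \<le> lam / (1 - \<alpha>) * 1"
    using par by (intro mult_left_mono) auto
  then show ?thesis by (simp add: \<eta>_def sum_distrib_left)
qed

lemma sum_cell_error:
  assumes n: "1 \<le> n" and q: "0 < q" and y: "y \<in> S"
  shows "(\<Sum>l<q. cell_error n q l y) \<le> total_error n q y"
proof -
  interpret thinned_tails F "\<lambda>n j. w n y j" "C y" "h y" \<alpha> \<gamma> by (rule tails[OF y])
  define \<delta> where "\<delta> = t / real q"
  have \<delta>: "0 < \<delta>" "\<delta> * real q = t" using t q by (auto simp: \<delta>_def)
  define \<zeta> where "\<zeta> k = ((\<delta> * real (Suc k)) powr (1 - \<alpha>) - (\<delta> * real k) powr (1 - \<alpha>)) / (1 - \<alpha>)" for k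
  have H: "0 \<le> H y" using h_nonneg by (simp add: H_def sum_nonneg)
  have c: "0 < real n powr \<gamma>" using n by simp
  have gm: "1 - \<phi> n y \<rho> = real n powr (- \<gamma>) * g n \<rho>" for \<rho>
    using c by (simp add: g_def \<phi>_def powr_minus)
  have gm2: "real n powr \<gamma> * (1 - \<phi> n y \<rho>) = g n \<rho>" for \<rho> by (simp add: g_def \<phi>_def)
  \<comment> \<open>Counting from the end, cell \<open>l\<close> becomes
    \<open>k = q - Suc l\<close>, and its start, where the queue is sampled, is the right end point
    in the remaining time.\<close>
  have re: "t - t * real l / real q = \<delta> * real (Suc (q - Suc l))" "\<eta> q l = lam * \<zeta> (q - Suc l)" if "l < q" for l
    using time_grid_cell[OF that q, of t] unfolding \<eta>_def \<zeta>_def time_grid_def \<delta>_def by auto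
  have s1: "(\<Sum>l<q. \<kappa> q * (1 - \<phi> n y (t - t * real l / real q))) \<le> lam * (real n powr (- \<gamma>) * integral {0..t} (g n))"
  proof -
    have "(\<Sum>l<q. \<kappa> q * (1 - \<phi> n y (t - t * real l / real q)))
      = (\<Sum>l<q. (\<lambda>k. lam * real n powr (- \<gamma>) * (\<delta> * g n (\<delta> * real (Suc k)))) (q - Suc l))"
      by (intro sum.cong) (auto simp: re gm \<kappa>_def \<delta>_def[symmetric])
    also have "\<dots> = (\<Sum>k<q. lam * real n powr (- \<gamma>) * (\<delta> * g n (\<delta> * real (Suc k))))"
      by (rule sum.nat_diff_reindex)
    also have "\<dots> = lam * real n powr (- \<gamma>) * (\<Sum>k<q. \<delta> * g n (\<delta> * real (Suc k)))"
      by (simp only: sum_distrib_left)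
    also have "\<dots> \<le> lam * real n powr (- \<gamma>) * integral {0..t} (g n)"
      using right_endpoint_sums(2)[where f="g n" and t=t and q=q and m=q and \<alpha>=\<alpha> and h="0", folded \<delta>_def]
        g_antimono g_nonneg t q par \<delta>
      by (intro mult_left_mono) (auto simp del: of_nat_Suc)
    finally show ?thesis by (simp add: mult.assoc)
  qed
  \<comment> \<open>\<open>g n\<close> is at most \<open>n powr \<gamma>\<close> at 0, so the
    telescoped drop costs at most \<open>\<delta> * n powr \<gamma>\<close>, which vanishes with the
    mesh.\<close>
  have s2: "(\<Sum>l<q. \<bar>real n powr \<gamma> * \<kappa> q * (1 - \<phi> n y (t - t * real l / real q)) - \<eta> q l * H y\<bar>)
    \<le> lam * (\<delta> * real n powr \<gamma> + integral {0..t} (\<lambda>\<rho>. \<bar>g n \<rho> - H y * \<rho> powr (- \<alpha>)\<bar>))"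
  proof -
    have "(\<Sum>l<q. \<bar>real n powr \<gamma> * \<kappa> q * (1 - \<phi> n y (t - t * real l / real q)) - \<eta> q l * H y\<bar>)
      = (\<Sum>l<q. (\<lambda>k. lam * \<bar>\<delta> * g n (\<delta> * real (Suc k)) - H y * \<zeta> k\<bar>) (q - Suc l))"
    proof (intro sum.cong refl)
      fix l assume "l \<in> {..<q}"
      then have l: "l < q" by simp
      have "real n powr \<gamma> * \<kappa> q * (1 - \<phi> n y (t - t * real l / real q)) - \<eta> q l * H y
        = lam * (\<delta> * (real n powr \<gamma> * (1 - \<phi> n y (\<delta> * real (Suc (q - Suc l))))) - H y * \<zeta> (q - Suc l))"
        unfolding re[OF l] \<kappa>_def \<delta>_def[symmetric] by (simp add: algebra_simps)
      then show "\<bar>real n powr \<gamma> * \<kappa> q * (1 - \<phi> n y (t - t * real l / real q)) - \<eta> q l * H y\<bar>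
        = (\<lambda>k. lam * \<bar>\<delta> * g n (\<delta> * real (Suc k)) - H y * \<zeta> k\<bar>) (q - Suc l)"
        unfolding gm2 using par by (simp add: abs_mult)
    qed
    also have "\<dots> = (\<Sum>k<q. lam * \<bar>\<delta> * g n (\<delta> * real (Suc k)) - H y * \<zeta> k\<bar>)"
      by (rule sum.nat_diff_reindex)
    also have "\<dots> = lam * (\<Sum>k<q. \<bar>\<delta> * g n (\<delta> * real (Suc k)) - H y * \<zeta> k\<bar>)"
      by (simp only: sum_distrib_left)
    also have "\<dots> \<le> lam * (\<delta> * real n powr \<gamma> + integral {0..t} (\<lambda>\<rho>. \<bar>g n \<rho> - H y * \<rho> powr (- \<alpha>)\<bar>))"
    proof (intro mult_left_mono)
      have "(\<Sum>k<q. \<bar>\<delta> * g n (\<delta> * real (Suc k)) - H y * \<zeta> k\<bar>)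
        \<le> \<delta> * (g n 0 - g n (\<delta> * real q)) + integral {0..\<delta> * real q} (\<lambda>\<rho>. \<bar>g n \<rho> - H y * \<rho> powr (- \<alpha>)\<bar>)"
        using right_endpoint_sums(1)[where f="g n" and t=t and q=q and m=q and \<alpha>=\<alpha> and h="H y", folded \<delta>_def]
          g_antimono g_nonneg t q par H
        unfolding \<zeta>_def by (simp del: of_nat_Suc)
      also have "\<delta> * (g n 0 - g n (\<delta> * real q)) \<le> \<delta> * real n powr \<gamma>"
        using \<delta> g_le[of n 0] g_nonneg[of n "\<delta> * real q"] by (intro mult_left_mono) auto
      finally show "(\<Sum>k<q. \<bar>\<delta> * g n (\<delta> * real (Suc k)) - H y * \<zeta> k\<bar>)
        \<le> \<delta> * real n powr \<gamma> + integral {0..t} (\<lambda>\<rho>. \<bar>g n \<rho> - H y * \<rho> powr (- \<alpha>)\<bar>)"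
        unfolding \<delta>(2) by simp
    qed (use par in auto)
    finally show ?thesis .
  qed
  have s3: "(\<Sum>l<q. \<kappa> q * (cE * \<eta> q l)) \<le> \<kappa> q * (cE * (lam / (1 - \<alpha>)))"
    unfolding sum_distrib_left[symmetric] using sum_\<eta>[OF q] cE \<kappa>_nonneg by (intro mult_left_mono) auto
  \<comment> \<open>The cells have unequal lengths in the limit time: one factor of the square is
    bounded by the mesh, the other is summed.\<close>
  have s4: "(\<Sum>l<q. cE * (\<eta> q l)\<^sup>2) \<le> cE * (lam / (1 - \<alpha>))\<^sup>2 * (t / real q) powr (1 - \<alpha>)"
  proof -
    have "(\<eta> q l)\<^sup>2 \<le> (lam / (1 - \<alpha>) * (t / real q) powr (1 - \<alpha>)) * \<eta> q l" if "l < q" for l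
    proof -
      have "\<eta> q l \<le> lam / (1 - \<alpha>) * (t / real q) powr (1 - \<alpha>)"
        unfolding \<eta>_def using mesh[OF that] par by (intro mult_left_mono) auto
      then show ?thesis unfolding power2_eq_square using \<eta>_nonneg[OF that] by (rule mult_right_mono)
    qed
    then have "(\<Sum>l<q. (\<eta> q l)\<^sup>2) \<le> (\<Sum>l<q. (lam / (1 - \<alpha>) * (t / real q) powr (1 - \<alpha>)) * \<eta> q l)"
      by (intro sum_mono) auto
    also have "\<dots> \<le> (lam / (1 - \<alpha>) * (t / real q) powr (1 - \<alpha>)) * (lam / (1 - \<alpha>))"
      unfolding sum_distrib_left[symmetric] using sum_\<eta>[OF q] par by (intro mult_left_mono) auto
    finally have "cE * (\<Sum>l<q. (\<eta> q l)\<^sup>2) \<le> cE * ((lam / (1 - \<alpha>) * (t / real q) powr (1 - \<alpha>)) * (lam / (1 - \<alpha>)))"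
      using cE by (rule mult_left_mono)
    then show ?thesis by (simp add: sum_distrib_left power2_eq_square mult_ac)
  qed
  have s5: "(\<Sum>l<q. 2 * (real n powr \<gamma> * \<kappa> q)\<^sup>2 + real (card S) * (\<kappa> q)\<^sup>2)
    = (2 * (real n powr \<gamma> * (lam * t))\<^sup>2 + real (card S) * (lam * t)\<^sup>2) / real q"
    using q by (simp add: \<kappa>_def power2_eq_square field_simps)
  have "(\<Sum>l<q. cell_error n q l y) = (\<Sum>l<q. 2 * (real n powr \<gamma> * \<kappa> q)\<^sup>2 + real (card S) * (\<kappa> q)\<^sup>2)
     + (\<Sum>l<q. \<kappa> q * (1 - \<phi> n y (t - t * real l / real q))) + (\<Sum>l<q. \<kappa> q * (cE * \<eta> q l))
     + (\<Sum>l<q. \<bar>real n powr \<gamma> * \<kappa> q * (1 - \<phi> n y (t - t * real l / real q)) - \<eta> q l * H y\<bar>) + (\<Sum>l<q. cE * (\<eta> q l)\<^sup>2)"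
    unfolding cell_error_def by (simp only: sum.distrib)
  also have "\<dots> \<le> (2 * (real n powr \<gamma> * (lam * t))\<^sup>2 + real (card S) * (lam * t)\<^sup>2) / real q
     + lam * (real n powr (- \<gamma>) * integral {0..t} (g n)) + \<kappa> q * (cE * (lam / (1 - \<alpha>)))
     + lam * (\<delta> * real n powr \<gamma> + integral {0..t} (\<lambda>\<rho>. \<bar>g n \<rho> - H y * \<rho> powr (- \<alpha>)\<bar>))
     + cE * (lam / (1 - \<alpha>))\<^sup>2 * (t / real q) powr (1 - \<alpha>)"
    using s1 s2 s3 s4 s5 by linarith
  also have "\<dots> = total_error n q y"
    unfolding total_error_def limit_error_def \<kappa>_def \<delta>_def by (simp add: add_divide_distrib distrib_left mult_ac)
  finally show ?thesis .
qed

lemma total_error_tendsto: "(\<lambda>q. total_error n (Suc q) y) \<longlonglongrightarrow> limit_error n y"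
proof -
  have 1: "(\<lambda>q. c / real (Suc q)) \<longlonglongrightarrow> 0" for c :: real by (rule LIMSEQ_Suc[OF lim_const_over_n])
  have "(\<lambda>q. total_error n (Suc q) y) \<longlonglongrightarrow> 0 + cE * (lam / (1 - \<alpha>))\<^sup>2 * 0 + limit_error n y"
    unfolding total_error_def by (intro tendsto_add tendsto_mult tendsto_const 1 LIMSEQ_Suc[OF mesh_lim])
  then show ?thesis by simp
qed

lemma limit_error_tendsto: "y \<in> S \<Longrightarrow> (\<lambda>n. limit_error n y) \<longlonglongrightarrow> 0"
proof -
  assume y: "y \<in> S"
  interpret thinned_tails F "\<lambda>n j. w n y j" "C y" "h y" \<alpha> \<gamma> by (rule tails[OF y])
  have "(\<lambda>n. limit_error n y) \<longlonglongrightarrow> lam * (0 + 0)"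
    unfolding limit_error_def H_def using t
    by (intro tendsto_mult tendsto_add tendsto_const integral_g_small integral_g_tendsto) auto
  then show ?thesis by simp
qed

text \<open>For fixed n both products tend to their transforms while the summed errors tend to
  \<open>limit_error\<close>; only afterwards does n grow. A single entry is bounded by its whole
  row, in which the errors are controlled.\<close>

theorem transform_limit:
  assumes x: "x \<in> S" and y: "y \<in> S"
    and a: "\<And>n. 1 \<le> n \<Longrightarrow> (\<lambda>q. path_weight S (A n (Suc q)) x (Suc q) y) \<longlonglongrightarrow> a n"
    and b: "(\<lambda>q. path_weight S (B (Suc q)) x (Suc q) y) \<longlonglongrightarrow> b"
  shows "a \<longlonglongrightarrow> b"
proof -
  have le: "\<bar>a n - b\<bar> \<le> (\<Sum>y\<in>S. limit_error n y)" if n: "1 \<le> n" for n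
  proof (rule LIMSEQ_le)
    show "(\<lambda>q. \<bar>path_weight S (A n (Suc q)) x (Suc q) y - path_weight S (B (Suc q)) x (Suc q) y\<bar>) \<longlonglongrightarrow> \<bar>a n - b\<bar>"
      by (intro tendsto_intros a[OF n] b)
    show "(\<lambda>q. \<Sum>y\<in>S. total_error n (Suc q) y) \<longlonglongrightarrow> (\<Sum>y\<in>S. limit_error n y)"
      by (intro tendsto_sum total_error_tendsto)
    have "\<bar>path_weight S (A n (Suc q)) x (Suc q) y - path_weight S (B (Suc q)) x (Suc q) y\<bar> \<le> (\<Sum>y\<in>S. total_error n (Suc q) y)" for q
    proof -
      have "\<bar>path_weight S (A n (Suc q)) x (Suc q) y - path_weight S (B (Suc q)) x (Suc q) y\<bar>
        \<le> (\<Sum>y\<in>S. \<bar>path_weight S (A n (Suc q)) x (Suc q) y - path_weight S (B (Suc q)) x (Suc q) y\<bar>)"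
        using finS y by (intro member_le_sum[of y S "\<lambda>y. \<bar>path_weight S (A n (Suc q)) x (Suc q) y - path_weight S (B (Suc q)) x (Suc q) y\<bar>"]) auto
      also have "\<dots> \<le> (\<Sum>l<Suc q. \<Sum>y\<in>S. cell_error n (Suc q) l y)"
        by (intro path_weight_diff finS x substochastic_A n substochastic_B sum_mono entry_error)
      also have "\<dots> = (\<Sum>y\<in>S. \<Sum>l<Suc q. cell_error n (Suc q) l y)" by (rule sum.swap)
      also have "\<dots> \<le> (\<Sum>y\<in>S. total_error n (Suc q) y)" by (intro sum_mono sum_cell_error n) auto
      finally show ?thesis .
    qed
    then show "\<exists>N. \<forall>q\<ge>N. \<bar>path_weight S (A n (Suc q)) x (Suc q) y - path_weight S (B (Suc q)) x (Suc q) y\<bar> \<le> (\<Sum>y\<in>S. total_error n (Suc q) y)"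
      by blast
  qed
  have "(\<lambda>n. \<Sum>y\<in>S. limit_error n y) \<longlonglongrightarrow> (\<Sum>y\<in>S. 0)"
    by (intro tendsto_sum limit_error_tendsto)
  then have lim: "(\<lambda>n. \<Sum>y\<in>S. limit_error n y) \<longlonglongrightarrow> 0" by simp
  have "(\<lambda>n. a n - b) \<longlonglongrightarrow> 0"
    by (rule Lim_null_comparison[OF _ lim]) (use le in \<open>auto intro!: eventually_sequentiallyI[of 1]\<close>)
  then show ?thesis by (simp add: LIM_zero_iff)
qed

end

section \<open>Weak convergence on the orthant from Laplace transforms\<close>

definition expo :: "real ^ 'k \<Rightarrow> real ^ 'k" where "expo z = (\<chi> j. exp (- z $ j))"

definition cube :: "(real ^ 'k) set" where "cube = {u. \<forall>j. 0 \<le> u $ j \<and> u $ j \<le> 1}"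

lemma compact_cube: "compact (cube :: (real ^ 'k) set)"
proof -
  have "(cube :: (real ^ 'k) set) = cbox 0 1" by (auto simp: cube_def mem_box_cart)
  then show ?thesis using compact_cbox[of "0 :: real ^ 'k" 1] by (simp only:)
qed

lemma expo_cube: "(\<And>j. 0 \<le> z $ j) \<Longrightarrow> expo z \<in> cube"
  by (auto simp: cube_def expo_def)

lemma expo_meas [measurable]: "expo \<in> borel_measurable borel"
  unfolding expo_def by (intro borel_measurable_vecI) simp

lemma bounded_on_cube:
  assumes "continuous_on UNIV g"
  obtains b where "\<And>u. u \<in> cube \<Longrightarrow> \<bar>g u :: real\<bar> \<le> b"
proof -
  have "compact (g ` cube)"
    using assms compact_cube by (intro compact_continuous_image continuous_on_subset[OF assms]) auto
  then show ?thesis using that by (force dest!: compact_imp_bounded simp: bounded_iff)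
qed

definition monomial :: "('k \<Rightarrow> nat) \<Rightarrow> real ^ 'k \<Rightarrow> real" where
  "monomial m u = (\<Prod>j\<in>UNIV. (u $ j) ^ m j)"

text \<open>Polynomials as linear combinations of monomials: convergence of means is linear, and a
  monomial in \<open>expo z\<close> is the integrand of a Laplace transform at natural
  arguments.\<close>

inductive monomial_sum :: "(real ^ 'k \<Rightarrow> real) \<Rightarrow> bool" where
  mono: "monomial_sum (monomial m)"
| add: "monomial_sum f \<Longrightarrow> monomial_sum g \<Longrightarrow> monomial_sum (\<lambda>u. f u + g u)"
| scale: "monomial_sum f \<Longrightarrow> monomial_sum (\<lambda>u. a * f u)"

lemma monomial_sum_mult:
  assumes "monomial_sum f" "monomial_sum g"
  shows "monomial_sum (\<lambda>u. f u * g u)"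
  using assms
proof (induction f rule: monomial_sum.induct)
  case (mono m)
  then show ?case
  proof (induction g rule: monomial_sum.induct)
    case (mono m')
    have "(\<lambda>u. monomial m u * monomial m' u) = monomial (\<lambda>j. m j + m' j)"
      by (simp add: monomial_def fun_eq_iff power_add prod.distrib)
    then show ?case by (simp add: monomial_sum.mono)
  next
    case (add f g)
    then show ?case by (simp add: distrib_left monomial_sum.add)
  next
    case (scale f a)
    then show ?case using monomial_sum.scale[of "\<lambda>u. monomial m u * f u" a] by (simp add: mult_ac)
  qed
next
  case (add f g)
  then show ?case by (simp add: distrib_right monomial_sum.add)
next
  case (scale f a)
  then show ?case using monomial_sum.scale[of "\<lambda>u. f u * g u" a] by (simp add: mult_ac)
qed

lemma monomial_sum_const: "monomial_sum (\<lambda>_. a)"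
  using monomial_sum.scale[OF monomial_sum.mono[of "\<lambda>_. 0"], of a] by (simp add: monomial_def)

lemma monomial_sum_sum: "finite I \<Longrightarrow> (\<And>i. i \<in> I \<Longrightarrow> monomial_sum (f i)) \<Longrightarrow> monomial_sum (\<lambda>u. \<Sum>i\<in>I. f i u)"
  by (induction I rule: finite_induct) (auto intro: monomial_sum_const monomial_sum.add)

lemma polynomial_monomial_sum: "real_polynomial_function f \<Longrightarrow> monomial_sum f" for f :: "real ^ 'k \<Rightarrow> real"
proof (induction f rule: real_polynomial_function.induct)
  case (linear f)
  have coord: "monomial_sum (\<lambda>u :: real ^ 'k. u $ j)" for j
  proof -
    have "(\<lambda>u :: real ^ 'k. u $ j) = monomial (\<lambda>i. of_bool (i = j))"
    proof
      fix u :: "real ^ 'k"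
      have "monomial (\<lambda>i. of_bool (i = j)) u = (\<Prod>i\<in>UNIV. if i = j then u $ i else 1)"
        unfolding monomial_def by (intro prod.cong) auto
      then show "u $ j = monomial (\<lambda>i. of_bool (i = j)) u" by simp
    qed
    then show ?thesis using monomial_sum.mono by metis
  qed
  interpret bounded_linear f by fact
  have "f = (\<lambda>u. \<Sum>j\<in>UNIV. f (axis j 1) * u $ j)"
  proof
    fix u :: "real ^ 'k"
    have "u = (\<Sum>j\<in>UNIV. (u $ j) *\<^sub>R axis j 1)"
      by (simp add: vec_eq_iff sum_component axis_def if_distrib cong: if_cong)
    then have "f u = f (\<Sum>j\<in>UNIV. (u $ j) *\<^sub>R axis j 1)" by simp
    then show "f u = (\<Sum>j\<in>UNIV. f (axis j 1) * u $ j)" by (simp add: sum scaleR mult.commute)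
  qed
  moreover have "monomial_sum (\<lambda>u. \<Sum>j\<in>UNIV. f (axis j 1) * u $ j)"
    by (intro monomial_sum_sum monomial_sum.scale coord) auto
  ultimately show ?case by simp
qed (auto intro: monomial_sum_const monomial_sum.add monomial_sum_mult)

lemma monomial_sum_cont: "monomial_sum g \<Longrightarrow> continuous_on UNIV g"
proof (induction g rule: monomial_sum.induct)
  case (mono m)
  show ?case unfolding monomial_def by (intro continuous_intros)
qed (auto intro!: continuous_intros)

text \<open>A continuous cutoff of the faces of the cube: zero if a coordinate is below
  \<open>\<epsilon>\<close>, one if all are at least \<open>2 * \<epsilon>\<close>. It takes the
  place of a tightness argument, since its defect is continuous on the cube and so has convergent
  means.\<close>

definition ramp :: "real \<Rightarrow> real ^ 'k \<Rightarrow> real" where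
  "ramp \<epsilon> u = (\<Prod>j\<in>UNIV. max 0 (min 1 (u $ j / \<epsilon> - 1)))"

lemma ramp_bounds: "0 \<le> ramp \<epsilon> u" "ramp \<epsilon> u \<le> 1"
  unfolding ramp_def by (auto intro!: prod_nonneg prod_le_1)

lemma ramp_cont: "continuous_on UNIV (ramp \<epsilon>)"
  unfolding ramp_def divide_inverse by (intro continuous_intros)

lemma ramp_zero: "0 < \<epsilon> \<Longrightarrow> u $ j < \<epsilon> \<Longrightarrow> ramp \<epsilon> u = 0"
proof -
  assume "0 < \<epsilon>" "u $ j < \<epsilon>"
  then have "max 0 (min 1 (u $ j / \<epsilon> - 1)) = 0" by (simp add: field_simps max_def min_def)
  then show ?thesis unfolding ramp_def by (intro prod_zero) auto
qed

lemma ramp_tendsto: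
  fixes u :: "real ^ 'k"
  assumes "\<And>j. 0 < u $ j"
  shows "(\<lambda>i. ramp (1 / real (Suc i)) u) \<longlonglongrightarrow> 1"
proof -
  have lim: "(\<lambda>i. max 0 (min 1 (u $ j / (1 / real (Suc i)) - 1))) \<longlonglongrightarrow> 1" for j
  proof (rule tendsto_eventually)
    obtain N where N: "2 / u $ j < real N" using reals_Archimedean2 by blast
    show "eventually (\<lambda>i. max 0 (min 1 (u $ j / (1 / real (Suc i)) - 1)) = 1) sequentially"
    proof (rule eventually_sequentiallyI[of N])
      fix i assume "N \<le> i"
      then have "2 / u $ j \<le> real (Suc i)" using N by linarith
      then have "2 \<le> u $ j * real (Suc i)" using assms[of j] by (simp add: field_simps)
      then show "max 0 (min 1 (u $ j / (1 / real (Suc i)) - 1)) = 1" by simp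
    qed
  qed
  have "(\<lambda>i. ramp (1 / real (Suc i)) u) \<longlonglongrightarrow> (\<Prod>j\<in>(UNIV :: 'k set). 1)"
    unfolding ramp_def by (rule tendsto_prod) (rule lim)
  then show ?thesis by simp
qed

text \<open>\<open>u \<mapsto> f (- ln u)\<close> need not extend continuously to the faces \<open>u $ j = 0\<close> of the cube; the
  truncation does, and it changes the value only where \<open>ramp \<epsilon>\<close> vanishes.\<close>

definition truncated :: "(real ^ 'k \<Rightarrow> real) \<Rightarrow> real \<Rightarrow> real ^ 'k \<Rightarrow> real" where
  "truncated f \<epsilon> u = f (\<chi> j. - ln (max \<epsilon> (u $ j)))"

lemma truncated_cont:
  assumes f: "continuous_on UNIV f" and "0 < \<epsilon>"
  shows "continuous_on UNIV (truncated f \<epsilon>)"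
proof -
  have "continuous_on UNIV (\<lambda>u :: real ^ 'k. \<chi> j. - ln (max \<epsilon> (u $ j)))"
    using assms(2) by (intro continuous_on_vec_lambda continuous_intros) (auto simp: max_def)
  then show ?thesis unfolding truncated_def by (rule continuous_on_compose2[OF f]) auto
qed

lemma truncated_close:
  assumes bd: "\<And>z. \<bar>f z\<bar> \<le> b" and \<epsilon>: "0 < \<epsilon>"
  shows "\<bar>f z - truncated f \<epsilon> (expo z)\<bar> \<le> 2 * b * (1 - ramp \<epsilon> (expo z))"
proof (cases "\<exists>j. expo z $ j < \<epsilon>")
  case True
  then have "ramp \<epsilon> (expo z) = 0" using ramp_zero[OF \<epsilon>] by blast
  moreover have "\<bar>f z - truncated f \<epsilon> (expo z)\<bar> \<le> b + b"
    unfolding truncated_def by (intro order_trans[OF abs_triangle_ineq4] add_mono bd)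
  ultimately show ?thesis by simp
next
  case False
  have b0: "0 \<le> b" using bd[of 0] by linarith
  have "\<epsilon> \<le> expo z $ j" for j using False by (simp add: not_less)
  then have "max \<epsilon> (exp (- z $ j)) = exp (- z $ j)" for j by (simp add: expo_def max_absorb2)
  then have "truncated f \<epsilon> (expo z) = f z" by (simp add: truncated_def expo_def)
  then show ?thesis using b0 ramp_bounds[of \<epsilon> "expo z"] by (simp add: mult_nonneg_nonneg)
qed

text \<open>The weight \<open>W\<close> will be the normalized indicator of prescribed initial and
  terminal states, so that a conditional law of a pair splits into finitely many weighted laws of
  \<open>Z\<close>.\<close>

locale weighted_vector = prob_space M for M :: "'a measure" +
  fixes W :: "'a \<Rightarrow> real" and Z :: "'a \<Rightarrow> real ^ 'k" and c :: real
  assumes W_meas [measurable]: "W \<in> borel_measurable M" and Z_meas [measurable]: "Z \<in> borel_measurable M"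
    and W_bound: "\<And>\<omega>. \<omega> \<in> space M \<Longrightarrow> 0 \<le> W \<omega> \<and> W \<omega> \<le> c"
    and Z_nonneg: "\<And>\<omega> j. \<omega> \<in> space M \<Longrightarrow> 0 \<le> Z \<omega> $ j"
begin

definition wmean :: "(real ^ 'k \<Rightarrow> real) \<Rightarrow> real" where
  "wmean g = (\<integral>\<omega>. W \<omega> * g (expo (Z \<omega>)) \<partial>M)"

lemma c_nonneg: "0 \<le> c"
  using not_empty W_bound by fastforce

lemma integrable_cont:
  assumes g: "continuous_on UNIV g"
  shows "integrable M (\<lambda>\<omega>. W \<omega> * g (expo (Z \<omega>)))"
proof -
  have [measurable]: "g \<in> borel_measurable borel" by (rule borel_measurable_continuous_onI[OF g])
  obtain b where b: "\<And>u. u \<in> cube \<Longrightarrow> \<bar>g u\<bar> \<le> b" using bounded_on_cube[OF g] by blast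
  have "\<bar>W \<omega> * g (expo (Z \<omega>))\<bar> \<le> c * b" if "\<omega> \<in> space M" for \<omega>
    unfolding abs_mult using W_bound[OF that] b[OF expo_cube[OF Z_nonneg[OF that]]] c_nonneg by (intro mult_mono) auto
  then show ?thesis by (intro integrable_const_bound[where B="c * b"]) auto
qed

lemma integral_close:
  fixes u v d :: "'a \<Rightarrow> real"
  assumes "integrable M u" "integrable M v" "integrable M d" "\<And>\<omega>. \<omega> \<in> space M \<Longrightarrow> \<bar>u \<omega> - v \<omega>\<bar> \<le> d \<omega>"
  shows "\<bar>(\<integral>\<omega>. u \<omega> \<partial>M) - (\<integral>\<omega>. v \<omega> \<partial>M)\<bar> \<le> (\<integral>\<omega>. d \<omega> \<partial>M)"
proof -
  have "\<bar>(\<integral>\<omega>. u \<omega> \<partial>M) - (\<integral>\<omega>. v \<omega> \<partial>M)\<bar> = \<bar>\<integral>\<omega>. u \<omega> - v \<omega> \<partial>M\<bar>" using assms by simp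
  also have "\<dots> \<le> (\<integral>\<omega>. \<bar>u \<omega> - v \<omega>\<bar> \<partial>M)" by (rule integral_abs_bound)
  also have "\<dots> \<le> (\<integral>\<omega>. d \<omega> \<partial>M)"
    using assms by (intro integral_mono integrable_abs Bochner_Integration.integrable_diff)
  finally show ?thesis .
qed

lemma weighted_diff: "\<omega> \<in> space M \<Longrightarrow> \<bar>x - y\<bar> \<le> e \<Longrightarrow> \<bar>W \<omega> * x - W \<omega> * y\<bar> \<le> W \<omega> * e"
  unfolding right_diff_distrib[symmetric] abs_mult using W_bound[of \<omega>] by (simp add: mult_left_mono)

lemma wmean_close:
  assumes "continuous_on UNIV g1" "continuous_on UNIV g2" and e: "\<And>u. u \<in> cube \<Longrightarrow> \<bar>g1 u - g2 u\<bar> \<le> e" "0 \<le> e"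
  shows "\<bar>wmean g1 - wmean g2\<bar> \<le> c * e"
proof -
  have "\<bar>wmean g1 - wmean g2\<bar> \<le> (\<integral>\<omega>. c * e \<partial>M)"
    unfolding wmean_def
  proof (intro integral_close integrable_cont assms)
    fix \<omega> assume w: "\<omega> \<in> space M"
    have "\<bar>W \<omega> * g1 (expo (Z \<omega>)) - W \<omega> * g2 (expo (Z \<omega>))\<bar> \<le> W \<omega> * e"
      by (intro weighted_diff w e expo_cube Z_nonneg)
    also have "\<dots> \<le> c * e" using W_bound[OF w] e(2) by (intro mult_right_mono) auto
    finally show "\<bar>W \<omega> * g1 (expo (Z \<omega>)) - W \<omega> * g2 (expo (Z \<omega>))\<bar> \<le> c * e" .
  qed simp
  then show ?thesis by (simp add: prob_space)
qed

lemma truncation_error: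
  assumes f: "continuous_on UNIV f" and bd: "\<And>z. \<bar>f z\<bar> \<le> b" and \<epsilon>: "0 < \<epsilon>"
  shows "\<bar>(\<integral>\<omega>. W \<omega> * f (Z \<omega>) \<partial>M) - wmean (truncated f \<epsilon>)\<bar> \<le> 2 * b * wmean (\<lambda>u. 1 - ramp \<epsilon> u)"
proof -
  have [measurable]: "f \<in> borel_measurable borel" by (rule borel_measurable_continuous_onI[OF f])
  have "\<bar>W \<omega> * f (Z \<omega>)\<bar> \<le> c * b" if "\<omega> \<in> space M" for \<omega>
    unfolding abs_mult using W_bound[OF that] bd c_nonneg by (intro mult_mono) auto
  then have i: "integrable M (\<lambda>\<omega>. W \<omega> * f (Z \<omega>))"
    by (intro integrable_const_bound[where B="c * b"]) auto
  have "\<bar>(\<integral>\<omega>. W \<omega> * f (Z \<omega>) \<partial>M) - wmean (truncated f \<epsilon>)\<bar> \<le> (\<integral>\<omega>. W \<omega> * (2 * b * (1 - ramp \<epsilon> (expo (Z \<omega>)))) \<partial>M)"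
    unfolding wmean_def
    by (intro integral_close i weighted_diff truncated_close bd \<epsilon> integrable_cont truncated_cont f
        integrable_cont[where g="\<lambda>u. 2 * b * (1 - ramp \<epsilon> u)"] continuous_intros ramp_cont)
  also have "\<dots> = 2 * b * wmean (\<lambda>u. 1 - ramp \<epsilon> u)"
    unfolding wmean_def by (simp add: mult.left_commute[of _ "2 * b"])
  finally show ?thesis .
qed

text \<open>The coordinates of \<open>expo z\<close> are positive, because \<open>Z\<close> is
  finite: no mass sits on the faces.\<close>

lemma ramp_defect_tendsto: "(\<lambda>i. wmean (\<lambda>u. 1 - ramp (1 / real (Suc i)) u)) \<longlonglongrightarrow> 0"
proof -
  have [measurable]: "ramp \<epsilon> \<in> borel_measurable borel" for \<epsilon> by (rule borel_measurable_continuous_onI[OF ramp_cont])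
  have "(\<lambda>i. \<integral>\<omega>. W \<omega> * (1 - ramp (1 / real (Suc i)) (expo (Z \<omega>))) \<partial>M) \<longlonglongrightarrow> (\<integral>\<omega>. 0 \<partial>M)"
  proof (rule integral_dominated_convergence[where w="\<lambda>_. c"])
    show "AE \<omega> in M. (\<lambda>i. W \<omega> * (1 - ramp (1 / real (Suc i)) (expo (Z \<omega>)))) \<longlonglongrightarrow> 0"
    proof (rule AE_I2)
      fix \<omega>
      have "(\<lambda>i. W \<omega> * (1 - ramp (1 / real (Suc i)) (expo (Z \<omega>)))) \<longlonglongrightarrow> W \<omega> * (1 - 1)"
        by (intro tendsto_intros ramp_tendsto) (simp add: expo_def)
      then show "(\<lambda>i. W \<omega> * (1 - ramp (1 / real (Suc i)) (expo (Z \<omega>)))) \<longlonglongrightarrow> 0" by simp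
    qed
    show "AE \<omega> in M. norm (W \<omega> * (1 - ramp (1 / real (Suc i)) (expo (Z \<omega>)))) \<le> c" for i
    proof (rule AE_I2)
      fix \<omega> assume w: "\<omega> \<in> space M"
      have "\<bar>W \<omega> * (1 - ramp (1 / real (Suc i)) (expo (Z \<omega>)))\<bar> \<le> c * 1"
        unfolding abs_mult using W_bound[OF w] ramp_bounds[of "1 / real (Suc i)" "expo (Z \<omega>)"]
        by (intro mult_mono) auto
      then show "norm (W \<omega> * (1 - ramp (1 / real (Suc i)) (expo (Z \<omega>)))) \<le> c" by simp
    qed
  qed (auto intro: integrable_const)
  then show ?thesis by (simp add: wmean_def)
qed

end

locale weighted_vectors = lim: weighted_vector M' W' Z' c
  for M' :: "'b measure" and W' :: "'b \<Rightarrow> real" and Z' :: "'b \<Rightarrow> real ^ 'k" and c +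
  fixes M :: "nat \<Rightarrow> 'a measure" and W :: "nat \<Rightarrow> 'a \<Rightarrow> real" and Z :: "nat \<Rightarrow> 'a \<Rightarrow> real ^ 'k"
  assumes vectors: "\<And>n. weighted_vector (M n) (W n) (Z n) c"
    and transform: "\<And>m :: 'k \<Rightarrow> nat. (\<lambda>n. \<integral>\<omega>. W n \<omega> * exp (- (\<Sum>j\<in>UNIV. real (m j) * Z n \<omega> $ j)) \<partial>M n)
       \<longlonglongrightarrow> (\<integral>\<omega>. W' \<omega> * exp (- (\<Sum>j\<in>UNIV. real (m j) * Z' \<omega> $ j)) \<partial>M')"
begin

sublocale seq: weighted_vector "M n" "W n" "Z n" c for n
  by (rule vectors)

lemma monomial_sum_tendsto: "monomial_sum g \<Longrightarrow> (\<lambda>n. seq.wmean n g) \<longlonglongrightarrow> lim.wmean g"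
proof (induction g rule: monomial_sum.induct)
  case (mono m)
  have "monomial m (expo z) = exp (- (\<Sum>j\<in>UNIV. real (m j) * z $ j))" for z :: "real ^ 'k"
    by (simp add: monomial_def expo_def exp_of_nat_mult[symmetric] exp_sum[symmetric] sum_negf)
  then show ?case using transform[of m] by (simp add: seq.wmean_def lim.wmean_def)
next
  case (add f g)
  note f = monomial_sum_cont[OF add.hyps(1)] and g = monomial_sum_cont[OF add.hyps(2)]
  show ?case
    using tendsto_add[OF add.IH] seq.integrable_cont[OF f] seq.integrable_cont[OF g] lim.integrable_cont[OF f] lim.integrable_cont[OF g]
    unfolding seq.wmean_def lim.wmean_def by (simp add: distrib_left)
next
  case (scale f a)
  have "seq.wmean n (\<lambda>u. a * f u) = a * seq.wmean n f" "lim.wmean (\<lambda>u. a * f u) = a * lim.wmean f" for n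
    by (simp_all add: seq.wmean_def lim.wmean_def mult.left_commute[of _ a])
  then show ?case using scale.IH by (simp add: tendsto_mult_left)
qed

lemma continuous_tendsto:
  assumes g: "continuous_on UNIV g"
  shows "(\<lambda>n. seq.wmean n g) \<longlonglongrightarrow> lim.wmean g"
proof (rule LIMSEQ_I)
  fix e :: real assume e: "0 < e"
  \<comment> \<open>\<open>c + 1\<close> instead of \<open>c\<close>, as the bound \<open>c\<close>
    may be zero.\<close>
  define d where "d = e / (3 * (c + 1))"
  have d: "0 < d" "c * d < e / 3" using e lim.c_nonneg by (auto simp: d_def field_simps)
  obtain h where h: "real_polynomial_function h" "\<And>u. u \<in> cube \<Longrightarrow> \<bar>g u - h u\<bar> < d"
    using Stone_Weierstrass_real_polynomial_function[OF compact_cube continuous_on_subset[OF g] d(1)] by auto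
  have hc: "continuous_on UNIV h" by (rule monomial_sum_cont[OF polynomial_monomial_sum[OF h(1)]])
  obtain N where N: "\<And>n. n \<ge> N \<Longrightarrow> \<bar>seq.wmean n h - lim.wmean h\<bar> < e / 3"
    using LIMSEQ_D[OF monomial_sum_tendsto[OF polynomial_monomial_sum[OF h(1)]], of "e / 3"] e by auto
  show "\<exists>N. \<forall>n\<ge>N. norm (seq.wmean n g - lim.wmean g) < e"
  proof (intro exI allI impI)
    fix n assume n: "N \<le> n"
    have "\<bar>seq.wmean n g - seq.wmean n h\<bar> \<le> c * d" "\<bar>lim.wmean g - lim.wmean h\<bar> \<le> c * d"
      by (rule seq.wmean_close[OF g hc] lim.wmean_close[OF g hc]; use h(2) d(1) in \<open>auto intro: less_imp_le\<close>)+
    then show "norm (seq.wmean n g - lim.wmean g) < e" using N[OF n] d(2) unfolding real_norm_def by linarith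
  qed
qed

text \<open>The truncation is chosen from the limit alone. The same \<open>\<epsilon>\<close> then
  serves for all large n, since the mean of \<open>1 - ramp \<epsilon>\<close> converges; this
  excludes loss of mass at infinity.\<close>

theorem weighted_convergence:
  assumes f: "continuous_on UNIV f" and bd: "\<And>z. \<bar>f z\<bar> \<le> b"
  shows "(\<lambda>n. \<integral>\<omega>. W n \<omega> * f (Z n \<omega>) \<partial>M n) \<longlonglongrightarrow> (\<integral>\<omega>. W' \<omega> * f (Z' \<omega>) \<partial>M')"
proof (rule LIMSEQ_I)
  fix e :: real assume e: "0 < e"
  have "(\<lambda>i. 2 * b * lim.wmean (\<lambda>u. 1 - ramp (1 / real (Suc i)) u)) \<longlonglongrightarrow> 2 * b * 0"
    by (intro tendsto_mult tendsto_const lim.ramp_defect_tendsto)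
  then have "eventually (\<lambda>i. 2 * b * lim.wmean (\<lambda>u. 1 - ramp (1 / real (Suc i)) u) < e / 4) sequentially"
    using e by (intro order_tendstoD(2)) auto
  then obtain i where i: "2 * b * lim.wmean (\<lambda>u. 1 - ramp (1 / real (Suc i)) u) < e / 4"
    by (auto simp: eventually_sequentially)
  define \<epsilon> where "\<epsilon> = 1 / real (Suc i)"
  have \<epsilon>: "0 < \<epsilon>" by (simp add: \<epsilon>_def)
  have "continuous_on UNIV (\<lambda>u :: real ^ 'k. 1 - ramp \<epsilon> u)" by (intro continuous_intros ramp_cont)
  from tendsto_mult[OF tendsto_const continuous_tendsto[OF this], of "2 * b"]
  have "eventually (\<lambda>n. 2 * b * seq.wmean n (\<lambda>u. 1 - ramp \<epsilon> u) < e / 4) sequentially"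
    using i by (intro order_tendstoD(2)) (auto simp: \<epsilon>_def)
  moreover have "eventually (\<lambda>n. \<bar>seq.wmean n (truncated f \<epsilon>) - lim.wmean (truncated f \<epsilon>)\<bar> < e / 4) sequentially"
    using LIMSEQ_D[OF continuous_tendsto[OF truncated_cont[OF f \<epsilon>]], of "e / 4"] e by (auto simp: eventually_sequentially)
  ultimately have "eventually (\<lambda>n. norm ((\<integral>\<omega>. W n \<omega> * f (Z n \<omega>) \<partial>M n) - (\<integral>\<omega>. W' \<omega> * f (Z' \<omega>) \<partial>M')) < e) sequentially"
  proof eventually_elim
    case (elim n)
    then show ?case
      using seq.truncation_error[OF f bd \<epsilon>, of n] lim.truncation_error[OF f bd \<epsilon>] i
      unfolding \<epsilon>_def real_norm_def by linarith
  qed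
  then show "\<exists>N. \<forall>n\<ge>N. norm ((\<integral>\<omega>. W n \<omega> * f (Z n \<omega>) \<partial>M n) - (\<integral>\<omega>. W' \<omega> * f (Z' \<omega>) \<partial>M')) < e"
    by (simp add: eventually_sequentially)
qed

end

section \<open>The scaling limit\<close>

lemma finite_state_space: "finite (state_space K :: (real ^ 'k) set)"
proof -
  have "(state_space K :: (real ^ 'k) set) \<subseteq> (\<lambda>f. \<chi> j. f j) ` (PiE UNIV (\<lambda>_. real ` {0..K}))"
  proof
    fix x :: "real ^ 'k" assume "x \<in> state_space K"
    then have "(\<lambda>j. x $ j) \<in> PiE UNIV (\<lambda>_. real ` {0..K})" "x = (\<chi> j. x $ j)"
      by (auto simp: state_space_def)
    then show "x \<in> (\<lambda>f. \<chi> j. f j) ` (PiE UNIV (\<lambda>_. real ` {0..K}))" by blast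
  qed
  then show ?thesis by (rule finite_subset) (intro finite_imageI finite_PiE, auto)
qed

lemma state_space_nonneg: "x \<in> state_space K \<Longrightarrow> 0 \<le> x $ j"
proof -
  assume "x \<in> state_space K"
  then have "x $ j \<in> real ` {0..K}" by (simp add: state_space_def)
  then show ?thesis by auto
qed

section \<open>Conditional laws with a discrete second component\<close>

lemma (in prob_space) integral_conditional_law:
  fixes f :: "'b::topological_space \<Rightarrow> real"
  assumes A: "A \<in> events" "0 < prob A" and Y[measurable]: "Y \<in> borel_measurable M" and f[measurable]: "f \<in> borel_measurable borel"
  shows "integral\<^sup>L (conditional_law M A Y) f = (\<integral>\<omega>. indicator A \<omega> * f (Y \<omega>) \<partial>M) / prob A"
proof -
  have "integral\<^sup>L (conditional_law M A Y) f = integral\<^sup>L (uniform_measure M A) (\<lambda>\<omega>. f (Y \<omega>))"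
    unfolding conditional_law_def
    by (rule integral_distr[OF _ f]) (use Y measurable_cong_sets[OF sets_uniform_measure refl] in blast)
  also have "uniform_measure M A = density M (\<lambda>\<omega>. ennreal (indicator A \<omega> / prob A))"
    unfolding uniform_measure_def
  proof (intro arg_cong2[where f=density] refl ext)
    fix \<omega> show "indicator A \<omega> / emeasure M A = ennreal (indicator A \<omega> / prob A)"
      using A(2) divide_ennreal[of 1 "prob A"] by (simp add: emeasure_eq_measure indicator_def)
  qed
  also have "integral\<^sup>L \<dots> (\<lambda>\<omega>. f (Y \<omega>)) = (\<integral>\<omega>. (indicator A \<omega> / prob A) *\<^sub>R f (Y \<omega>) \<partial>M)"
    using A by (intro integral_density) auto
  also have "\<dots> = (\<integral>\<omega>. (indicator A \<omega> * f (Y \<omega>)) / prob A \<partial>M)"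
    by (simp add: field_simps)
  finally show ?thesis by simp
qed

lemma (in prob_space) integral_conditional_law_const:
  fixes f :: "'b::topological_space \<Rightarrow> real"
  assumes A: "A \<in> events" "0 < prob A" and Y: "Y \<in> borel_measurable M" and f: "f \<in> borel_measurable borel"
    and c: "\<And>\<omega>. \<omega> \<in> A \<Longrightarrow> Y \<omega> = v"
  shows "integral\<^sup>L (conditional_law M A Y) f = f v"
proof -
  have "(\<integral>\<omega>. indicator A \<omega> * f (Y \<omega>) \<partial>M) = (\<integral>\<omega>. indicator A \<omega> * f v \<partial>M)"
    by (intro Bochner_Integration.integral_cong) (auto simp: indicator_def c)
  then show ?thesis
    unfolding integral_conditional_law[OF A Y f] using A by (simp add: Int_absorb1 sets.sets_into_space)
qed

text \<open>The second component takes finitely many values, so it can be fixed in the test function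
  and moved into the weight.\<close>

lemma (in prob_space) integral_split_finite:
  fixes f :: "(real ^ 'k) \<times> (real ^ 'k) \<Rightarrow> real"
  assumes "finite S" and A[measurable]: "A \<in> events" and Z[measurable]: "Z \<in> borel_measurable M" and Y[measurable]: "Y \<in> borel_measurable M"
    and YS: "\<And>\<omega>. \<omega> \<in> space M \<Longrightarrow> Y \<omega> \<in> S" and f: "continuous_on UNIV f" and b: "\<And>z. \<bar>f z\<bar> \<le> b"
  shows "(\<integral>\<omega>. indicator A \<omega> * f (Z \<omega>, Y \<omega>) \<partial>M) / c = (\<Sum>y\<in>S. \<integral>\<omega>. (indicator A \<omega> * of_bool (Y \<omega> = y) / c) * f (Z \<omega>, y) \<partial>M)"
proof -
  have fy: "continuous_on UNIV (\<lambda>z. f (z, y))" for y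
    by (rule continuous_on_compose2[OF f]) (auto intro!: continuous_intros)
  have [measurable]: "(\<lambda>z. f (z, y)) \<in> borel_measurable borel" for y by (rule borel_measurable_continuous_onI[OF fy])
  have int: "integrable M (\<lambda>\<omega>. indicator A \<omega> * of_bool (Y \<omega> = y) * f (Z \<omega>, y))" for y
  proof (rule integrable_const_bound[where B=b])
    show "AE \<omega> in M. norm (indicator A \<omega> * of_bool (Y \<omega> = y) * f (Z \<omega>, y)) \<le> b"
      using b order_trans[OF abs_ge_zero b] by (intro AE_I2) (auto simp: indicator_def)
  qed measurable
  have "(\<integral>\<omega>. indicator A \<omega> * f (Z \<omega>, Y \<omega>) \<partial>M) = (\<integral>\<omega>. (\<Sum>y\<in>S. indicator A \<omega> * of_bool (Y \<omega> = y) * f (Z \<omega>, y)) \<partial>M)"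
  proof (rule Bochner_Integration.integral_cong[OF refl])
    fix \<omega> assume w: "\<omega> \<in> space M"
    have "(\<Sum>y\<in>S. indicator A \<omega> * of_bool (Y \<omega> = y) * f (Z \<omega>, y)) = (\<Sum>y\<in>S. if Y \<omega> = y then indicator A \<omega> * f (Z \<omega>, y) else 0)"
      by (intro sum.cong) auto
    also have "\<dots> = indicator A \<omega> * f (Z \<omega>, Y \<omega>)" using assms(1) YS[OF w] by simp
    finally show "indicator A \<omega> * f (Z \<omega>, Y \<omega>) = (\<Sum>y\<in>S. indicator A \<omega> * of_bool (Y \<omega> = y) * f (Z \<omega>, y))" by simp
  qed
  also have "\<dots> = (\<Sum>y\<in>S. \<integral>\<omega>. indicator A \<omega> * of_bool (Y \<omega> = y) * f (Z \<omega>, y) \<partial>M)"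
    by (rule Bochner_Integration.integral_sum) (rule int)
  finally show ?thesis by (simp add: sum_divide_distrib)
qed

text \<open>The restriction to \<open>1 \<le> n\<close> reflects the model, which is scaled by
  powers of n; sequences are shifted by one and shifted back at the end. Transforms at natural
  numbers \<open>m\<close> are enough, as they are the means of monomials in
  \<open>expo\<close>.\<close>

lemma conditional_pair_convergence:
  fixes M :: "'a measure" and M' :: "'b measure" and Z :: "nat \<Rightarrow> 'a \<Rightarrow> real ^ 'k" and Y :: "nat \<Rightarrow> 'a \<Rightarrow> real ^ 'k"
    and Z' Y' :: "'b \<Rightarrow> real ^ 'k"
  assumes M: "prob_space M" and M': "prob_space M'" and S: "finite S"
    and A: "\<And>n. 1 \<le> n \<Longrightarrow> A n \<in> sets M" "\<And>n. 1 \<le> n \<Longrightarrow> measure M (A n) = mass" "0 < mass"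
    and A': "A' \<in> sets M'" "0 < measure M' A'"
    and Z: "\<And>n. 1 \<le> n \<Longrightarrow> Z n \<in> borel_measurable M" "\<And>n \<omega> j. 1 \<le> n \<Longrightarrow> \<omega> \<in> space M \<Longrightarrow> 0 \<le> Z n \<omega> $ j"
    and Y: "\<And>n. 1 \<le> n \<Longrightarrow> Y n \<in> borel_measurable M" "\<And>n \<omega>. 1 \<le> n \<Longrightarrow> \<omega> \<in> space M \<Longrightarrow> Y n \<omega> \<in> S"
    and Z': "Z' \<in> borel_measurable M'" "\<And>\<omega> j. \<omega> \<in> space M' \<Longrightarrow> 0 \<le> Z' \<omega> $ j"
    and Y': "Y' \<in> borel_measurable M'" "\<And>\<omega>. \<omega> \<in> space M' \<Longrightarrow> Y' \<omega> \<in> S"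
    and transform: "\<And>(m :: 'k \<Rightarrow> nat) y. y \<in> S \<Longrightarrow>
      (\<lambda>n. (\<integral>\<omega>. indicator (A n) \<omega> * exp (- (\<Sum>j\<in>UNIV. real (m j) * Z n \<omega> $ j)) * of_bool (Y n \<omega> = y) \<partial>M) / mass)
       \<longlonglongrightarrow> (\<integral>\<omega>. indicator A' \<omega> * exp (- (\<Sum>j\<in>UNIV. real (m j) * Z' \<omega> $ j)) * of_bool (Y' \<omega> = y) \<partial>M') / measure M' A'"
  shows "converges_weakly (\<lambda>n. conditional_law M (A n) (\<lambda>\<omega>. (Z n \<omega>, Y n \<omega>))) (conditional_law M' A' (\<lambda>\<omega>. (Z' \<omega>, Y' \<omega>)))"
  unfolding converges_weakly_def
proof (intro allI impI)
  fix f :: "(real ^ 'k) \<times> (real ^ 'k) \<Rightarrow> real"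
  assume f: "continuous_on UNIV f \<and> bounded (range f)"
  then obtain b where b: "\<And>z. \<bar>f z\<bar> \<le> b" by (auto simp: bounded_iff)
  have fc: "continuous_on UNIV f" and fm: "f \<in> borel_measurable borel"
    using f by (auto intro: borel_measurable_continuous_onI)
  interpret M: prob_space M by (rule M)
  interpret M': prob_space M' by (rule M')
  note [measurable] = A'(1) Z'(1) Y'(1)
  \<comment> \<open>A bound on the weights common to the sequence and to the limit.\<close>
  define c where "c = max (1 / mass) (1 / measure M' A')"
  have "(\<lambda>n. \<integral>\<omega>. (indicator (A (Suc n)) \<omega> * of_bool (Y (Suc n) \<omega> = y) / mass) * f (Z (Suc n) \<omega>, y) \<partial>M)
    \<longlonglongrightarrow> (\<integral>\<omega>. (indicator A' \<omega> * of_bool (Y' \<omega> = y) / measure M' A') * f (Z' \<omega>, y) \<partial>M')" if y: "y \<in> S" for y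
  proof -
    have bd: "0 \<le> indicator B \<omega> * of_bool Q / d \<and> indicator B \<omega> * of_bool Q / d \<le> 1 / d" if "0 < d"
      for B :: "'c set" and \<omega> Q and d :: real
      using that by (auto simp: indicator_def)
    have seq: "weighted_vector M (\<lambda>\<omega>. indicator (A (Suc n)) \<omega> * of_bool (Y (Suc n) \<omega> = y) / mass) (Z (Suc n)) c" for n
    proof
      have [measurable]: "A (Suc n) \<in> sets M" "Y (Suc n) \<in> borel_measurable M" using A(1)[of "Suc n"] Y(1)[of "Suc n"] by auto
      show "(\<lambda>\<omega>. indicator (A (Suc n)) \<omega> * of_bool (Y (Suc n) \<omega> = y) / mass) \<in> borel_measurable M" by measurable
      show "0 \<le> indicator (A (Suc n)) \<omega> * of_bool (Y (Suc n) \<omega> = y) / mass \<and> indicator (A (Suc n)) \<omega> * of_bool (Y (Suc n) \<omega> = y) / mass \<le> c" for \<omega>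
        using bd[OF A(3), of "A (Suc n)" \<omega> "Y (Suc n) \<omega> = y"] unfolding c_def by linarith
    qed (use Z(1)[of "Suc n"] Z(2)[of "Suc n"] in auto)
    have lim: "weighted_vector M' (\<lambda>\<omega>. indicator A' \<omega> * of_bool (Y' \<omega> = y) / measure M' A') Z' c"
    proof
      show "(\<lambda>\<omega>. indicator A' \<omega> * of_bool (Y' \<omega> = y) / measure M' A') \<in> borel_measurable M'" by measurable
      show "0 \<le> indicator A' \<omega> * of_bool (Y' \<omega> = y) / measure M' A' \<and> indicator A' \<omega> * of_bool (Y' \<omega> = y) / measure M' A' \<le> c" for \<omega>
        using bd[OF A'(2), of A' \<omega> "Y' \<omega> = y"] unfolding c_def by linarith
    qed (use Z' in auto)
    interpret W: weighted_vectors M' "\<lambda>\<omega>. indicator A' \<omega> * of_bool (Y' \<omega> = y) / measure M' A'" Z' c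
      "\<lambda>_. M" "\<lambda>n \<omega>. indicator (A (Suc n)) \<omega> * of_bool (Y (Suc n) \<omega> = y) / mass" "\<lambda>n. Z (Suc n)"
    proof (intro weighted_vectors.intro weighted_vectors_axioms.intro seq lim)
      fix m :: "'k \<Rightarrow> nat"
      have e: "indicator B \<omega> * of_bool Q / d * e = (indicator B \<omega> * e * of_bool Q) / d" for B :: "'c set" and \<omega> Q and d e :: real
        by simp
      show "(\<lambda>n. \<integral>\<omega>. indicator (A (Suc n)) \<omega> * of_bool (Y (Suc n) \<omega> = y) / mass * exp (- (\<Sum>j\<in>UNIV. real (m j) * Z (Suc n) \<omega> $ j)) \<partial>M)
        \<longlonglongrightarrow> (\<integral>\<omega>. indicator A' \<omega> * of_bool (Y' \<omega> = y) / measure M' A' * exp (- (\<Sum>j\<in>UNIV. real (m j) * Z' \<omega> $ j)) \<partial>M')"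
        unfolding e using LIMSEQ_Suc[OF transform[OF y, of m]] by simp
    qed
    have fy: "continuous_on UNIV (\<lambda>z. f (z, y))"
      by (rule continuous_on_compose2[OF fc]) (auto intro!: continuous_intros)
    show ?thesis by (rule W.weighted_convergence[OF fy b])
  qed
  then have lim: "(\<lambda>n. \<Sum>y\<in>S. \<integral>\<omega>. (indicator (A (Suc n)) \<omega> * of_bool (Y (Suc n) \<omega> = y) / mass) * f (Z (Suc n) \<omega>, y) \<partial>M)
    \<longlonglongrightarrow> (\<Sum>y\<in>S. \<integral>\<omega>. (indicator A' \<omega> * of_bool (Y' \<omega> = y) / measure M' A') * f (Z' \<omega>, y) \<partial>M')"
    by (rule tendsto_sum)
  have e1: "integral\<^sup>L (conditional_law M (A (Suc n)) (\<lambda>\<omega>. (Z (Suc n) \<omega>, Y (Suc n) \<omega>))) f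
    = (\<Sum>y\<in>S. \<integral>\<omega>. (indicator (A (Suc n)) \<omega> * of_bool (Y (Suc n) \<omega> = y) / mass) * f (Z (Suc n) \<omega>, y) \<partial>M)" for n
  proof -
    have n: "1 \<le> Suc n" by simp
    have [measurable]: "Z (Suc n) \<in> borel_measurable M" "Y (Suc n) \<in> borel_measurable M" by (rule Z(1)[OF n], rule Y(1)[OF n])
    have pm: "(\<lambda>\<omega>. (Z (Suc n) \<omega>, Y (Suc n) \<omega>)) \<in> borel_measurable M" by measurable
    have "integral\<^sup>L (conditional_law M (A (Suc n)) (\<lambda>\<omega>. (Z (Suc n) \<omega>, Y (Suc n) \<omega>))) f
      = (\<integral>\<omega>. indicator (A (Suc n)) \<omega> * f (Z (Suc n) \<omega>, Y (Suc n) \<omega>) \<partial>M) / mass"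
      using M.integral_conditional_law[OF A(1)[OF n] _ pm fm] A(2)[OF n] A(3) by simp
    also have "\<dots> = (\<Sum>y\<in>S. \<integral>\<omega>. (indicator (A (Suc n)) \<omega> * of_bool (Y (Suc n) \<omega> = y) / mass) * f (Z (Suc n) \<omega>, y) \<partial>M)"
      by (rule M.integral_split_finite[OF S A(1)[OF n] Z(1)[OF n] Y(1)[OF n] Y(2)[OF n] fc b])
    finally show ?thesis .
  qed
  have e2: "integral\<^sup>L (conditional_law M' A' (\<lambda>\<omega>. (Z' \<omega>, Y' \<omega>))) f
    = (\<Sum>y\<in>S. \<integral>\<omega>. (indicator A' \<omega> * of_bool (Y' \<omega> = y) / measure M' A') * f (Z' \<omega>, y) \<partial>M')"
  proof -
    have pm: "(\<lambda>\<omega>. (Z' \<omega>, Y' \<omega>)) \<in> borel_measurable M'" by measurable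
    have "integral\<^sup>L (conditional_law M' A' (\<lambda>\<omega>. (Z' \<omega>, Y' \<omega>))) f
      = (\<integral>\<omega>. indicator A' \<omega> * f (Z' \<omega>, Y' \<omega>) \<partial>M') / measure M' A'"
      by (rule M'.integral_conditional_law[OF A' pm fm])
    also have "\<dots> = (\<Sum>y\<in>S. \<integral>\<omega>. (indicator A' \<omega> * of_bool (Y' \<omega> = y) / measure M' A') * f (Z' \<omega>, y) \<partial>M')"
      by (rule M'.integral_split_finite[OF S A'(1) Z'(1) Y'(1) Y'(2) fc b])
    finally show ?thesis .
  qed
  have "(\<lambda>n. integral\<^sup>L (conditional_law M (A (Suc n)) (\<lambda>\<omega>. (Z (Suc n) \<omega>, Y (Suc n) \<omega>))) f)
    \<longlonglongrightarrow> integral\<^sup>L (conditional_law M' A' (\<lambda>\<omega>. (Z' \<omega>, Y' \<omega>))) f"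
    unfolding e1 e2 by (rule lim)
  then show "(\<lambda>n. integral\<^sup>L (conditional_law M (A n) (\<lambda>\<omega>. (Z n \<omega>, Y n \<omega>))) f)
    \<longlonglongrightarrow> integral\<^sup>L (conditional_law M' A' (\<lambda>\<omega>. (Z' \<omega>, Y' \<omega>))) f"
    by (rule LIMSEQ_imp_Suc)
qed

section \<open>Limits and expansions of the weights\<close>

lemma scaled_one_minus_exp_bounds:
  fixes b c :: real
  assumes "0 \<le> b" "0 < c"
  shows "c * (1 - exp (- (b / c))) \<le> b" "b - b\<^sup>2 / c \<le> c * (1 - exp (- (b / c)))"
proof -
  have "1 - exp (- (b / c)) \<le> b / c" using exp_ge_add_one_self[of "- (b / c)"] by simp
  then have "c * (1 - exp (- (b / c))) \<le> c * (b / c)" using assms by (intro mult_left_mono) auto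
  then show "c * (1 - exp (- (b / c))) \<le> b" using assms by simp
  have "b / c - (b / c)\<^sup>2 \<le> 1 - exp (- (b / c))" using exp_minus_le_quadratic[of "b / c"] assms by simp
  then have "c * (b / c - (b / c)\<^sup>2) \<le> c * (1 - exp (- (b / c)))" using assms by (intro mult_left_mono) auto
  moreover have "c * (b / c - (b / c)\<^sup>2) = b - b\<^sup>2 / c" using assms by (simp add: power2_eq_square right_diff_distrib)
  ultimately show "b - b\<^sup>2 / c \<le> c * (1 - exp (- (b / c)))" by simp
qed

lemma powr_seq_at_top:
  assumes "0 < \<beta>"
  shows "filterlim (\<lambda>n. real n powr \<beta>) at_top sequentially"
proof -
  have "filterlim (\<lambda>n. exp (\<beta> * ln (real n))) at_top sequentially"
    by (intro filterlim_compose[OF exp_at_top] filterlim_tendsto_pos_mult_at_top[OF tendsto_const assms]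
        filterlim_compose[OF ln_at_top] filterlim_real_sequentially)
  moreover have "eventually (\<lambda>n. exp (\<beta> * ln (real n)) = real n powr \<beta>) sequentially"
    using eventually_gt_at_top[of 0] by eventually_elim (simp add: powr_def)
  ultimately show ?thesis by (simp cong: filterlim_cong)
qed

lemma scaled_one_minus_exp_tendsto:
  fixes b :: real and c :: "nat \<Rightarrow> real"
  assumes b: "0 \<le> b" and c: "filterlim c at_top sequentially"
  shows "(\<lambda>n. c n * (1 - exp (- (b / c n)))) \<longlonglongrightarrow> b"
proof (rule tendsto_sandwich)
  have pos: "eventually (\<lambda>n. 0 < c n) sequentially" using c by (simp add: filterlim_at_top_dense)
  show "eventually (\<lambda>n. b - b\<^sup>2 / c n \<le> c n * (1 - exp (- (b / c n)))) sequentially"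
    using pos by eventually_elim (rule scaled_one_minus_exp_bounds[OF b])
  show "eventually (\<lambda>n. c n * (1 - exp (- (b / c n))) \<le> b) sequentially"
    using pos by eventually_elim (rule scaled_one_minus_exp_bounds[OF b])
  have "(\<lambda>n. b - b\<^sup>2 / c n) \<longlonglongrightarrow> b - 0"
    by (intro tendsto_diff tendsto_const tendsto_divide_0[OF tendsto_const] filterlim_at_top_imp_at_infinity c)
  then show "(\<lambda>n. b - b\<^sup>2 / c n) \<longlonglongrightarrow> b" by simp
qed simp

text \<open>The expansion of the fluid weight. The single constant \<open>H + H\<^sup>2\<close>
  serves the first-order and the second-order bound.\<close>

lemma exponential_factor_bounds:
  fixes \<eta> H :: real
  assumes "0 \<le> \<eta>" "0 \<le> H"
  shows "0 \<le> exp (- (\<eta> * H)) \<and> exp (- (\<eta> * H)) \<le> 1" "1 - exp (- (\<eta> * H)) \<le> (H + H\<^sup>2) * \<eta>"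
    "\<bar>exp (- (\<eta> * H)) - (1 - \<eta> * H)\<bar> \<le> (H + H\<^sup>2) * \<eta>\<^sup>2"
proof -
  have p: "0 \<le> \<eta> * H" using assms by simp
  show "0 \<le> exp (- (\<eta> * H)) \<and> exp (- (\<eta> * H)) \<le> 1" using p by simp
  have l: "1 - \<eta> * H \<le> exp (- (\<eta> * H))" using exp_ge_add_one_self[of "- (\<eta> * H)"] by simp
  have "1 - exp (- (\<eta> * H)) \<le> H * \<eta>" using l by (simp add: mult.commute)
  also have "\<dots> \<le> (H + H\<^sup>2) * \<eta>" using assms by (intro mult_right_mono) auto
  finally show "1 - exp (- (\<eta> * H)) \<le> (H + H\<^sup>2) * \<eta>" .
  have "\<bar>exp (- (\<eta> * H)) - (1 - \<eta> * H)\<bar> \<le> H\<^sup>2 * \<eta>\<^sup>2"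
    using l exp_minus_le_quadratic[OF p] by (simp add: power_mult_distrib mult.commute)
  also have "\<dots> \<le> (H + H\<^sup>2) * \<eta>\<^sup>2" using assms by (intro mult_right_mono) auto
  finally show "\<bar>exp (- (\<eta> * H)) - (1 - \<eta> * H)\<bar> \<le> (H + H\<^sup>2) * \<eta>\<^sup>2" .
qed

text \<open>The expansion of the jump weight: \<open>1 - exp (- \<eta>)\<close> lies between
  \<open>\<eta> - \<eta>\<^sup>2\<close> and \<open>\<eta>\<close>, and the product over coordinates
  is linearized.\<close>

lemma product_factor_bounds:
  fixes \<eta> :: real and h :: "'k::finite \<Rightarrow> real"
  assumes \<eta>: "0 \<le> \<eta>" and h: "\<And>j. 0 \<le> h j" "\<And>j. h j \<le> 1"
  defines "H \<equiv> \<Sum>j\<in>UNIV. h j" and "E \<equiv> \<Prod>j\<in>UNIV. 1 - h j * (1 - exp (- \<eta>))"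
  shows "0 \<le> E \<and> E \<le> 1" "1 - E \<le> (H + H\<^sup>2) * \<eta>" "\<bar>E - (1 - \<eta> * H)\<bar> \<le> (H + H\<^sup>2) * \<eta>\<^sup>2"
proof -
  define b where "b = 1 - exp (- \<eta>)"
  have b: "0 \<le> b" "b \<le> 1" "b \<le> \<eta>" "\<eta> - \<eta>\<^sup>2 \<le> b"
    using \<eta> exp_ge_add_one_self[of "- \<eta>"] exp_minus_le_quadratic[OF \<eta>] by (auto simp: b_def)
  have x: "0 \<le> h j * b" "h j * b \<le> 1" for j using h[of j] b by (auto intro: mult_le_one)
  have H: "0 \<le> H" unfolding H_def using h by (intro sum_nonneg)
  have s: "(\<Sum>j\<in>UNIV. h j * b) = H * b" by (simp add: H_def sum_distrib_right)
  have E: "1 - H * b \<le> E" "E \<le> 1 - H * b + (H * b)\<^sup>2"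
    using prod_one_minus_bounds[of UNIV "\<lambda>j. h j * b"] x unfolding s by (auto simp: E_def b_def)
  show "0 \<le> E \<and> E \<le> 1"
    unfolding E_def b_def[symmetric] using x by (auto intro!: prod_nonneg prod_le_1)
  have Hb: "H * b \<le> H * \<eta>" using H b by (intro mult_left_mono) auto
  have "1 - E \<le> H * \<eta>" using E Hb by linarith
  also have "\<dots> \<le> (H + H\<^sup>2) * \<eta>" using \<eta> by (intro mult_right_mono) auto
  finally show "1 - E \<le> (H + H\<^sup>2) * \<eta>" .
  have "H * (\<eta> - \<eta>\<^sup>2) \<le> H * b" using H b by (intro mult_left_mono) auto
  moreover have "(H * b)\<^sup>2 \<le> (H * \<eta>)\<^sup>2" using Hb H b by (intro power_mono) auto
  ultimately show "\<bar>E - (1 - \<eta> * H)\<bar> \<le> (H + H\<^sup>2) * \<eta>\<^sup>2"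
    using E Hb H by (simp add: abs_le_iff algebra_simps power_mult_distrib)
qed

text \<open>The setting of the theorem, with the transition function \<open>p\<close> of the limit
  chain, which \<open>ct_markov_chain\<close> gives only existentially, fixed as a
  parameter.\<close>

locale scaling_limit =
  fixes K :: nat
    and P :: "real ^ 'k \<Rightarrow> real ^ 'k \<Rightarrow> real"
    and \<pi> :: "real ^ 'k \<Rightarrow> real"
    and lam \<gamma> \<alpha> t :: real
    and M :: "'a measure"
    and N :: "nat \<Rightarrow> real \<Rightarrow> 'a \<Rightarrow> nat"
    and X :: "nat \<Rightarrow> nat \<Rightarrow> 'a \<Rightarrow> real ^ 'k"
    and L :: "nat \<Rightarrow> 'k \<Rightarrow> 'a \<Rightarrow> real"
    and M' :: "'b measure"
    and \<X> :: "real \<Rightarrow> 'b \<Rightarrow> real ^ 'k"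
    and \<nu> :: "'k \<Rightarrow> real \<Rightarrow> 'b \<Rightarrow> nat"
    and S :: "(real ^ 'k) set"
    and p :: "real \<Rightarrow> real \<Rightarrow> real ^ 'k \<Rightarrow> real ^ 'k \<Rightarrow> real"
  assumes S_def: "S = state_space K"
    and rates: "0 < lam" "0 < \<gamma>" "0 < \<alpha>" "\<alpha> < 1"
    and stochP: "stochastic_matrix_on S P"
    and M: "prob_space M"
    and service: "service_times M \<alpha> L"
    and arrivals: "\<And>n. 1 \<le> n \<Longrightarrow> poisson_process M {0..} (lam * real n powr \<gamma>) (N n)"
    and chain: "\<And>n. 1 \<le> n \<Longrightarrow> markov_chain M S \<pi> (rescaled_matrix \<gamma> P n) (X n)"
    and indep: "\<And>n. 1 \<le> n \<Longrightarrow> prob_space.indep_sets M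
           (\<lambda>m. [generated_events M (count_space UNIV) (N n) {0..},
                 generated_events M borel (X n) UNIV,
                 generated_events M borel (\<lambda>(i, j). L i j) UNIV] ! m) {..<3}"
    and M': "prob_space M'"
    and \<X>: "ct_markov_chain M' S \<pi> (limit_generator \<alpha> lam P) \<X>"
    and tf: "transition_function S p" and gen: "has_generator S p (limit_generator \<alpha> lam P)"
    and law: "\<And>m s x. (\<forall>i\<le>Suc m. s i \<in> {0..1} \<and> x i \<in> S) \<Longrightarrow> (\<forall>i\<le>m. s i < s (Suc i)) \<Longrightarrow>
            \<P>(\<omega> in M'. \<forall>i\<le>m. \<X> (s i) \<omega> = x i) > 0 \<Longrightarrow>
          \<P>(\<omega> in M'. \<X> (s (Suc m)) \<omega> = x (Suc m) \<bar> \<forall>i\<le>m. \<X> (s i) \<omega> = x i)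
            = p (s m) (s (Suc m)) (x m) (x (Suc m))"
    and \<nu>: "\<And>j. poisson_process M' {0..1} (lam / (1 - \<alpha>)) (\<nu> j)"
    and indep': "prob_space.indep_sets M'
           (\<lambda>m. case m of
                  None \<Rightarrow> generated_events M' borel \<X> {0..1}
                | Some j \<Rightarrow> generated_events M' (count_space UNIV) (\<nu> j) {0..1}) UNIV"
    and t: "0 \<le> t" "t \<le> 1"
begin

sublocale M: prob_space M by (rule M)
sublocale M': prob_space M' by (rule M')
sublocale time_changed_chain S P \<alpha> lam p
  by unfold_locales (use S_def finite_state_space stochP rates tf gen in auto)

definition a :: real where "a = 1 - t powr (1 - \<alpha>)"

definition Z :: "nat \<Rightarrow> 'a \<Rightarrow> real ^ 'k" where
  "Z n = queue_process (N n) (X n) (\<lambda>i j \<omega>. L i j \<omega> / real n) t"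

abbreviation queue_laplace :: "('k \<Rightarrow> nat) \<Rightarrow> real ^ 'k \<Rightarrow> real ^ 'k \<Rightarrow> nat \<Rightarrow> real" where
  "queue_laplace m x y n \<equiv> \<integral>\<omega>. indicator {\<omega> \<in> space M. X n 0 \<omega> = x} \<omega> *
     exp (- (\<Sum>j\<in>UNIV. real (m j) * (Z n \<omega> /\<^sub>R real n powr (\<gamma> - \<alpha>)) $ j)) * of_bool (X n (N n t \<omega>) \<omega> = y) \<partial>M"

abbreviation fluid_integral :: "'b \<Rightarrow> real ^ 'k" where
  "fluid_integral \<omega> \<equiv> (lam / (1 - \<alpha>)) *\<^sub>R (LINT v:{a..1}|lborel. \<X> v \<omega>)"

abbreviation jump_vector :: "'b \<Rightarrow> real ^ 'k" where
  "jump_vector \<omega> \<equiv> \<chi> j. jump_integral a 1 (\<lambda>v. \<X> v \<omega> $ j) (\<lambda>v. \<nu> j v \<omega>)"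

lemma a01: "0 \<le> a" "a \<le> 1"
  using t par powr_le1[of "1 - \<alpha>" t] by (auto simp: a_def)

lemma S_nonneg: "x \<in> S \<Longrightarrow> 0 \<le> x $ j"
  unfolding S_def by (rule state_space_nonneg)

lemma \<X>_meas: "v \<in> {0..1} \<Longrightarrow> \<X> v \<in> borel_measurable M'"
  and \<X>_in: "v \<in> {0..1} \<Longrightarrow> \<omega> \<in> space M' \<Longrightarrow> \<X> v \<omega> \<in> S"
  and \<X>_right: "v \<in> {0..<1} \<Longrightarrow> \<omega> \<in> space M' \<Longrightarrow> ((\<lambda>v. \<X> v \<omega>) \<longlongrightarrow> \<X> v \<omega>) (at_right v)"
  and \<X>_init: "x \<in> S \<Longrightarrow> M'.prob {\<omega> \<in> space M'. \<X> 0 \<omega> = x} = \<pi> x"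
  using \<X> by (auto simp: ct_markov_chain_def)

definition F :: "'k \<Rightarrow> real \<Rightarrow> real" where
  "F j z = M.prob {\<omega> \<in> space M. L 0 j \<omega> > z}"

lemma L_indep: "M.indep_vars (\<lambda>_. borel) (\<lambda>(i, j). L i j) UNIV"
  using service by (simp add: service_times_def)

lemma L_meas [measurable]: "L i j \<in> borel_measurable M"
  using L_indep unfolding M.indep_vars_def by (metis (mono_tags, lifting) UNIV_I case_prod_conv)

text \<open>The equality of laws is given for whole vectors; the tail is read off at a
  half-space.\<close>

lemma L_tail: "M.prob {\<omega> \<in> space M. L i j \<omega> > z} = F j z"
proof -
  have m: "(\<lambda>\<omega>. (\<chi> j. L i j \<omega>) :: real ^ 'k) \<in> borel_measurable M" for i
    by (intro borel_measurable_vecI) simp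
  have "M.prob {\<omega> \<in> space M. L i j \<omega> > z} = measure (distr M borel (\<lambda>\<omega>. (\<chi> j. L i j \<omega>) :: real ^ 'k)) {v. v $ j > z}" for i
  proof (subst measure_distr[OF m])
    have "open {v :: real ^ 'k. v $ j > z}" by (intro open_Collect_less continuous_intros)
    then show "{v :: real ^ 'k. v $ j > z} \<in> sets borel" by simp
  qed (auto intro!: arg_cong[where f="M.prob"])
  moreover have "distr M borel (\<lambda>\<omega>. (\<chi> j. L i j \<omega>) :: real ^ 'k) = distr M borel (\<lambda>\<omega>. \<chi> j. L 0 j \<omega>)"
    using service by (simp add: service_times_def)
  ultimately show ?thesis by (simp add: F_def)
qed

lemma F_bounds: "0 \<le> F j z" "F j z \<le> 1"
  by (simp_all add: F_def)

lemma F_antimono: "x \<le> y \<Longrightarrow> F j y \<le> F j x"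
  unfolding F_def by (intro M.finite_measure_mono) auto

lemma F_lim: "((\<lambda>x. F j x * x powr \<alpha>) \<longlongrightarrow> 1) at_top"
proof -
  have "(\<lambda>z. F j z) \<sim>[at_top] (\<lambda>z. z powr (- \<alpha>))"
    using service by (simp add: service_times_def F_def)
  from asymp_equivD[OF this]
  have "((\<lambda>x. if F j x = 0 \<and> x powr (- \<alpha>) = 0 then 1 else F j x / x powr (- \<alpha>)) \<longlongrightarrow> 1) at_top" .
  moreover have "eventually (\<lambda>x. (if F j x = 0 \<and> x powr (- \<alpha>) = 0 then 1 else F j x / x powr (- \<alpha>)) = F j x * x powr \<alpha>) at_top"
    using eventually_gt_at_top[of 0] by eventually_elim (simp add: powr_minus divide_inverse)
  ultimately show ?thesis by (rule Lim_transform_eventually)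
qed

text \<open>The chain may stay: the mass at time \<open>a\<close> is at least that of being in
  \<open>x\<close> at times 0 and \<open>a\<close>, a product of \<open>\<pi> x\<close> and a
  positive diagonal entry. The case \<open>a = 0\<close> is separate because the Markov property is
  given for strictly increasing times.\<close>

lemma start_pos:
  assumes "x \<in> S" "0 < \<pi> x"
  shows "0 < M'.prob {\<omega> \<in> space M'. \<X> a \<omega> = x}"
proof (cases "a = 0")
  case True
  then show ?thesis using assms \<X>_init by simp
next
  case False
  then have a: "0 < a" using a01 by simp
  define s where "s i = (if i = 0 then 0 else a)" for i :: nat
  have [measurable]: "\<X> 0 \<in> borel_measurable M'" "\<X> a \<in> borel_measurable M'" using a01 by (auto intro: \<X>_meas)
  have "cond_prob M' (\<lambda>\<omega>. \<X> (s (Suc 0)) \<omega> = x) (\<lambda>\<omega>. \<forall>i\<le>0. \<X> (s i) \<omega> = x) = p (s 0) (s (Suc 0)) x x"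
    using law[of 0 s "\<lambda>_. x"] assms a a01 \<X>_init by (auto simp: s_def)
  moreover have "0 < p (s 0) (s (Suc 0)) x x"
    using p_diag_pos[of a x] assms a01 by (simp add: s_def)
  ultimately have "0 < cond_prob M' (\<lambda>\<omega>. \<X> a \<omega> = x) (\<lambda>\<omega>. \<X> 0 \<omega> = x)" by (simp add: s_def)
  then have "0 < M'.prob {\<omega> \<in> space M'. \<X> a \<omega> = x \<and> \<X> 0 \<omega> = x}"
    unfolding cond_prob_def using assms \<X>_init by (simp add: zero_less_divide_iff)
  also have "\<dots> \<le> M'.prob {\<omega> \<in> space M'. \<X> a \<omega> = x}" by (intro M'.finite_measure_mono) auto
  finally show ?thesis .
qed

lemma X0_event: "1 \<le> n \<Longrightarrow> {\<omega> \<in> space M. X n 0 \<omega> = x} \<in> sets M"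
proof -
  assume "1 \<le> n"
  then have [measurable]: "X n 0 \<in> borel_measurable M" using chain by (simp add: markov_chain_def)
  show ?thesis by measurable
qed

lemma X0_prob: "1 \<le> n \<Longrightarrow> x \<in> S \<Longrightarrow> M.prob {\<omega> \<in> space M. X n 0 \<omega> = x} = \<pi> x"
  using chain by (simp add: markov_chain_def)

lemma Xa_event: "{\<omega> \<in> space M'. \<X> a \<omega> = x} \<in> sets M'"
proof -
  have [measurable]: "\<X> a \<in> borel_measurable M'" using a01 by (intro \<X>_meas) auto
  show ?thesis by measurable
qed

lemma \<X>_1: "\<X> 1 \<in> borel_measurable M'" "\<omega> \<in> space M' \<Longrightarrow> \<X> 1 \<omega> \<in> S"
  by (auto intro: \<X>_meas \<X>_in)

text \<open>Here \<open>a = 1\<close>, and both conditional laws integrate like the point mass at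
  \<open>(0, x)\<close>. The grid degenerates, so this case is kept apart from the
  transforms.\<close>

lemma time_zero:
  assumes "t = 0" and x: "x \<in> S" "0 < \<pi> x" and Z': "\<And>\<omega>. \<omega> \<in> space M' \<Longrightarrow> Z' \<omega> = 0"
  shows "converges_weakly (\<lambda>n. conditional_law M {\<omega> \<in> space M. X n 0 \<omega> = x} (\<lambda>\<omega>. (Z n \<omega> /\<^sub>R r n, X n (N n t \<omega>) \<omega>)))
    (conditional_law M' {\<omega> \<in> space M'. \<X> a \<omega> = x} (\<lambda>\<omega>. (Z' \<omega>, \<X> 1 \<omega>)))"
  unfolding converges_weakly_def
proof (intro allI impI)
  fix f :: "(real ^ 'k) \<times> (real ^ 'k) \<Rightarrow> real"
  assume f: "continuous_on UNIV f \<and> bounded (range f)"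
  then have fm: "f \<in> borel_measurable borel" by (auto intro: borel_measurable_continuous_onI)
  have a: "a = 1" unfolding a_def using assms(1) by simp
  have e1: "integral\<^sup>L (conditional_law M {\<omega> \<in> space M. X n 0 \<omega> = x} (\<lambda>\<omega>. (Z n \<omega> /\<^sub>R r n, X n (N n t \<omega>) \<omega>))) f = f (0, x)"
    if n: "1 \<le> n" for n
  proof (rule M.integral_conditional_law_const[OF X0_event[OF n] _ _ fm])
    have N0: "N n t \<omega> = 0" if "\<omega> \<in> space M" for \<omega>
      using arrivals[OF n] that assms(1) by (simp add: poisson_process_def)
    have Z0: "Z n \<omega> = 0" if "\<omega> \<in> space M" for \<omega>
      using N0[OF that] by (simp add: Z_def queue_process_def vec_eq_iff)
    have [measurable]: "X n 0 \<in> borel_measurable M" using chain[OF n] by (simp add: markov_chain_def)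
    have "(\<lambda>\<omega>. (0 :: real ^ 'k, X n 0 \<omega>)) \<in> borel_measurable M" by measurable
    also have "?this \<longleftrightarrow> (\<lambda>\<omega>. (Z n \<omega> /\<^sub>R r n, X n (N n t \<omega>) \<omega>)) \<in> borel_measurable M"
      by (rule measurable_cong) (simp add: Z0 N0)
    finally show "(\<lambda>\<omega>. (Z n \<omega> /\<^sub>R r n, X n (N n t \<omega>) \<omega>)) \<in> borel_measurable M" .
    show "0 < M.prob {\<omega> \<in> space M. X n 0 \<omega> = x}" using X0_prob[OF n x(1)] x(2) by simp
    show "(Z n \<omega> /\<^sub>R r n, X n (N n t \<omega>) \<omega>) = (0, x)" if "\<omega> \<in> {\<omega> \<in> space M. X n 0 \<omega> = x}" for \<omega>
      using that by (simp add: Z0 N0)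
  qed
  have e2: "integral\<^sup>L (conditional_law M' {\<omega> \<in> space M'. \<X> a \<omega> = x} (\<lambda>\<omega>. (Z' \<omega>, \<X> 1 \<omega>))) f = f (0, x)"
  proof (rule M'.integral_conditional_law_const[OF Xa_event start_pos[OF x] _ fm])
    have [measurable]: "\<X> 1 \<in> borel_measurable M'" by (rule \<X>_1)
    have "(\<lambda>\<omega>. (0 :: real ^ 'k, \<X> 1 \<omega>)) \<in> borel_measurable M'" by measurable
    also have "?this \<longleftrightarrow> (\<lambda>\<omega>. (Z' \<omega>, \<X> 1 \<omega>)) \<in> borel_measurable M'"
      by (rule measurable_cong) (simp add: Z')
    finally show "(\<lambda>\<omega>. (Z' \<omega>, \<X> 1 \<omega>)) \<in> borel_measurable M'" .
  qed (use a Z' in auto)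
  show "(\<lambda>n. integral\<^sup>L (conditional_law M {\<omega> \<in> space M. X n 0 \<omega> = x} (\<lambda>\<omega>. (Z n \<omega> /\<^sub>R r n, X n (N n t \<omega>) \<omega>))) f)
    \<longlonglongrightarrow> integral\<^sup>L (conditional_law M' {\<omega> \<in> space M'. \<X> a \<omega> = x} (\<lambda>\<omega>. (Z' \<omega>, \<X> 1 \<omega>))) f"
    unfolding e2 by (rule tendsto_eventually) (auto simp: e1 intro!: eventually_sequentiallyI[of 1])
qed

lemma queue_locale:
  assumes "1 \<le> n" "0 < t" "\<And>j. 0 \<le> s j"
  shows "rescaled_queue M S (rescaled_matrix \<gamma> P n) \<pi> (N n) (X n) L (lam * real n powr \<gamma>) (real n) t F s"
proof
  show "stochastic_matrix_on S (rescaled_matrix \<gamma> P n)"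
    by (rule rescaled_stochastic[OF finS stochP]) (use assms(1) rates in auto)
qed (use assms S_nonneg finS arrivals chain L_indep L_tail indep rates in auto)

lemma limit_locale:
  assumes "0 < t" "\<And>j. 0 \<le> s j"
  shows "limit_model M' S P \<alpha> lam p (time_grid \<alpha> t) a (\<lambda>q. (t / real q) powr (1 - \<alpha>)) \<X> \<nu> s"
proof (intro limit_model.intro)
  show "refining_partitions (time_grid \<alpha> t) a (\<lambda>q. (t / real q) powr (1 - \<alpha>))"
    unfolding a_def using assms(1) par by (intro refining_time_grid)
  show "prob_space M'" by (rule M')
  show "time_changed_chain S P \<alpha> lam p" by (rule time_changed_chain_axioms)
  show "limit_model_axioms M' S \<alpha> lam p a \<X> \<nu> s"
    by unfold_locales (use \<X>_meas \<X>_in \<X>_right law S_nonneg assms a01 \<nu> indep' in auto)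
qed

lemma queue_measurable_nonneg:
  assumes "1 \<le> n" "0 < t"
  shows "Z n \<in> borel_measurable M" "(\<lambda>\<omega>. X n (N n t \<omega>) \<omega>) \<in> borel_measurable M"
    "\<omega> \<in> space M \<Longrightarrow> 0 \<le> Z n \<omega> $ j" "\<omega> \<in> space M \<Longrightarrow> X n (N n t \<omega>) \<omega> \<in> S"
proof -
  interpret Q: rescaled_queue M S "rescaled_matrix \<gamma> P n" \<pi> "N n" "X n" L "lam * real n powr \<gamma>" "real n" t F "\<lambda>_. 0"
    by (rule queue_locale) (use assms in auto)
  show "Z n \<in> borel_measurable M" unfolding Z_def by (rule Q.queue_measurable)
  show "(\<lambda>\<omega>. X n (N n t \<omega>) \<omega>) \<in> borel_measurable M" by (rule Q.terminal_measurable)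
  show "\<omega> \<in> space M \<Longrightarrow> X n (N n t \<omega>) \<omega> \<in> S" by (rule Q.X_in)
  show "\<omega> \<in> space M \<Longrightarrow> 0 \<le> Z n \<omega> $ j"
    unfolding Z_def queue_process_def using Q.X_in S_nonneg by (auto intro!: sum_nonneg)
qed

text \<open>Scaling \<open>Z\<close> by \<open>n powr (\<gamma> - \<alpha>)\<close> divides the
  argument of the transform, which gives the weights \<open>w\<close>. Both regimes enter through
  \<open>h\<close>, the limit of the scaled weights, and through the cell weight \<open>E\<close> of
  the limit.\<close>

lemma transform_convergence:
  fixes m :: "'k \<Rightarrow> nat"
  assumes t0: "0 < t" and xy: "x \<in> S" "y \<in> S" and \<pi>: "0 < \<pi> x"
    and h: "\<And>y j. y \<in> S \<Longrightarrow>
      (\<lambda>n. real n powr (\<gamma> - \<alpha>) * (1 - exp (- (real (m j) / real n powr (\<gamma> - \<alpha>) * y $ j)))) \<longlonglongrightarrow> h y j"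
    and cE: "0 \<le> cE"
    and E: "\<And>q l y. l < q \<Longrightarrow> y \<in> S \<Longrightarrow> 0 \<le> E q l y \<and> E q l y \<le> 1"
    and E1: "\<And>q l y. l < q \<Longrightarrow> y \<in> S \<Longrightarrow>
      1 - E q l y \<le> cE * (lam / (1 - \<alpha>) * (time_grid \<alpha> t q (Suc l) - time_grid \<alpha> t q l))"
    and E2: "\<And>q l y. l < q \<Longrightarrow> y \<in> S \<Longrightarrow>
      \<bar>E q l y - (1 - lam / (1 - \<alpha>) * (time_grid \<alpha> t q (Suc l) - time_grid \<alpha> t q l) * (\<Sum>j\<in>UNIV. h y j))\<bar>
        \<le> cE * (lam / (1 - \<alpha>) * (time_grid \<alpha> t q (Suc l) - time_grid \<alpha> t q l))\<^sup>2"
    and lim: "(\<lambda>q. d * path_weight S (\<lambda>l z y. p (time_grid \<alpha> t (Suc q) l) (time_grid \<alpha> t (Suc q) (Suc l)) z y * E (Suc q) l y) x (Suc q) y)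
      \<longlonglongrightarrow> R" and d: "0 < d"
  shows "(\<lambda>n. queue_laplace m x y n / \<pi> x)
    \<longlonglongrightarrow> R / d"
proof -
  define w where "w n y j = 1 - exp (- (real (m j) / real n powr (\<gamma> - \<alpha>) * y $ j))" for n and y :: "real ^ 'k" and j
  have thin: "thinned_tails F (\<lambda>n j. w n y j) (\<lambda>j. real (m j) * y $ j) (h y) \<alpha> \<gamma>" if y: "y \<in> S" for y
  proof
    fix n j
    have p: "0 \<le> real (m j) / real n powr (\<gamma> - \<alpha>) * y $ j" using S_nonneg[OF y] by simp
    show "0 \<le> w n y j" "w n y j \<le> 1" using p by (auto simp: w_def)
    show "real n powr (\<gamma> - \<alpha>) * w n y j \<le> real (m j) * y $ j" if "1 \<le> n"
      using scaled_one_minus_exp_bounds(1)[of "real (m j) * y $ j" "real n powr (\<gamma> - \<alpha>)"] S_nonneg[OF y, of j] that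
      by (simp add: w_def)
    show "(\<lambda>n. real n powr (\<gamma> - \<alpha>) * w n y j) \<longlonglongrightarrow> h y j" unfolding w_def by (rule h[OF y])
  qed (use F_bounds F_antimono F_lim rates in auto)
  interpret C: step_comparison S P \<alpha> lam p t \<gamma> F w "\<lambda>y j. real (m j) * y $ j" h E cE
    by (intro step_comparison.intro time_changed_chain_axioms step_comparison_axioms.intro thin E E1 E2 cE t0 t(2) rates(2))
  have b: "(\<lambda>q. path_weight S (C.B (Suc q)) x (Suc q) y) \<longlonglongrightarrow> R / d"
  proof -
    have "(\<lambda>q. path_weight S (C.B (Suc q)) x (Suc q) y)
      = (\<lambda>q. d * path_weight S (\<lambda>l z y. p (time_grid \<alpha> t (Suc q) l) (time_grid \<alpha> t (Suc q) (Suc l)) z y * E (Suc q) l y) x (Suc q) y / d)"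
      using d unfolding C.B_def[abs_def] by simp
    also have "\<dots> \<longlonglongrightarrow> R / d" using lim d by (intro tendsto_divide tendsto_const) auto
    finally show ?thesis .
  qed
  show ?thesis
  proof (rule C.transform_limit[OF xy _ b])
    fix n :: nat assume n: "1 \<le> n"
    interpret Q: rescaled_queue M S "rescaled_matrix \<gamma> P n" \<pi> "N n" "X n" L "lam * real n powr \<gamma>" "real n" t F
      "\<lambda>j. real (m j) / real n powr (\<gamma> - \<alpha>)"
      by (rule queue_locale) (use n t0 in auto)
    have "Q.step_matrix q = C.A n q" for q
      unfolding Q.step_matrix_def[abs_def] C.A_def[abs_def] C.thinned_def[abs_def] Q.\<phi>_def C.\<phi>_def w_def Q.grid_time_def ..
    moreover have "(\<integral>\<omega>. of_bool (X n 0 \<omega> = x) * exp (- (\<Sum>j\<in>UNIV. real (m j) / real n powr (\<gamma> - \<alpha>) * Z n \<omega> $ j)) * of_bool (X n (N n t \<omega>) \<omega> = y) \<partial>M)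
      = queue_laplace m x y n"
      by (intro Bochner_Integration.integral_cong) (auto simp: indicator_def divide_inverse mult.assoc)
    ultimately have "(\<lambda>q. \<pi> x * path_weight S (C.A n (Suc q)) x (Suc q) y) \<longlonglongrightarrow>
      queue_laplace m x y n"
      using Q.queue_transform[OF xy] by (simp add: Z_def)
    from tendsto_divide[OF this tendsto_const[of "\<pi> x"]] \<pi>
    show "(\<lambda>q. path_weight S (C.A n (Suc q)) x (Suc q) y) \<longlonglongrightarrow>
      queue_laplace m x y n / \<pi> x"
      by simp
  qed
qed

section \<open>The two regimes\<close>

lemma cell_length_nonneg:
  assumes "0 < t" "l < q"
  shows "0 \<le> lam / (1 - \<alpha>) * (time_grid \<alpha> t q (Suc l) - time_grid \<alpha> t q l)"
proof -
  interpret refining_partitions "time_grid \<alpha> t" "1 - t powr (1 - \<alpha>)" "\<lambda>q. (t / real q) powr (1 - \<alpha>)"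
    by (rule refining_time_grid) (use assms par in auto)
  show ?thesis using strict[OF assms(2)] par by simp
qed

lemma coefficient_bound:
  fixes H :: "real ^ 'k \<Rightarrow> real"
  assumes H: "\<And>y. y \<in> S \<Longrightarrow> 0 \<le> H y" and y: "y \<in> S"
  shows "H y + (H y)\<^sup>2 \<le> (\<Sum>y\<in>S. H y + (H y)\<^sup>2)"
  by (rule member_le_sum[OF y _ finS, of "\<lambda>y. H y + (H y)\<^sup>2"]) (use H in auto)

text \<open>The scaled weights linearize: \<open>c * (1 - exp (- (b / c)))\<close> tends to
  \<open>b\<close> as \<open>c\<close> grows. So \<open>h y j = m j * y j\<close>, and the weight of
  a cell is the exponential of a linear function of \<open>y\<close>, as for an integral over
  time.\<close>

lemma fast_arrivals:
  assumes t0: "0 < t" and fast: "\<alpha> < \<gamma>" and x: "x \<in> S" "0 < \<pi> x"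
  shows "converges_weakly
    (\<lambda>n. conditional_law M {\<omega> \<in> space M. X n 0 \<omega> = x} (\<lambda>\<omega>. (Z n \<omega> /\<^sub>R real n powr (\<gamma> - \<alpha>), X n (N n t \<omega>) \<omega>)))
    (conditional_law M' {\<omega> \<in> space M'. \<X> a \<omega> = x}
       (\<lambda>\<omega>. ((lam / (1 - \<alpha>)) *\<^sub>R (LINT v:{a..1}|lborel. \<X> v \<omega>), \<X> 1 \<omega>)))"
proof (rule conditional_pair_convergence[OF M M' finS, where mass="\<pi> x"])
  interpret I: limit_model M' S P \<alpha> lam p "time_grid \<alpha> t" a "\<lambda>q. (t / real q) powr (1 - \<alpha>)" \<X> \<nu> "\<lambda>_. 0"
    by (rule limit_locale) (use t0 in auto)
  note [measurable] = I.fluid_measurable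
  show "(\<lambda>\<omega>. fluid_integral \<omega>) \<in> borel_measurable M'"
    by (intro borel_measurable_scaleR borel_measurable_const I.fluid_measurable)
  show "0 \<le> fluid_integral \<omega> $ j" if "\<omega> \<in> space M'" for \<omega> j
    using I.fluid_nonneg[OF that] par by simp
  show "(\<lambda>\<omega>. Z n \<omega> /\<^sub>R real n powr (\<gamma> - \<alpha>)) \<in> borel_measurable M" if "1 \<le> n" for n
    by (intro borel_measurable_scaleR borel_measurable_const queue_measurable_nonneg that t0)
  show "0 \<le> (Z n \<omega> /\<^sub>R real n powr (\<gamma> - \<alpha>)) $ j" if "1 \<le> n" "\<omega> \<in> space M" for n \<omega> j
    using queue_measurable_nonneg(3)[OF that(1) t0 that(2), of j] by simp
next
  fix m :: "'k \<Rightarrow> nat" and y assume y: "y \<in> S"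
  interpret I: limit_model M' S P \<alpha> lam p "time_grid \<alpha> t" a "\<lambda>q. (t / real q) powr (1 - \<alpha>)" \<X> \<nu> "\<lambda>j. real (m j)"
    by (rule limit_locale) (use t0 in auto)
  define H where "H y = (\<Sum>j\<in>UNIV. real (m j) * y $ j)" for y :: "real ^ 'k"
  have H: "0 \<le> H y" if "y \<in> S" for y using S_nonneg[OF that] by (auto simp: H_def intro!: sum_nonneg)
  define cE where "cE = (\<Sum>y\<in>S. H y + (H y)\<^sup>2)"
  have cE: "0 \<le> cE" unfolding cE_def using H by (intro sum_nonneg) auto
  let ?\<eta> = "\<lambda>q l. lam / (1 - \<alpha>) * (time_grid \<alpha> t q (Suc l) - time_grid \<alpha> t q l)"
  let ?d = "M'.prob {\<omega> \<in> space M'. \<X> a \<omega> = x}"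
  have "(\<lambda>n. queue_laplace m x y n / \<pi> x)
    \<longlonglongrightarrow> (\<integral>\<omega>. of_bool (\<X> a \<omega> = x) *
      exp (- (\<Sum>j\<in>UNIV. real (m j) * fluid_integral \<omega> $ j)) * of_bool (\<X> 1 \<omega> = y) \<partial>M') / ?d"
  proof (rule transform_convergence[where h="\<lambda>y j. real (m j) * y $ j" and E="\<lambda>q l y. exp (- (?\<eta> q l * H y))" and cE=cE,
      OF t0 x(1) y x(2) _ cE])
    show "(\<lambda>n. real n powr (\<gamma> - \<alpha>) * (1 - exp (- (real (m j) / real n powr (\<gamma> - \<alpha>) * y $ j)))) \<longlonglongrightarrow> real (m j) * y $ j"
      if "y \<in> S" for y j
    proof -
      have "filterlim (\<lambda>n. real n powr (\<gamma> - \<alpha>)) at_top sequentially"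
        using fast by (intro powr_seq_at_top) auto
      from scaled_one_minus_exp_tendsto[OF _ this, of "real (m j) * y $ j"] show ?thesis
        using S_nonneg[OF that, of j] by simp
    qed
    fix q l :: nat and y assume ly: "l < q" "y \<in> S"
    note \<eta> = cell_length_nonneg[OF t0 ly(1)]
    note b = exponential_factor_bounds[OF \<eta> H[OF ly(2)]]
    have c: "H y + (H y)\<^sup>2 \<le> cE" unfolding cE_def by (rule coefficient_bound[OF H ly(2)])
    show "0 \<le> exp (- (?\<eta> q l * H y)) \<and> exp (- (?\<eta> q l * H y)) \<le> 1" by (rule b(1))
    show "1 - exp (- (?\<eta> q l * H y)) \<le> cE * ?\<eta> q l"
      using b(2) mult_right_mono[OF c \<eta>] by linarith
    show "\<bar>exp (- (?\<eta> q l * H y)) - (1 - ?\<eta> q l * (\<Sum>j\<in>UNIV. real (m j) * y $ j))\<bar> \<le> cE * (?\<eta> q l)\<^sup>2"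
      using b(3) mult_right_mono[OF c, of "(?\<eta> q l)\<^sup>2"] unfolding H_def[of y, symmetric] by simp
  next
    show "0 < ?d" by (rule start_pos[OF x])
    show "(\<lambda>q. ?d * path_weight S (\<lambda>l z y. p (time_grid \<alpha> t (Suc q) l) (time_grid \<alpha> t (Suc q) (Suc l)) z y *
        exp (- (?\<eta> (Suc q) l * H y))) x (Suc q) y)
      \<longlonglongrightarrow> (\<integral>\<omega>. of_bool (\<X> a \<omega> = x) *
      exp (- (\<Sum>j\<in>UNIV. real (m j) * fluid_integral \<omega> $ j)) * of_bool (\<X> 1 \<omega> = y) \<partial>M')"
      unfolding H_def using par by (intro I.fluid_transform x y) auto
  qed
  moreover have "(\<integral>\<omega>. of_bool (\<X> a \<omega> = x) *
      exp (- (\<Sum>j\<in>UNIV. real (m j) * fluid_integral \<omega> $ j)) * of_bool (\<X> 1 \<omega> = y) \<partial>M')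
    = (\<integral>\<omega>. indicator {\<omega> \<in> space M'. \<X> a \<omega> = x} \<omega> *
      exp (- (\<Sum>j\<in>UNIV. real (m j) * fluid_integral \<omega> $ j)) * of_bool (\<X> 1 \<omega> = y) \<partial>M')"
    by (intro Bochner_Integration.integral_cong) (auto simp: indicator_def)
  ultimately show "(\<lambda>n. queue_laplace m x y n / \<pi> x)
    \<longlonglongrightarrow> (\<integral>\<omega>. indicator {\<omega> \<in> space M'. \<X> a \<omega> = x} \<omega> *
      exp (- (\<Sum>j\<in>UNIV. real (m j) * fluid_integral \<omega> $ j)) * of_bool (\<X> 1 \<omega> = y) \<partial>M') / ?d"
    by simp
qed (use X0_event X0_prob x Xa_event start_pos queue_measurable_nonneg(2,4) t0 \<X>_1 in auto)

text \<open>For \<gamma> = \<alpha> the weights are the same for all positive n and keep their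
  exponential form, \<open>h y j = 1 - exp (- m j * y j)\<close>. This is the transform of jumps of
  size \<open>y j\<close>, hence the Poisson integrals.\<close>

lemma equilibrium:
  assumes t0: "0 < t" and eq: "\<gamma> = \<alpha>" and x: "x \<in> S" "0 < \<pi> x"
  shows "converges_weakly
    (\<lambda>n. conditional_law M {\<omega> \<in> space M. X n 0 \<omega> = x} (\<lambda>\<omega>. (Z n \<omega>, X n (N n t \<omega>) \<omega>)))
    (conditional_law M' {\<omega> \<in> space M'. \<X> a \<omega> = x}
       (\<lambda>\<omega>. (jump_vector \<omega>, \<X> 1 \<omega>)))"
proof (rule conditional_pair_convergence[OF M M' finS, where mass="\<pi> x"])
  interpret I: limit_model M' S P \<alpha> lam p "time_grid \<alpha> t" a "\<lambda>q. (t / real q) powr (1 - \<alpha>)" \<X> \<nu> "\<lambda>_. 0"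
    by (rule limit_locale) (use t0 in auto)
  show "(\<lambda>\<omega>. jump_vector \<omega>) \<in> borel_measurable M'"
    by (intro borel_measurable_vecI) (simp add: I.jump_measurable)
  show "0 \<le> jump_vector \<omega> $ j" if "\<omega> \<in> space M'" for \<omega> j
    using I.jump_nonneg[OF that] by simp
next
  fix m :: "'k \<Rightarrow> nat" and y assume y: "y \<in> S"
  interpret I: limit_model M' S P \<alpha> lam p "time_grid \<alpha> t" a "\<lambda>q. (t / real q) powr (1 - \<alpha>)" \<X> \<nu> "\<lambda>j. real (m j)"
    by (rule limit_locale) (use t0 in auto)
  define h where "h y j = 1 - exp (- (real (m j) * y $ j))" for y :: "real ^ 'k" and j
  define H where "H y = (\<Sum>j\<in>UNIV. h y j)" for y :: "real ^ 'k"
  have h: "0 \<le> h y j" "h y j \<le> 1" if "y \<in> S" for y j using S_nonneg[OF that, of j] by (auto simp: h_def)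
  have H: "0 \<le> H y" if "y \<in> S" for y using h[OF that] by (auto simp: H_def intro!: sum_nonneg)
  define cE where "cE = (\<Sum>y\<in>S. H y + (H y)\<^sup>2)"
  have cE: "0 \<le> cE" unfolding cE_def using H by (intro sum_nonneg) auto
  let ?\<eta> = "\<lambda>q l. lam / (1 - \<alpha>) * (time_grid \<alpha> t q (Suc l) - time_grid \<alpha> t q l)"
  let ?d = "M'.prob {\<omega> \<in> space M'. \<X> a \<omega> = x}"
  have "(\<lambda>n. queue_laplace m x y n / \<pi> x)
    \<longlonglongrightarrow> (\<integral>\<omega>. of_bool (\<X> a \<omega> = x) *
      exp (- (\<Sum>j\<in>UNIV. real (m j) * jump_integral a 1 (\<lambda>v. \<X> v \<omega> $ j) (\<lambda>v. \<nu> j v \<omega>))) * of_bool (\<X> 1 \<omega> = y) \<partial>M') / ?d"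
  proof (rule transform_convergence[where h=h and E=I.jump_factor and cE=cE, OF t0 x(1) y x(2) _ cE])
    show "(\<lambda>n. real n powr (\<gamma> - \<alpha>) * (1 - exp (- (real (m j) / real n powr (\<gamma> - \<alpha>) * y $ j)))) \<longlonglongrightarrow> h y j" for y j
      by (rule tendsto_eventually, rule eventually_sequentiallyI[of 1]) (simp add: eq h_def)
    fix q l :: nat and y assume ly: "l < q" "y \<in> S"
    note \<eta> = cell_length_nonneg[OF t0 ly(1)]
    have E: "I.jump_factor q l y = (\<Prod>j\<in>UNIV. 1 - h y j * (1 - exp (- ?\<eta> q l)))"
      by (simp add: I.jump_factor_def h_def)
    note b = product_factor_bounds[where h="h y", OF \<eta> h[OF ly(2)], folded H_def]
    have c: "H y + (H y)\<^sup>2 \<le> cE" unfolding cE_def by (rule coefficient_bound[OF H ly(2)])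
    show "0 \<le> I.jump_factor q l y \<and> I.jump_factor q l y \<le> 1" unfolding E by (rule b(1))
    show "1 - I.jump_factor q l y \<le> cE * ?\<eta> q l"
      unfolding E using b(2) mult_right_mono[OF c \<eta>] by linarith
    show "\<bar>I.jump_factor q l y - (1 - ?\<eta> q l * (\<Sum>j\<in>UNIV. h y j))\<bar> \<le> cE * (?\<eta> q l)\<^sup>2"
      using b(3) mult_right_mono[OF c, of "(?\<eta> q l)\<^sup>2"] unfolding E H_def[of y, symmetric] by simp
  next
    show "0 < ?d" by (rule start_pos[OF x])
  qed (rule I.jump_transform[OF x(1) y])
  moreover have "(\<integral>\<omega>. of_bool (\<X> a \<omega> = x) *
      exp (- (\<Sum>j\<in>UNIV. real (m j) * jump_integral a 1 (\<lambda>v. \<X> v \<omega> $ j) (\<lambda>v. \<nu> j v \<omega>))) * of_bool (\<X> 1 \<omega> = y) \<partial>M')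
    = (\<integral>\<omega>. indicator {\<omega> \<in> space M'. \<X> a \<omega> = x} \<omega> *
      exp (- (\<Sum>j\<in>UNIV. real (m j) * jump_vector \<omega> $ j)) * of_bool (\<X> 1 \<omega> = y) \<partial>M')"
    by (intro Bochner_Integration.integral_cong) (auto simp: indicator_def)
  \<comment> \<open>The scaling factor is \<open>n powr 0\<close>, which is 1 for positive n but 0
    for n = 0; the sequences are shown to agree only eventually.\<close>
  moreover have "(\<lambda>n. queue_laplace m x y n / \<pi> x)
    \<longlonglongrightarrow> R \<Longrightarrow> (\<lambda>n. (\<integral>\<omega>. indicator {\<omega> \<in> space M. X n 0 \<omega> = x} \<omega> *
      exp (- (\<Sum>j\<in>UNIV. real (m j) * Z n \<omega> $ j)) * of_bool (X n (N n t \<omega>) \<omega> = y) \<partial>M) / \<pi> x) \<longlonglongrightarrow> R" for R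
    by (erule Lim_transform_eventually, rule eventually_sequentiallyI[of 1]) (simp add: eq)
  ultimately show "(\<lambda>n. (\<integral>\<omega>. indicator {\<omega> \<in> space M. X n 0 \<omega> = x} \<omega> *
      exp (- (\<Sum>j\<in>UNIV. real (m j) * Z n \<omega> $ j)) * of_bool (X n (N n t \<omega>) \<omega> = y) \<partial>M) / \<pi> x)
    \<longlonglongrightarrow> (\<integral>\<omega>. indicator {\<omega> \<in> space M'. \<X> a \<omega> = x} \<omega> *
      exp (- (\<Sum>j\<in>UNIV. real (m j) * jump_vector \<omega> $ j)) * of_bool (\<X> 1 \<omega> = y) \<partial>M') / ?d"
    by simp
qed (use X0_event X0_prob x Xa_event start_pos queue_measurable_nonneg t0 \<X>_1 in auto)

end

lemma set_integral_singleton: "(LINT v:{c}|lborel. f v) = (0 :: 'b::euclidean_space)" for c :: real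
  unfolding set_lebesgue_integral_def
  by (rule integral_eq_zero_AE) (use AE_lborel_singleton[of c] in \<open>eventually_elim, auto\<close>)

theorem theorem2:
  fixes K :: nat
    and P :: "real ^ 'k \<Rightarrow> real ^ 'k \<Rightarrow> real"
    and \<pi> :: "real ^ 'k \<Rightarrow> real"
    and lam \<gamma> \<alpha> t :: real
    and M :: "'a measure"
    and N :: "nat \<Rightarrow> real \<Rightarrow> 'a \<Rightarrow> nat"
    and X :: "nat \<Rightarrow> nat \<Rightarrow> 'a \<Rightarrow> real ^ 'k"
    and L :: "nat \<Rightarrow> 'k \<Rightarrow> 'a \<Rightarrow> real"
    and M' :: "'b measure"
    and \<X> :: "real \<Rightarrow> 'b \<Rightarrow> real ^ 'k"
    and \<nu> :: "'k \<Rightarrow> real \<Rightarrow> 'b \<Rightarrow> nat"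
  defines "S \<equiv> (state_space K :: (real ^ 'k) set)"
    and "a \<equiv> 1 - t powr (1 - \<alpha>)"
    and "Z \<equiv> \<lambda>n. queue_process (N n) (X n) (\<lambda>i j \<omega>. L i j \<omega> / real n) t"
  assumes "1 \<le> K"
    and "0 < lam" and "0 < \<gamma>" and "0 < \<alpha>" and "\<alpha> < 1"
    and "stochastic_matrix_on S P" and "stationary_distribution_on S P \<pi>"
    \<comment> \<open>the rescaled model\<close>
    and "prob_space M"
    and "service_times M \<alpha> L"
    and "\<And>n. 1 \<le> n \<Longrightarrow> poisson_process M {0..} (lam * real n powr \<gamma>) (N n)"
    and "\<And>n. 1 \<le> n \<Longrightarrow> markov_chain M S \<pi> (rescaled_matrix \<gamma> P n) (X n)"
    and "\<And>n. 1 \<le> n \<Longrightarrow> prob_space.indep_sets M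
           (\<lambda>m. [generated_events M (count_space UNIV) (N n) {0..},
                 generated_events M borel (X n) UNIV,
                 generated_events M borel (\<lambda>(i, j). L i j) UNIV] ! m) {..<3}"
    \<comment> \<open>the limit processes\<close>
    and "prob_space M'"
    and "ct_markov_chain M' S \<pi> (limit_generator \<alpha> lam P) \<X>"
    and "\<And>j. poisson_process M' {0..1} (lam / (1 - \<alpha>)) (\<nu> j)"
    and "prob_space.indep_sets M'
           (\<lambda>m. case m of
                  None \<Rightarrow> generated_events M' borel \<X> {0..1}
                | Some j \<Rightarrow> generated_events M' (count_space UNIV) (\<nu> j) {0..1}) UNIV"
    and "0 \<le> t" and "t \<le> 1"
  shows
    "(\<alpha> < \<gamma> \<longrightarrow> (\<forall>x\<in>S. 0 < \<pi> x \<longrightarrow>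
        converges_weakly
          (\<lambda>n. conditional_law M {\<omega> \<in> space M. X n 0 \<omega> = x}
                 (\<lambda>\<omega>. (Z n \<omega> /\<^sub>R real n powr (\<gamma> - \<alpha>), X n (N n t \<omega>) \<omega>)))
          (conditional_law M' {\<omega> \<in> space M'. \<X> a \<omega> = x}
             (\<lambda>\<omega>. ((lam / (1 - \<alpha>)) *\<^sub>R (LINT v:{a..1}|lborel. \<X> v \<omega>), \<X> 1 \<omega>))))) \<and>
     (\<gamma> = \<alpha> \<longrightarrow> (\<forall>x\<in>S. 0 < \<pi> x \<longrightarrow>
        converges_weakly
          (\<lambda>n. conditional_law M {\<omega> \<in> space M. X n 0 \<omega> = x}
                 (\<lambda>\<omega>. (Z n \<omega>, X n (N n t \<omega>) \<omega>)))
          (conditional_law M' {\<omega> \<in> space M'. \<X> a \<omega> = x}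
             (\<lambda>\<omega>. (\<chi> j. jump_integral a 1 (\<lambda>v. \<X> v \<omega> $ j) (\<lambda>v. \<nu> j v \<omega>), \<X> 1 \<omega>)))))"
proof -
  from assms(17) obtain p where p: "transition_function S p" "has_generator S p (limit_generator \<alpha> lam P)"
    and law: "\<forall>m s x. (\<forall>i\<le>Suc m. s i \<in> {0..1} \<and> x i \<in> S) \<and> (\<forall>i\<le>m. s i < s (Suc i)) \<and>
            \<P>(\<omega> in M'. \<forall>i\<le>m. \<X> (s i) \<omega> = x i) > 0 \<longrightarrow>
          \<P>(\<omega> in M'. \<X> (s (Suc m)) \<omega> = x (Suc m) \<bar> \<forall>i\<le>m. \<X> (s i) \<omega> = x i)
            = p (s m) (s (Suc m)) (x m) (x (Suc m))"
    unfolding ct_markov_chain_def by blast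
  interpret D: scaling_limit K P \<pi> lam \<gamma> \<alpha> t M N X L M' \<X> \<nu> S p
    by (rule scaling_limit.intro) (fact assms p | use assms(1) law in blast)+
  have a: "D.a = a" and Z: "D.Z = Z"
    by (simp_all add: D.a_def D.Z_def[abs_def] assms(2,3))
  show ?thesis
  proof (cases "t = 0")
    case True
    then have a1: "a = 1" by (simp add: assms(2))
    \<comment> \<open>With \<open>a = 1\<close> one integral runs over a single point and the other
      over an empty set of jump times.\<close>
    have "(lam / (1 - \<alpha>)) *\<^sub>R (LINT v:{a..1}|lborel. \<X> v \<omega>) = 0"
      and "(\<chi> j. jump_integral a 1 (\<lambda>v. \<X> v \<omega> $ j) (\<lambda>v. \<nu> j v \<omega>)) = 0" for \<omega>
      by (simp_all add: a1 set_integral_singleton jump_integral_def vec_eq_iff)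
    then show ?thesis
      using D.time_zero[OF True, where r="\<lambda>n. real n powr (\<gamma> - \<alpha>)" and Z'="\<lambda>\<omega>. (lam / (1 - \<alpha>)) *\<^sub>R (LINT v:{a..1}|lborel. \<X> v \<omega>)"]
        D.time_zero[OF True, where r="\<lambda>n. 1" and Z'="\<lambda>\<omega>. \<chi> j. jump_integral a 1 (\<lambda>v. \<X> v \<omega> $ j) (\<lambda>v. \<nu> j v \<omega>)"]
      unfolding a Z by auto
  next
    case False
    then have "0 < t" using assms(20) by simp
    then show ?thesis using D.fast_arrivals D.equilibrium unfolding a Z by blast
  qed
qed

end
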